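(* Let $p\geq 3$ be a prime, $n\in\mathbb{Z}_p$, and $\phi(\mathbf{x})=\sum_{i=1}^r(b_ix_i^2+c_ix_i)$ with $b_i,c_i\in\mathbb{Z}_p$. For $1\le i\le r$ let $t_i=\min(\operatorname{ord}_p(b_i),\operatorname{ord}_p(c_i))$, and set $D_p=\{i:\operatorname{ord}_p(b_i)>\operatorname{ord}_p(c_i)\}$, $N_p=\{i:\operatorname{ord}_p(b_i)\le\operatorname{ord}_p(c_i)\}$, $\mathfrak{t}_d=\min\{t_i: i\in D_p\}$, and $$\mathfrak{n}=n+\sum_{i\in N_p}\frac{c_i^2}{4b_i}.$$ If $\mathfrak{n}\ne0$ write $\mathfrak{n}=\mathfrak{u}_np^{\mathfrak{t}_n}$ with $\mathfrak{u}_n\in\mathbb{Z}_p^\times$, $\mathfrak{t}_n\in\mathbb{Z}$; otherwise $\mathfrak{t}_n=\infty$. For $t\in\mathbb{Z}$ let $\mathcal{L}_p(t)=\{i\in N_p: t_i-t<0\text{ and } t_i-t \text{ odd}\}$, $\ell_p(t)=|\mathcal{L}_p(t)|$, $$\delta_p(t)=\varepsilon_p^{3\ell_p(t)}\prod_{i\in\mathcal{L}_p(t)}\left(\frac{u_i}{p}\right),\qquad \tau_p(t)=t+\sum_{i\in N_p,\ t_i<t}\frac{t_i-t}{2},$$ where $u_i=p^{-\operatorname{ord}_p(b_i)}b_i\in\mathbb{Z}_p^\times$, and let $\omega_p=0$ if $\mathfrak{t}_n\ge\mathfrak{t}_d$; $\omega_p=-\frac1p$ if $\mathfrak{t}_n<\mathfrak{t}_d$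 and $\ell_p(\mathfrak{t}_n+1)$ is even; $\omega_p=\varepsilon_p\left(\frac{\mathfrak{u}_n}{p}\right)\frac{1}{\sqrt p}$ if $\mathfrak{t}_n<\mathfrak{t}_d$ and $\ell_p(\mathfrak{t}_n+1)$ is odd. Then $$I_p(n;\phi)=1+\left(1-\frac1p\right)\sum_{\substack{1\le t\le\min(\mathfrak{t}_d,\mathfrak{t}_n)\\ \ell_p(t)\text{ even}}}\delta_p(t)p^{\tau_p(t)}+\delta_p(\mathfrak{t}_n+1)\,\omega_p\,p^{\tau_p(\mathfrak{t}_n+1)}.$$
   Context: For $\alpha\in\mathbb{Q}_p$, $e_p(\alpha)=e^{-2\pi i a}$ where $a\in\bigcup_{t\ge1}p^{-t}\mathbb{Z}$ satisfies $\alpha-a\in\mathbb{Z}_p$. Haar measures on $\mathbb{Q}_p$ and $\mathbb{Q}_p^r$ are normalized so that $\mathbb{Z}_p$ and $\mathbb{Z}_p^r$ have volume $1$. For $\phi$ as in the claim, $I_p(n;\phi)=\int_{\mathbb{Q}_p}\int_{\mathbb{Z}_p^r}e_p(\sigma(\phi(\mathbf{x})-n))\,d\mathbf{x}\,d\sigma$. $\varepsilon_p=1$ if $p\equiv1\pmod4$ and $\varepsilon_p=i$ if $p\equiv3\pmod 4$; $\left(\frac{u}{p}\right)$ for $u\in\mathbb{Z}_p^\times$ is the Legendre symbol of its reduction mod $p$. Conventions: $\infty$ is a formal symbol with $t\le\infty$ and $t+\infty=\infty+t=\infty$ for all $t\in\mathbb{Z}$; the minimum of the empty set is $\infty$; $\operatorname{ord}_p(0)=\infty$.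 *)

theory Defs
  imports
    "HOL-Analysis.Analysis"
    "HOL-Computational_Algebra.Squarefree"
    "HOL-Number_Theory.Number_Theory"
    "Berlekamp_Zassenhaus.Finite_Field"
begin

section \<open>The field of p-adic numbers\<close>

subsection \<open>The p-adic absolute value on the rationals\<close>

definition rat_ord :: "nat \<Rightarrow> rat \<Rightarrow> int" where
  "rat_ord p q = (case quotient_of q of (a, b) \<Rightarrow>
     int (multiplicity (int p) a) - int (multiplicity (int p) b))"

definition rat_abs :: "nat \<Rightarrow> rat \<Rightarrow> real" where
  "rat_abs p q = (if q = 0 then 0 else real p powi (- rat_ord p q))"

lemma rat_ord_divide:
  assumes "prime p" "a \<noteq> 0" "b \<noteq> 0"
  shows "rat_ord p (of_int a / of_int b) =
    int (multiplicity (int p) a) - int (multiplicity (int p) b)"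
proof -
  obtain c d where cd: "quotient_of (of_int a / of_int b :: rat) = (c, d)"
    by fastforce
  have d: "d > 0" using quotient_of_denom_pos[OF cd] .
  have eq: "(of_int a / of_int b :: rat) = of_int c / of_int d"
    using quotient_of_div[OF cd] .
  have c: "c \<noteq> 0" using eq assms d by auto
  have "(of_int (a * d) :: rat) = of_int (c * b)"
    using eq assms d by (simp add: field_simps)
  then have "a * d = c * b" by (simp only: of_int_eq_iff)
  moreover have pr: "prime_elem (int p)" using assms(1) by simp
  ultimately have "multiplicity (int p) a + multiplicity (int p) d
      = multiplicity (int p) c + multiplicity (int p) b"
    using prime_elem_multiplicity_mult_distrib[OF pr] assms c d
    by (metis less_irrefl)
  then show ?thesis unfolding rat_ord_def cd by simp
qed

lemma rat_ord_mult:
  assumes "prime p" "x \<noteq> 0" "y \<noteq> 0"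
  shows "rat_ord p (x * y) = rat_ord p x + rat_ord p y"
proof -
  obtain a b where x: "x = of_int a / of_int b" "b \<noteq> 0"
    by (metis quotient_of_div quotient_of_denom_pos surj_pair less_irrefl)
  obtain c d where y: "y = of_int c / of_int d" "d \<noteq> 0"
    by (metis quotient_of_div quotient_of_denom_pos surj_pair less_irrefl)
  have nz: "a \<noteq> 0" "c \<noteq> 0" using x y assms by auto
  have "x * y = of_int (a * c) / of_int (b * d)" using x y by simp
  then have "rat_ord p (x * y) = int (multiplicity (int p) (a * c)) - int (multiplicity (int p) (b * d))"
    using rat_ord_divide[OF assms(1), of "a*c" "b*d"] x y nz by simp
  also have "\<dots> = rat_ord p x + rat_ord p y"
    using rat_ord_divide[OF assms(1)] x y nz assms(1)
    by (simp add: prime_elem_multiplicity_mult_distrib)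
  finally show ?thesis .
qed

lemma rat_abs_nonneg [simp]: "rat_abs p x \<ge> 0"
  by (simp add: rat_abs_def)

lemma rat_abs_0 [simp]: "rat_abs p 0 = 0"
  by (simp add: rat_abs_def)

lemma rat_ord_1 [simp]: "rat_ord p 1 = 0"
  by (simp add: rat_ord_def)

lemma rat_abs_1 [simp]: "rat_abs p 1 = 1"
  by (simp add: rat_abs_def)

lemma rat_abs_minus [simp]: "rat_abs p (- x) = rat_abs p x"
  by (simp add: rat_abs_def rat_ord_def rat_uminus_code
      split: prod.splits)

lemma rat_abs_minus_commute: "rat_abs p (x - y) = rat_abs p (y - x)"
  by (metis minus_diff_eq rat_abs_minus)

lemma rat_abs_eq_0_iff: "prime p \<Longrightarrow> rat_abs p x = 0 \<longleftrightarrow> x = 0"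
  using prime_gt_0_nat[of p] by (auto simp: rat_abs_def power_int_eq_0_iff)

lemma rat_abs_mult:
  assumes "prime p" shows "rat_abs p (x * y) = rat_abs p x * rat_abs p y"
  using assms prime_gt_0_nat[of p] rat_ord_mult[of p x y]
  by (auto simp: rat_abs_def power_int_add power_int_diff power_int_minus field_simps)

lemma rat_abs_inverse:
  assumes "prime p" shows "rat_abs p (inverse x) = inverse (rat_abs p x)"
proof (cases "x = 0")
  case False
  then have "rat_abs p x * rat_abs p (inverse x) = 1"
    using rat_abs_mult[OF assms, of x "inverse x"] by simp
  then show ?thesis by (metis inverse_unique)
qed simp

lemma rat_abs_add_1:
  assumes p: "prime p" and x: "rat_abs p x \<le> 1"
  shows "rat_abs p (1 + x) \<le> 1"
proof (cases "x = 0 \<or> 1 + x = 0")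
  case False
  obtain a b where ab: "quotient_of x = (a, b)" by fastforce
  have b: "b > 0" using quotient_of_denom_pos[OF ab] .
  have xe: "x = of_int a / of_int b" using quotient_of_div[OF ab] .
  have cop: "coprime a b" using quotient_of_coprime[OF ab] .
  have a0: "a \<noteq> 0" using xe False by auto
  have "rat_ord p x \<ge> 0"
  proof (rule ccontr)
    assume "\<not> ?thesis"
    then have "real p powi 0 < real p powi (- rat_ord p x)"
      using prime_gt_1_nat[OF p] by (intro power_int_strict_increasing) auto
    with x False show False by (simp add: rat_abs_def)
  qed
  moreover have xo: "rat_ord p x = int (multiplicity (int p) a) - int (multiplicity (int p) b)"
    by (simp add: rat_ord_def ab)
  ultimately have le: "multiplicity (int p) b \<le> multiplicity (int p) a" by simp
  have mb: "multiplicity (int p) b = 0"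
  proof (rule ccontr)
    assume "multiplicity (int p) b \<noteq> 0"
    then have "int p dvd b" "int p dvd a" using le
      by (metis not_dvd_imp_multiplicity_0 le_zero_eq)+
    with cop p show False
      by (meson coprime_common_divisor not_prime_unit prime_nat_int_transfer)
  qed
  have e: "1 + x = of_int (a + b) / of_int b" using xe b by (simp add: field_simps)
  have "a + b \<noteq> 0" using e False by auto
  then have "rat_ord p (1 + x) = int (multiplicity (int p) (a + b))"
    using rat_ord_divide[OF p, of "a + b" b] e b mb by simp
  then have "real p powi (- rat_ord p (1 + x)) \<le> real p powi 0"
    using prime_gt_1_nat[OF p] by (intro power_int_increasing) auto
  then show ?thesis by (simp add: rat_abs_def)
qed auto

lemma rat_abs_add_le_max:
  assumes p: "prime p"
  shows "rat_abs p (x + y) \<le> max (rat_abs p x) (rat_abs p y)"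
proof -
  have *: "rat_abs p (x + y) \<le> rat_abs p x" if "rat_abs p y \<le> rat_abs p x" for x y
  proof (cases "x = 0")
    case True
    with that show ?thesis by simp
  next
    case False
    then have pos: "rat_abs p x > 0"
      using rat_abs_eq_0_iff[OF p, of x] rat_abs_nonneg[of p x] by linarith
    have "rat_abs p (y / x) \<le> 1" using that pos
      unfolding divide_inverse rat_abs_mult[OF p] rat_abs_inverse[OF p]
      by (simp add: divide_inverse[symmetric])
    then have "rat_abs p (1 + y / x) \<le> 1" by (rule rat_abs_add_1[OF p])
    then have "rat_abs p x * rat_abs p (1 + y / x) \<le> rat_abs p x * 1"
      by (rule mult_left_mono) simp
    moreover have "x + y = x * (1 + y / x)" using False by (simp add: distrib_left)
    ultimately show ?thesis by (metis rat_abs_mult[OF p] mult.right_neutral)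
  qed
  show ?thesis
    using *[of y x] *[of x y] by (cases "rat_abs p y \<le> rat_abs p x") (auto simp: add.commute)
qed

lemma rat_abs_triangle:
  assumes "prime p" shows "rat_abs p (x + y) \<le> rat_abs p x + rat_abs p y"
  using rat_abs_add_le_max[OF assms, of x y] rat_abs_nonneg[of p x] rat_abs_nonneg[of p y]
  by linarith

lemma rat_abs_diff_abs:
  assumes "prime p" shows "\<bar>rat_abs p x - rat_abs p y\<bar> \<le> rat_abs p (x - y)"
  using rat_abs_triangle[OF assms, of "x - y" y] rat_abs_triangle[OF assms, of "y - x" x]
  by (simp add: rat_abs_minus_commute)

subsection \<open>Completion\<close>

definition padic_cauchy :: "nat \<Rightarrow> (nat \<Rightarrow> rat) \<Rightarrow> bool" where
  "padic_cauchy p X \<longleftrightarrow> (\<forall>e>0. \<exists>M. \<forall>m\<ge>M. \<forall>n\<ge>M. rat_abs p (X m - X n) < e)"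

definition padic_null :: "nat \<Rightarrow> (nat \<Rightarrow> rat) \<Rightarrow> bool" where
  "padic_null p X \<longleftrightarrow> (\<lambda>n. rat_abs p (X n)) \<longlonglongrightarrow> 0"

lemma padic_null_add:
  assumes "prime p" "padic_null p X" "padic_null p Y"
  shows "padic_null p (\<lambda>n. X n + Y n)"
  unfolding padic_null_def
proof (rule tendsto_sandwich[OF _ _ tendsto_const])
  show "(\<lambda>n. rat_abs p (X n) + rat_abs p (Y n)) \<longlonglongrightarrow> 0"
    using tendsto_add[OF assms(2,3)[unfolded padic_null_def]] by simp
qed (auto simp: rat_abs_triangle[OF assms(1)])

lemma padic_null_minus: "padic_null p X \<Longrightarrow> padic_null p (\<lambda>n. - X n)"
  by (simp add: padic_null_def)

lemma padic_null_0 [simp]: "padic_null p (\<lambda>n. 0)"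
  by (simp add: padic_null_def)

lemma padic_cauchy_const [simp]: "padic_cauchy p (\<lambda>n. c)"
  by (simp add: padic_cauchy_def)

lemma padic_cauchy_add:
  assumes p: "prime p" and "padic_cauchy p X" "padic_cauchy p Y"
  shows "padic_cauchy p (\<lambda>n. X n + Y n)"
  unfolding padic_cauchy_def
proof (intro allI impI)
  fix e :: real assume e: "e > 0"
  obtain M where M: "\<forall>m\<ge>M. \<forall>n\<ge>M. rat_abs p (X m - X n) < e"
    using assms(2) e by (auto simp: padic_cauchy_def)
  obtain N where N: "\<forall>m\<ge>N. \<forall>n\<ge>N. rat_abs p (Y m - Y n) < e"
    using assms(3) e by (auto simp: padic_cauchy_def)
  have "rat_abs p (X m + Y m - (X n + Y n)) < e" if "m \<ge> max M N" "n \<ge> max M N" for m n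
  proof -
    have "rat_abs p (X m - X n) < e" "rat_abs p (Y m - Y n) < e" using M N that by simp_all
    then show ?thesis
      using rat_abs_add_le_max[OF p, of "X m - X n" "Y m - Y n"] by (simp add: add_diff_add)
  qed
  then show "\<exists>M. \<forall>m\<ge>M. \<forall>n\<ge>M. rat_abs p (X m + Y m - (X n + Y n)) < e"
    by (intro exI[of _ "max M N"] allI impI)
qed

lemma padic_cauchy_minus: "padic_cauchy p X \<Longrightarrow> padic_cauchy p (\<lambda>n. - X n)"
  by (simp add: padic_cauchy_def) (metis rat_abs_minus_commute)

lemma padic_cauchy_abs_convergent:
  assumes p: "prime p" and "padic_cauchy p X"
  shows "convergent (\<lambda>n. rat_abs p (X n))"
proof -
  have "Cauchy (\<lambda>n. rat_abs p (X n))"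
    unfolding Cauchy_def dist_real_def
    using assms(2) rat_abs_diff_abs[OF p] by (meson padic_cauchy_def order_le_less_trans)
  then show ?thesis by (rule Cauchy_convergent)
qed

lemma padic_cauchy_bounded:
  assumes "prime p" "padic_cauchy p X"
  obtains B where "B > 0" "\<And>n. rat_abs p (X n) \<le> B"
proof -
  have "Bseq (\<lambda>n. rat_abs p (X n))"
    using padic_cauchy_abs_convergent[OF assms] by (rule convergent_imp_Bseq)
  then show ?thesis using that by (auto simp: Bseq_def)
qed

lemma padic_null_mult:
  assumes p: "prime p" and "padic_null p X" "padic_cauchy p Y"
  shows "padic_null p (\<lambda>n. X n * Y n)"
proof -
  obtain B where B: "B > 0" "\<And>n. rat_abs p (Y n) \<le> B"
    using padic_cauchy_bounded[OF p assms(3)] by metis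
  show ?thesis
    unfolding padic_null_def
  proof (rule tendsto_sandwich[OF _ _ tendsto_const])
    show "(\<lambda>n. rat_abs p (X n) * B) \<longlonglongrightarrow> 0"
      using tendsto_mult_right[OF assms(2)[unfolded padic_null_def], of B] by simp
  qed (use B in \<open>auto simp: rat_abs_mult[OF p] intro!: always_eventually mult_left_mono\<close>)
qed

lemma padic_cauchy_mult:
  assumes p: "prime p" and X: "padic_cauchy p X" and Y: "padic_cauchy p Y"
  shows "padic_cauchy p (\<lambda>n. X n * Y n)"
  unfolding padic_cauchy_def
proof (intro allI impI)
  fix e :: real assume e: "e > 0"
  obtain B where B: "B > 0" "\<And>n. rat_abs p (X n) \<le> B"
    using padic_cauchy_bounded[OF p X] by metis
  obtain C where C: "C > 0" "\<And>n. rat_abs p (Y n) \<le> C"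
    using padic_cauchy_bounded[OF p Y] by metis
  have eB: "e / (2 * B) > 0" and eC: "e / (2 * C) > 0" using e B(1) C(1) by simp_all
  obtain M where M: "\<forall>m\<ge>M. \<forall>n\<ge>M. rat_abs p (X m - X n) < e / (2 * C)"
    using X eC unfolding padic_cauchy_def by blast
  obtain N where N: "\<forall>m\<ge>N. \<forall>n\<ge>N. rat_abs p (Y m - Y n) < e / (2 * B)"
    using Y eB unfolding padic_cauchy_def by blast
  have "rat_abs p (X m * Y m - X n * Y n) < e" if mn: "m \<ge> max M N" "n \<ge> max M N" for m n
  proof -
    have "rat_abs p (X m * Y m - X n * Y n)
        = rat_abs p (X m * (Y m - Y n) + (X m - X n) * Y n)"
      by (rule arg_cong[of _ _ "rat_abs p"]) (simp only: left_diff_distrib right_diff_distrib diff_add_eq add_diff_eq diff_add_cancel)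
    also have "\<dots> \<le> rat_abs p (X m) * rat_abs p (Y m - Y n) + rat_abs p (X m - X n) * rat_abs p (Y n)"
      using rat_abs_triangle[OF p, of "X m * (Y m - Y n)" "(X m - X n) * Y n"]
      by (simp only: rat_abs_mult[OF p])
    also have "\<dots> \<le> B * rat_abs p (Y m - Y n) + rat_abs p (X m - X n) * C"
      by (intro add_mono mult_right_mono mult_left_mono B C) auto
    also have "\<dots> < B * (e / (2 * B)) + e / (2 * C) * C"
    proof (intro add_strict_mono mult_strict_left_mono mult_strict_right_mono)
      show "rat_abs p (Y m - Y n) < e / (2 * B)" using N mn by simp
      show "rat_abs p (X m - X n) < e / (2 * C)" using M mn by simp
    qed (use B(1) C(1) in simp_all)
    also have "\<dots> = e" using B(1) C(1) by simp
    finally show ?thesis .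
  qed
  then show "\<exists>M. \<forall>m\<ge>M. \<forall>n\<ge>M. rat_abs p (X m * Y m - X n * Y n) < e"
    by (intro exI[of _ "max M N"] allI impI)
qed

lemma padic_cauchy_not_null:
  assumes p: "prime p" and X: "padic_cauchy p X" "\<not> padic_null p X"
  obtains c M where "c > 0" "\<And>n. n \<ge> M \<Longrightarrow> rat_abs p (X n) = c"
proof -
  obtain L where L: "(\<lambda>n. rat_abs p (X n)) \<longlonglongrightarrow> L"
    using padic_cauchy_abs_convergent[OF p X(1)] by (auto simp: convergent_def)
  have "L \<ge> 0" using L by (rule LIMSEQ_le_const) auto
  with L X(2) have L0: "L > 0" by (cases "L = 0") (auto simp: padic_null_def)
  obtain M where M: "\<forall>m\<ge>M. \<forall>n\<ge>M. rat_abs p (X m - X n) < L / 2"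
    using X(1) L0 half_gt_zero unfolding padic_cauchy_def by blast
  have "\<forall>\<^sub>F n in sequentially. rat_abs p (X n) > L / 2"
    using order_tendstoD(1)[OF L, of "L / 2"] L0 by simp
  then obtain N where N: "\<And>n. n \<ge> N \<Longrightarrow> rat_abs p (X n) > L / 2"
    by (auto simp: eventually_sequentially)
  let ?K = "max M N"
  have "rat_abs p (X n) = rat_abs p (X ?K)" if n: "n \<ge> ?K" for n
  proof -
    have "rat_abs p (X n - X ?K) < L / 2" "rat_abs p (X ?K - X n) < L / 2"
      using M n by auto
    moreover have "rat_abs p (X n) > L / 2" "rat_abs p (X ?K) > L / 2" using N n by auto
    ultimately show ?thesis
      using rat_abs_add_le_max[OF p, of "X n - X ?K" "X ?K"]
        rat_abs_add_le_max[OF p, of "X ?K - X n" "X n"] by (auto simp: max_def split: if_splits)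
  qed
  moreover have "rat_abs p (X ?K) > 0" using N[of ?K] L0 by simp
  ultimately show ?thesis using that by blast
qed

lemma padic_cauchy_inverse:
  assumes p: "prime p" and X: "padic_cauchy p X" "\<not> padic_null p X"
  shows "padic_cauchy p (\<lambda>n. inverse (X n))"
  unfolding padic_cauchy_def
proof (intro allI impI)
  fix e :: real assume e: "e > 0"
  obtain c K where c: "c > 0" "\<And>n. n \<ge> K \<Longrightarrow> rat_abs p (X n) = c"
    using padic_cauchy_not_null[OF p X] by metis
  have ec: "e * c * c > 0" using e c(1) by simp
  obtain M where M: "\<forall>m\<ge>M. \<forall>n\<ge>M. rat_abs p (X m - X n) < e * c * c"
    using X(1) ec unfolding padic_cauchy_def by blast
  have "rat_abs p (inverse (X m) - inverse (X n)) < e" if mn: "m \<ge> max K M" "n \<ge> max K M" for m n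
  proof -
    have nz: "X m \<noteq> 0" "X n \<noteq> 0" using c(2)[of m] c(2)[of n] c(1) mn by auto
    then have "inverse (X m) - inverse (X n) = (X n - X m) * (inverse (X m) * inverse (X n))"
      by (simp add: field_simps)
    then have "rat_abs p (inverse (X m) - inverse (X n)) = rat_abs p (X n - X m) * (inverse c * inverse c)"
      using c mn by (simp add: rat_abs_mult[OF p] rat_abs_inverse[OF p])
    also have "\<dots> < e * c * c * (inverse c * inverse c)"
      using M mn c by (intro mult_strict_right_mono) auto
    also have "\<dots> = e" using c(1) by (simp add: field_simps)
    finally show ?thesis .
  qed
  then show "\<exists>M. \<forall>m\<ge>M. \<forall>n\<ge>M. rat_abs p (inverse (X m) - inverse (X n)) < e"
    by (intro exI[of _ "max K M"] allI impI)
qed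

lemma padic_null_inverse_mult:
  assumes p: "prime p" and X: "padic_cauchy p X" "\<not> padic_null p X"
  shows "padic_null p (\<lambda>n. inverse (X n) * X n - 1)"
proof -
  obtain c K where c: "c > 0" "\<And>n. n \<ge> K \<Longrightarrow> rat_abs p (X n) = c"
    using padic_cauchy_not_null[OF p X] by metis
  have "\<forall>\<^sub>F n in sequentially. rat_abs p (inverse (X n) * X n - 1) = 0"
    unfolding eventually_sequentially
  proof (intro exI allI impI)
    fix n assume "n \<ge> K"
    then have "X n \<noteq> 0" using c(2)[of n] c(1) by auto
    then show "rat_abs p (inverse (X n) * X n - 1) = 0" by simp
  qed
  then show ?thesis unfolding padic_null_def by (rule tendsto_eventually)
qed

text \<open>Throughout, the prime \<open>p\<close> is the cardinality of the type \<open>'p\<close>. The field \<open>'p padic\<close> is the completion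
  of the rationals with respect to the \<open>p\<close>-adic absolute value: the ring of Cauchy sequences modulo
  the null sequences.\<close>

typedef (overloaded) 'p cauchy_seq = "{X. padic_cauchy CARD('p::prime_card) X}"
  morphisms seq_of Cauchy_seq
  by (rule exI[of _ "\<lambda>n. 0"]) simp

setup_lifting type_definition_cauchy_seq

instantiation cauchy_seq :: (prime_card) comm_ring_1
begin

lift_definition zero_cauchy_seq :: "'a cauchy_seq" is "\<lambda>n. 0" by simp

lift_definition one_cauchy_seq :: "'a cauchy_seq" is "\<lambda>n. 1" by simp

lift_definition plus_cauchy_seq :: "'a cauchy_seq \<Rightarrow> 'a cauchy_seq \<Rightarrow> 'a cauchy_seq"
  is "\<lambda>X Y n. X n + Y n" by (rule padic_cauchy_add[OF prime_card])

lift_definition uminus_cauchy_seq :: "'a cauchy_seq \<Rightarrow> 'a cauchy_seq"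
  is "\<lambda>X n. - X n" by (rule padic_cauchy_minus)

lift_definition minus_cauchy_seq :: "'a cauchy_seq \<Rightarrow> 'a cauchy_seq \<Rightarrow> 'a cauchy_seq"
  is "\<lambda>X Y n. X n - Y n"
  using padic_cauchy_add[OF prime_card] padic_cauchy_minus by fastforce

lift_definition times_cauchy_seq :: "'a cauchy_seq \<Rightarrow> 'a cauchy_seq \<Rightarrow> 'a cauchy_seq"
  is "\<lambda>X Y n. X n * Y n" by (rule padic_cauchy_mult[OF prime_card])

instance
  by standard (transfer; simp add: fun_eq_iff algebra_simps)+

end

lift_definition null_seq :: "'p::prime_card cauchy_seq \<Rightarrow> bool"
  is "padic_null CARD('p)" .

lift_definition inverse_seq :: "'p::prime_card cauchy_seq \<Rightarrow> 'p cauchy_seq"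
  is "\<lambda>X. if padic_null CARD('p) X then (\<lambda>n. 0) else (\<lambda>n. inverse (X n))"
  by (simp add: padic_cauchy_inverse[OF prime_card])

lift_definition abs_seq :: "'p::prime_card cauchy_seq \<Rightarrow> real"
  is "\<lambda>X. lim (\<lambda>n. rat_abs CARD('p) (X n))" .

lemma null_seq_0 [simp]: "null_seq 0"
  by transfer simp

lemma null_seq_add: "null_seq X \<Longrightarrow> null_seq Y \<Longrightarrow> null_seq (X + Y)"
  by transfer (rule padic_null_add[OF prime_card])

lemma null_seq_minus: "null_seq X \<Longrightarrow> null_seq (- X)"
  by transfer (rule padic_null_minus)

lemma null_seq_mult: "null_seq X \<Longrightarrow> null_seq (X * Y)"
  by transfer (rule padic_null_mult[OF prime_card])

lemma inverse_seq_null: "null_seq X \<Longrightarrow> inverse_seq X = 0"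
  by transfer simp

lemma null_inverse_seq_mult: "\<not> null_seq X \<Longrightarrow> null_seq (inverse_seq X * X - 1)"
  by transfer (simp add: padic_null_inverse_mult[OF prime_card])

lemma not_null_seq_1: "\<not> null_seq 1"
  by transfer (simp add: padic_null_def LIMSEQ_const_iff)

lemma abs_seq_LIMSEQ:
  "(\<lambda>n. rat_abs CARD('p) (seq_of X n)) \<longlonglongrightarrow> abs_seq (X :: 'p::prime_card cauchy_seq)"
  by transfer (use padic_cauchy_abs_convergent[OF prime_card] convergent_LIMSEQ_iff in blast)

lemma null_seq_iff: "null_seq X \<longleftrightarrow> abs_seq X = 0"
  using abs_seq_LIMSEQ[of X] by (auto simp: null_seq.rep_eq padic_null_def dest: LIMSEQ_unique)

lemma abs_seq_nonneg: "abs_seq X \<ge> 0"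
  using abs_seq_LIMSEQ[of X] by (rule LIMSEQ_le_const) auto

lemma abs_seq_mult: "abs_seq (X * Y) = abs_seq X * abs_seq Y"
  using tendsto_mult[OF abs_seq_LIMSEQ[of X] abs_seq_LIMSEQ[of Y]] abs_seq_LIMSEQ[of "X * Y"]
  by (simp add: times_cauchy_seq.rep_eq rat_abs_mult[OF prime_card] LIMSEQ_unique)

lemma abs_seq_minus: "abs_seq (- X) = abs_seq X"
  by transfer simp

lemma abs_seq_add: "abs_seq (X + Y) \<le> max (abs_seq X) (abs_seq Y)"
proof (rule LIMSEQ_le)
  show "(\<lambda>n. max (rat_abs CARD('a) (seq_of X n)) (rat_abs CARD('a) (seq_of Y n)))
      \<longlonglongrightarrow> max (abs_seq X) (abs_seq Y)"
    by (intro tendsto_max abs_seq_LIMSEQ)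
qed (use abs_seq_LIMSEQ[of "X + Y"] in
    \<open>auto simp: plus_cauchy_seq.rep_eq rat_abs_add_le_max[OF prime_card]\<close>)

lemma abs_seq_values:
  assumes "\<not> null_seq (X :: 'p::prime_card cauchy_seq)"
  shows "\<exists>k::int. abs_seq X = real CARD('p) powi k"
proof -
  have "padic_cauchy CARD('p) (seq_of X)" using seq_of by blast
  then obtain c M where c: "c > 0" "\<And>n. n \<ge> M \<Longrightarrow> rat_abs CARD('p) (seq_of X n) = c"
    using padic_cauchy_not_null[OF prime_card] assms by (metis null_seq.rep_eq)
  then have "(\<lambda>n. rat_abs CARD('p) (seq_of X n)) \<longlonglongrightarrow> c"
    by (intro tendsto_eventually) (auto simp: eventually_sequentially)
  then have "abs_seq X = c" using LIMSEQ_unique abs_seq_LIMSEQ by blast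
  moreover have "c = real CARD('p) powi (- rat_ord CARD('p) (seq_of X M))"
    using c(1) c(2)[of M] by (auto simp: rat_abs_def split: if_splits)
  ultimately show ?thesis by blast
qed

definition padic_rel :: "'p::prime_card cauchy_seq \<Rightarrow> 'p cauchy_seq \<Rightarrow> bool" where
  "padic_rel X Y \<longleftrightarrow> null_seq (X - Y)"

lemma equivp_padic_rel: "equivp (padic_rel :: 'p::prime_card cauchy_seq \<Rightarrow> _)"
proof (rule equivpI)
  show "reflp (padic_rel :: 'p cauchy_seq \<Rightarrow> _)" by (rule reflpI) (simp add: padic_rel_def)
  show "symp (padic_rel :: 'p cauchy_seq \<Rightarrow> _)"
    by (rule sympI) (metis padic_rel_def null_seq_minus minus_diff_eq)
  show "transp (padic_rel :: 'p cauchy_seq \<Rightarrow> _)"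
  proof (rule transpI)
    fix X Y Z :: "'p cauchy_seq"
    assume "padic_rel X Y" "padic_rel Y Z"
    then show "padic_rel X Z"
      using null_seq_add[of "X - Y" "Y - Z"] by (simp add: padic_rel_def)
  qed
qed

quotient_type (overloaded) 'p padic = "'p::prime_card cauchy_seq" / padic_rel
  by (rule equivp_padic_rel)

lemma padic_rel_abs_seq:
  assumes "padic_rel X Y" shows "abs_seq X = abs_seq Y"
proof -
  have "abs_seq (X - Y) = 0" "abs_seq (Y - X) = 0"
    using assms abs_seq_minus[of "X - Y"] by (auto simp: padic_rel_def null_seq_iff)
  then show ?thesis
    using abs_seq_add[of "X - Y" Y] abs_seq_add[of "Y - X" X] abs_seq_nonneg[of X]
      abs_seq_nonneg[of Y] by simp
qed

lemma padic_rel_null_iff: "padic_rel X Y \<Longrightarrow> null_seq X \<longleftrightarrow> null_seq Y"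
  by (simp add: null_seq_iff padic_rel_abs_seq)

lemma padic_rel_mult:
  assumes "padic_rel X X'" "padic_rel Y Y'" shows "padic_rel (X * Y) (X' * Y')"
proof -
  have "null_seq ((X - X') * Y + (Y - Y') * X')"
    using assms by (intro null_seq_add null_seq_mult) (simp_all add: padic_rel_def)
  then show ?thesis by (simp add: padic_rel_def algebra_simps)
qed

lemma padic_rel_inverse_seq:
  assumes "padic_rel X Y" shows "padic_rel (inverse_seq X) (inverse_seq Y)"
proof (cases "null_seq X")
  case True
  then show ?thesis
    using padic_rel_null_iff[OF assms] by (simp add: inverse_seq_null padic_rel_def)
next
  case False
  then have Y: "\<not> null_seq Y" using padic_rel_null_iff[OF assms] by simp
  let ?I = "inverse_seq X" and ?J = "inverse_seq Y"
  have "null_seq ((X - Y) * (- (?I * ?J)) + (?I * X - 1) * ?J + (- ((?J * Y - 1) * ?I)))"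
    using assms null_inverse_seq_mult[OF False] null_inverse_seq_mult[OF Y]
    by (intro null_seq_add null_seq_minus null_seq_mult) (simp_all add: padic_rel_def)
  moreover have "(X - Y) * (- (?I * ?J)) + (?I * X - 1) * ?J + (- ((?J * Y - 1) * ?I)) = ?I - ?J"
    by (simp add: algebra_simps)
  ultimately show ?thesis by (simp add: padic_rel_def)
qed

instantiation padic :: (prime_card) field
begin

lift_definition zero_padic :: "'a padic" is 0 .

lift_definition one_padic :: "'a padic" is 1 .

lift_definition plus_padic :: "'a padic \<Rightarrow> 'a padic \<Rightarrow> 'a padic" is "(+)"
  using null_seq_add by (fastforce simp: padic_rel_def algebra_simps)

lift_definition uminus_padic :: "'a padic \<Rightarrow> 'a padic" is uminus
  using null_seq_minus by (fastforce simp: padic_rel_def)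

lift_definition times_padic :: "'a padic \<Rightarrow> 'a padic \<Rightarrow> 'a padic" is "(*)"
  by (rule padic_rel_mult)

lift_definition inverse_padic :: "'a padic \<Rightarrow> 'a padic" is inverse_seq
  by (rule padic_rel_inverse_seq)

definition minus_padic :: "'a padic \<Rightarrow> 'a padic \<Rightarrow> 'a padic" where "x - y = x + - y" for x y :: "'a padic"

definition divide_padic :: "'a padic \<Rightarrow> 'a padic \<Rightarrow> 'a padic" where "x div y = x * inverse y" for x y :: "'a padic"

instance
proof
  fix a b c :: "'a padic"
  show "a + b = b + a"
    by transfer (simp add: padic_rel_def algebra_simps)
  show "(a + b) + c = a + (b + c)"
    by transfer (simp add: padic_rel_def algebra_simps)
  show "0 + a = a"
    by transfer (simp add: padic_rel_def)
  show "- a + a = 0"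
    by transfer (simp add: padic_rel_def)
  show "a - b = a + - b"
    by (rule minus_padic_def)
  show "(a * b) * c = a * (b * c)"
    by transfer (simp add: padic_rel_def algebra_simps)
  show "a * b = b * a"
    by transfer (simp add: padic_rel_def algebra_simps)
  show "1 * a = a"
    by transfer (simp add: padic_rel_def)
  show "(a + b) * c = a * c + b * c"
    by transfer (simp add: padic_rel_def algebra_simps)
  show "(0::'a padic) \<noteq> 1"
    by transfer (use null_seq_minus not_null_seq_1 in \<open>fastforce simp: padic_rel_def\<close>)
  show "a \<noteq> 0 \<Longrightarrow> inverse a * a = 1"
    by transfer (simp add: padic_rel_def null_inverse_seq_mult)
  show "a div b = a * inverse b"
    by (rule divide_padic_def)
  show "inverse (0::'a padic) = 0"
    by transfer (simp add: padic_rel_def inverse_seq_null)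
qed

end

subsection \<open>Absolute value and topology\<close>

lift_definition padic_norm :: "'p::prime_card padic \<Rightarrow> real" is abs_seq
  by (rule padic_rel_abs_seq)

lemma padic_norm_add: "padic_norm (x + y) \<le> max (padic_norm x) (padic_norm y)" for x y :: "'p::prime_card padic"
  by transfer (rule abs_seq_add)

lemma padic_norm_nonneg: "padic_norm x \<ge> 0" for x :: "'p::prime_card padic"
  by transfer (rule abs_seq_nonneg)

lemma padic_norm_minus: "padic_norm (- x) = padic_norm x" for x :: "'p::prime_card padic"
  by transfer (rule abs_seq_minus)

lemma padic_norm_eq_0_iff: "padic_norm x = 0 \<longleftrightarrow> x = 0" for x :: "'p::prime_card padic"
  by transfer (simp add: padic_rel_def null_seq_iff)

instantiation padic :: (prime_card) metric_space
begin

definition dist_padic :: "'a padic \<Rightarrow> 'a padic \<Rightarrow> real"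
  where "dist x y = padic_norm (x - y)" for x y :: "'a padic"

definition uniformity_padic :: "('a padic \<times> 'a padic) filter"
  where "uniformity = (INF e\<in>{0<..}. principal {(x :: 'a padic, y). dist x y < e})"

definition open_padic :: "'a padic set \<Rightarrow> bool"
  where "open U = (\<forall>x\<in>U. \<forall>\<^sub>F (x', y) in uniformity. x' = x \<longrightarrow> y \<in> U)" for U :: "'a padic set"

instance
proof
  fix x y z :: "'a padic"
  show "dist x y = 0 \<longleftrightarrow> x = y"
    by (simp add: dist_padic_def padic_norm_eq_0_iff)
  show "dist x y \<le> dist x z + dist y z"
    using padic_norm_add[of "x - z" "z - y"] padic_norm_minus[of "y - z"]
      padic_norm_nonneg[of "x - z"] padic_norm_nonneg[of "y - z"]
    by (simp add: dist_padic_def)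
qed (simp_all add: uniformity_padic_def open_padic_def)

end

lemma padic_norm_mult: "padic_norm (x * y) = padic_norm x * padic_norm y" for x y :: "'p::prime_card padic"
  by transfer (rule abs_seq_mult)

lemma padic_norm_values:
  "x \<noteq> 0 \<Longrightarrow> \<exists>k::int. padic_norm x = real CARD('p) powi k" for x :: "'p::prime_card padic"
  by transfer (simp add: padic_rel_def abs_seq_values)

lemma of_nat_padic: "of_nat k = abs_padic (of_nat k)"
  by (induction k) (simp_all add: zero_padic.abs_eq one_padic.abs_eq plus_padic.abs_eq)

lemma seq_of_of_nat: "seq_of (of_nat k) = (\<lambda>n. of_nat k)"
  by (induction k) (simp_all add: zero_cauchy_seq.rep_eq one_cauchy_seq.rep_eq
      plus_cauchy_seq.rep_eq fun_eq_iff)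

lemma padic_norm_of_nat: "padic_norm (of_nat k :: 'p::prime_card padic) = rat_abs CARD('p) (of_nat k)"
  by (simp add: of_nat_padic padic_norm.abs_eq abs_seq.rep_eq seq_of_of_nat)

instance padic :: (prime_card) field_char_0
proof
  show "inj (of_nat :: nat \<Rightarrow> 'a padic)"
  proof (rule linorder_injI)
    fix i j :: nat assume "i < j"
    then have "padic_norm (of_nat (j - i) :: 'a padic) \<noteq> 0"
      by (simp only: padic_norm_of_nat rat_abs_eq_0_iff[OF prime_card] of_nat_eq_0_iff)
    then show "of_nat i \<noteq> (of_nat j :: 'a padic)"
      using \<open>i < j\<close> by (auto simp: of_nat_diff padic_norm_eq_0_iff)
  qed
qed


definition padic_ints :: "'p::prime_card padic set" where
  "padic_ints = {x. padic_norm x \<le> 1}"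

definition padic_val :: "'p::prime_card padic \<Rightarrow> int" where
  "padic_val x = (THE k. padic_norm x = real CARD('p) powi (- k))"

definition padic_ord :: "'p::prime_card padic \<Rightarrow> ereal" where
  "padic_ord x = (if x = 0 then \<infinity> else ereal (of_int (padic_val x)))"

definition padic_unit_part :: "'p::prime_card padic \<Rightarrow> 'p padic" where
  "padic_unit_part x = x * of_nat CARD('p) powi (- padic_val x)"

lemma padic_norm_eq_val:
  assumes "x \<noteq> (0 :: 'p::prime_card padic)"
  shows "padic_norm x = real CARD('p) powi (- padic_val x)"
proof -
  have p: "real CARD('p) > 1" using prime_gt_1_nat[OF prime_card[where 'a='p]] by simp
  obtain k where k: "padic_norm x = real CARD('p) powi k"
    using padic_norm_values[OF assms] by blast
  have "k' = - k" if "padic_norm x = real CARD('p) powi (- k')" for k'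
    using that k power_int_strict_increasing[OF _ p] by (metis less_irrefl linorder_neqE minus_minus)
  then have "padic_val x = - k" unfolding padic_val_def using k by (intro the_equality) auto
  with k show ?thesis by simp
qed

text \<open>The Legendre symbol of the reduction modulo \<open>p\<close> of a \<open>p\<close>-adic integer.\<close>

definition padic_residue :: "'p::prime_card padic \<Rightarrow> int" where
  "padic_residue u = (THE a. 0 \<le> a \<and> a < int CARD('p) \<and> padic_norm (u - of_int a) < 1)"

definition padic_Legendre :: "'p::prime_card padic \<Rightarrow> int" where
  "padic_Legendre u = Legendre (padic_residue u) (int CARD('p))"

text \<open>The additive character: \<open>a\<close> is determined by \<open>\<alpha>\<close> up to an integer, so the choice is immaterial.\<close>

definition padic_char :: "'p::prime_card padic \<Rightarrow> complex" where
  "padic_char \<alpha> = exp (- 2 * of_real pi * \<i> * of_rat (SOME a :: rat.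
     (\<exists>t\<ge>1. \<exists>m::int. a = of_int m / of_nat CARD('p) ^ t) \<and> \<alpha> - of_rat a \<in> padic_ints))"

section \<open>Haar measure and the singular integral\<close>

definition is_padic_haar :: "'p::prime_card padic measure \<Rightarrow> bool" where
  "is_padic_haar \<mu> \<longleftrightarrow> sets \<mu> = sets borel
     \<and> (\<forall>a. \<forall>A\<in>sets borel. emeasure \<mu> ((+) a ` A) = emeasure \<mu> A)
     \<and> emeasure \<mu> padic_ints = 1"

text \<open>The functions \<open>\<sigma> \<mapsto> \<integral> e\<^sub>p(\<sigma>(\<phi>(x) - n)) dx\<close> are in general not absolutely integrable over the \<open>p\<close>-adic
  numbers (for instance if \<open>\<phi>(x) = x\<^sup>2\<close> and \<open>n = 1\<close>). The outer integral is therefore the limit of the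
  integrals over the balls \<open>p\<^sup>-\<^sup>TZ\<^sub>p\<close>; it agrees with the Lebesgue integral whenever that exists.\<close>

definition padic_ball :: "nat \<Rightarrow> 'p::prime_card padic set" where
  "padic_ball T = {\<sigma>. padic_norm \<sigma> \<le> real CARD('p) ^ T}"

definition padic_integrable ::
    "'p::prime_card padic measure \<Rightarrow> ('p padic \<Rightarrow> complex) \<Rightarrow> bool" where
  "padic_integrable \<mu> f \<longleftrightarrow> convergent (\<lambda>T. LINT \<sigma>:padic_ball T|\<mu>. f \<sigma>)"

definition padic_integral ::
    "'p::prime_card padic measure \<Rightarrow> ('p padic \<Rightarrow> complex) \<Rightarrow> complex" where
  "padic_integral \<mu> f = lim (\<lambda>T. LINT \<sigma>:padic_ball T|\<mu>. f \<sigma>)"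

lemma padic_integral_eq_lebesgue:
  fixes \<mu> :: "'p::prime_card padic measure"
  assumes \<mu>: "is_padic_haar \<mu>" and f: "integrable \<mu> f"
  shows "padic_integrable \<mu> f" "padic_integral \<mu> f = (LINT \<sigma>|\<mu>. f \<sigma>)"
proof -
  have sp: "space \<mu> = UNIV" "sets \<mu> = sets borel"
    using \<mu> sets_eq_imp_space_eq[of \<mu> borel] by (auto simp: is_padic_haar_def)
  have p: "real CARD('p) > 1" using prime_gt_1_nat[OF prime_card[where 'a='p]] by simp
  have "padic_ball T = cball (0 :: 'p padic) (real CARD('p) ^ T)" for T
    by (auto simp: padic_ball_def cball_def dist_padic_def padic_norm_minus)
  then have meas: "(padic_ball T :: 'p padic set) \<in> sets \<mu>" for T
    by (simp add: sp(2) borel_closed)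
  have inc: "incseq (padic_ball :: nat \<Rightarrow> 'p padic set)"
    unfolding incseq_def padic_ball_def
    using p by (auto intro: order_trans power_increasing)
  have un: "(\<Union>T. padic_ball T) = (UNIV :: 'p padic set)"
    using real_arch_pow[OF p] by (fastforce simp: padic_ball_def intro: less_imp_le)
  have "(\<lambda>T. LINT \<sigma>:padic_ball T|\<mu>. f \<sigma>) \<longlonglongrightarrow> (LINT \<sigma>:(\<Union>T. padic_ball T)|\<mu>. f \<sigma>)"
    by (rule set_integral_cont_up[OF meas inc])
      (use f in \<open>simp add: un set_integrable_def\<close>)
  then have "(\<lambda>T. LINT \<sigma>:padic_ball T|\<mu>. f \<sigma>) \<longlonglongrightarrow> (LINT \<sigma>|\<mu>. f \<sigma>)"
    by (simp add: un set_lebesgue_integral_def)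
  then show "padic_integrable \<mu> f" "padic_integral \<mu> f = (LINT \<sigma>|\<mu>. f \<sigma>)"
    by (auto simp: padic_integrable_def padic_integral_def convergent_def limI)
qed

text \<open>Points of the \<open>r\<close>-dimensional space are functions on \<open>{1..r}\<close>, and its normalised Haar measure is the
  product of \<open>r\<close> copies of \<open>\<mu>\<close>.\<close>

definition Ip_integrand :: "'p::prime_card padic measure \<Rightarrow> nat \<Rightarrow> 'p padic \<Rightarrow>
    ((nat \<Rightarrow> 'p padic) \<Rightarrow> 'p padic) \<Rightarrow> 'p padic \<Rightarrow> complex" where
  "Ip_integrand \<mu> r n \<phi> \<sigma> =
     (LINT x:(\<Pi>\<^sub>E i\<in>{1..r}. padic_ints)|(\<Pi>\<^sub>M i\<in>{1..r}. \<mu>). padic_char (\<sigma> * (\<phi> x - n)))"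

definition Ip :: "'p::prime_card padic measure \<Rightarrow> nat \<Rightarrow> 'p padic \<Rightarrow>
    ((nat \<Rightarrow> 'p padic) \<Rightarrow> 'p padic) \<Rightarrow> complex" where
  "Ip \<mu> r n \<phi> = padic_integral \<mu> (Ip_integrand \<mu> r n \<phi>)"

section \<open>Data attached to a diagonal quadratic polynomial\<close>

definition quad_poly :: "nat \<Rightarrow> (nat \<Rightarrow> 'p::prime_card padic) \<Rightarrow> (nat \<Rightarrow> 'p padic) \<Rightarrow>
    (nat \<Rightarrow> 'p padic) \<Rightarrow> 'p padic" where
  "quad_poly r b c x = (\<Sum>i=1..r. b i * x i ^ 2 + c i * x i)"

definition t_coef :: "(nat \<Rightarrow> 'p::prime_card padic) \<Rightarrow> (nat \<Rightarrow> 'p padic) \<Rightarrow> nat \<Rightarrow> ereal" where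
  "t_coef b c i = min (padic_ord (b i)) (padic_ord (c i))"

definition D_set :: "nat \<Rightarrow> (nat \<Rightarrow> 'p::prime_card padic) \<Rightarrow> (nat \<Rightarrow> 'p padic) \<Rightarrow> nat set" where
  "D_set r b c = {i\<in>{1..r}. padic_ord (b i) > padic_ord (c i)}"

definition N_set :: "nat \<Rightarrow> (nat \<Rightarrow> 'p::prime_card padic) \<Rightarrow> (nat \<Rightarrow> 'p padic) \<Rightarrow> nat set" where
  "N_set r b c = {i\<in>{1..r}. padic_ord (b i) \<le> padic_ord (c i)}"

text \<open>The infimum of the empty set of extended reals is \<open>\<infinity>\<close>.\<close>

definition t_d :: "nat \<Rightarrow> (nat \<Rightarrow> 'p::prime_card padic) \<Rightarrow> (nat \<Rightarrow> 'p padic) \<Rightarrow> ereal" where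
  "t_d r b c = (INF i\<in>D_set r b c. t_coef b c i)"

text \<open>If \<open>b i = 0\<close> for some \<open>i\<close> in \<open>N_set r b c\<close>, then also \<open>c i = 0\<close>, and the summand \<open>0 / 0\<close> is \<open>0\<close>.\<close>

definition shifted_n :: "nat \<Rightarrow> (nat \<Rightarrow> 'p::prime_card padic) \<Rightarrow> (nat \<Rightarrow> 'p padic) \<Rightarrow>
    'p padic \<Rightarrow> 'p padic" where
  "shifted_n r b c n = n + (\<Sum>i\<in>N_set r b c. c i ^ 2 / (4 * b i))"

definition t_n :: "nat \<Rightarrow> (nat \<Rightarrow> 'p::prime_card padic) \<Rightarrow> (nat \<Rightarrow> 'p padic) \<Rightarrow>
    'p padic \<Rightarrow> ereal" where
  "t_n r b c n = padic_ord (shifted_n r b c n)"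

definition L_set :: "nat \<Rightarrow> (nat \<Rightarrow> 'p::prime_card padic) \<Rightarrow> (nat \<Rightarrow> 'p padic) \<Rightarrow> int \<Rightarrow> nat set" where
  "L_set r b c t = {i\<in>N_set r b c. t_coef b c i - ereal (of_int t) < 0 \<and>
     (\<exists>k::int. odd k \<and> t_coef b c i - ereal (of_int t) = ereal (of_int k))}"

definition ell :: "nat \<Rightarrow> (nat \<Rightarrow> 'p::prime_card padic) \<Rightarrow> (nat \<Rightarrow> 'p padic) \<Rightarrow> int \<Rightarrow> nat" where
  "ell r b c t = card (L_set r b c t)"

definition eps :: "nat \<Rightarrow> complex" where
  "eps p = (if p mod 4 = 1 then 1 else \<i>)"

definition delta :: "nat \<Rightarrow> (nat \<Rightarrow> 'p::prime_card padic) \<Rightarrow> (nat \<Rightarrow> 'p padic) \<Rightarrow> int \<Rightarrow> complex" where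
  "delta r b c t = eps CARD('p) ^ (3 * ell r b c t) *
     (\<Prod>i\<in>L_set r b c t. of_int (padic_Legendre (padic_unit_part (b i))))"

definition tau :: "nat \<Rightarrow> (nat \<Rightarrow> 'p::prime_card padic) \<Rightarrow> (nat \<Rightarrow> 'p padic) \<Rightarrow> int \<Rightarrow> real" where
  "tau r b c t = of_int t +
     (\<Sum>i\<in>{i\<in>N_set r b c. t_coef b c i < ereal (of_int t)}.
        (real_of_ereal (t_coef b c i) - of_int t) / 2)"

text \<open>If \<open>t_n r b c n\<close> is finite, it is the integer \<open>padic_val (shifted_n r b c n)\<close>. If it is infinite, then
  \<open>omega r b c n = 0\<close>, and the meaningless value \<open>padic_val 0\<close> plays no role.\<close>

definition omega :: "nat \<Rightarrow> (nat \<Rightarrow> 'p::prime_card padic) \<Rightarrow> (nat \<Rightarrow> 'p padic) \<Rightarrow>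
    'p padic \<Rightarrow> complex" where
  "omega r b c n =
     (if t_n r b c n \<ge> t_d r b c then 0
      else if even (ell r b c (padic_val (shifted_n r b c n) + 1)) then - 1 / of_nat CARD('p)
      else eps CARD('p) * of_int (padic_Legendre (padic_unit_part (shifted_n r b c n)))
             * (1 / of_real (sqrt (real CARD('p)))))"

definition sum_term :: "nat \<Rightarrow> (nat \<Rightarrow> 'p::prime_card padic) \<Rightarrow> (nat \<Rightarrow> 'p padic) \<Rightarrow>
    'p padic \<Rightarrow> nat \<Rightarrow> complex" where
  "sum_term r b c n t =
     (if 1 \<le> t \<and> ereal (real t) \<le> min (t_d r b c) (t_n r b c n) \<and> even (ell r b c (int t))
      then delta r b c (int t) * of_real (real CARD('p) powr tau r b c (int t)) else 0)"

end

theory Submission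
  imports Defs
begin

text \<open>
  Everything is locally constant, so every integral over a ball is a finite sum over residues. The inner integral
  factors into one-dimensional integrals of \<open>e\<^sub>p(\<sigma>(b x\<^sup>2 + c x))\<close>. If the linear coefficient dominates, such an
  integral is the indicator of \<open>\<sigma> c \<in> Z\<^sub>p\<close>; otherwise completing the square leaves a pure quadratic integral, and
  splitting the variable modulo \<open>p\<close> lowers the conductor by two until a classical Gauss sum remains. Hence on the
  shell \<open>|\<sigma>| = p\<^sup>t\<close> the integrand is a constant times \<open>e\<^sub>p(-\<sigma> \<nn>)\<close> times a power of the Legendre symbol
  of the unit part of \<open>\<sigma>\<close>. The shell integral is thus a character sum that has its generic value for \<open>t \<le> t\<^sub>n\<close>,
  produces the term with \<open>\<omega>\<^sub>p\<close> for \<open>t = t\<^sub>n + 1\<close>, and vanishes for larger \<open>t\<close>. The sign of the Gauss sum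
  comes from Gauss' own argument: at a root of unity of order \<open>p\<close>, the alternating sum of the Gaussian
  binomial coefficients is on the one hand the Gauss sum and on the other hand a product of sines.
\<close>

section \<open>The alternating sum of Gaussian binomial coefficients\<close>

text \<open>Apart from Fubini for the product measure, integration enters through a single fact: a
  function with an explicit period has a finite Riemann sum as its integral over a ball.
  Translation, scaling and splitting off a digit thereby become identities between finite sums. Two
  signs have to be kept apart. \<open>padic_char\<close> has a minus sign in its exponent, so the
  inner integrals produce the conjugate Gauss sum, and the conjugate of \<open>eps\<close> is its
  cube; the integration over \<open>\<sigma>\<close> is against e_p(-\<sigma> \<open>\<nn>\<close>)
  and produces the Gauss sum itself. Hence the exponent 3 in \<open>delta\<close> and the plain
  \<open>eps\<close> in \<open>omega\<close>. The absolute value of the Gauss sum would not suffice,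
  since \<open>eps\<close> occurs to odd powers; this is why its sign has to be determined.\<close>

text \<open>The Gaussian binomial coefficient, provided that \<open>j \<le> m\<close> and \<open>q ^ i \<noteq> 1\<close> for \<open>1 \<le> i \<le> j\<close>.\<close>

definition qbin :: "'a::field \<Rightarrow> nat \<Rightarrow> nat \<Rightarrow> 'a" where
  "qbin q m j = (\<Prod>i<j. (1 - q ^ (m - i)) / (1 - q ^ Suc i))"

lemma qbin_0 [simp]: "qbin q m 0 = 1"
  by (simp add: qbin_def)

lemma qbin_Suc_right: "qbin q m (Suc j) = qbin q m j * ((1 - q ^ (m - j)) / (1 - q ^ Suc j))"
  by (simp add: qbin_def)

lemma qbin_eq_0 [simp]: "qbin q m (Suc m) = 0"
  by (simp add: qbin_Suc_right)

text \<open>The extra factor continues the falling numerator of \<open>qbin q (Suc m) j\<close> by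
  one step at the bottom; reading the longer product from the top instead splits off
  \<open>1 - q ^ Suc m\<close>. The denominators agree.\<close>

lemma qbin_absorb: "(1 - q ^ (Suc m - j)) * qbin q (Suc m) j = (1 - q ^ Suc m) * qbin q m j"
proof -
  have "(1 - q ^ (Suc m - j)) * (\<Prod>i<j. 1 - q ^ (Suc m - i)) = (\<Prod>i<Suc j. 1 - q ^ (Suc m - i))"
    by (simp add: mult.commute)
  also have "\<dots> = (1 - q ^ Suc m) * (\<Prod>i<j. 1 - q ^ (m - i))"
    by (simp only: prod.lessThan_Suc_shift) simp
  finally show ?thesis by (simp add: qbin_def prod_dividef)
qed

text \<open>Absorption turns the left side into a multiple of \<open>qbin q m j\<close>; then 1 -
  q^(m+1) = (1 - q^(m-j)) + q^(m-j) (1 - q^(j+1)) separates the two summands.\<close>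

lemma qbin_pascal:
  assumes "j \<le> m" "q ^ Suc j \<noteq> 1"
  shows "qbin q (Suc m) (Suc j) = qbin q m (Suc j) + q ^ (m - j) * qbin q m j"
proof -
  have "qbin q (Suc m) (Suc j) = qbin q (Suc m) j * (1 - q ^ (Suc m - j)) / (1 - q ^ Suc j)"
    by (simp add: qbin_Suc_right)
  also have "\<dots> = qbin q m j * (1 - q ^ Suc m) / (1 - q ^ Suc j)"
    using qbin_absorb[of q m j] by (simp add: mult.commute)
  also have "1 - q ^ Suc m = (1 - q ^ (m - j)) + q ^ (m - j) * (1 - q ^ Suc j)"
    using assms(1) by (simp add: algebra_simps flip: power_add power_Suc)
  also have "qbin q m j * \<dots> / (1 - q ^ Suc j) = qbin q m (Suc j) + q ^ (m - j) * qbin q m j"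
    using assms(2) by (simp add: qbin_Suc_right field_simps)
  finally show ?thesis .
qed

text \<open>Pascal's rule pairs terms of opposite sign and leaves the factor
  \<open>1 - q ^ (Suc m - j)\<close>. Absorption trades it for a factor independent of j and lowers
  the index a second time, hence the step by two.\<close>

lemma alternating_qbin_sum_rec:
  assumes "\<And>i. 1 \<le> i \<Longrightarrow> i \<le> Suc (Suc m) \<Longrightarrow> q ^ i \<noteq> 1"
  shows "(\<Sum>j\<le>Suc (Suc m). (-1) ^ j * qbin q (Suc (Suc m)) j)
       = (1 - q ^ Suc m) * (\<Sum>j\<le>m. (-1) ^ j * qbin q m j)"
proof -
  let ?M = "Suc m"
  have "(\<Sum>j\<le>Suc ?M. (-1) ^ j * qbin q (Suc ?M) j)
      = 1 + (\<Sum>j\<le>?M. (-1) ^ Suc j * qbin q (Suc ?M) (Suc j))"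
    by (subst sum.atMost_Suc_shift) simp
  also have "(\<Sum>j\<le>?M. (-1) ^ Suc j * qbin q (Suc ?M) (Suc j))
      = (\<Sum>j\<le>?M. (-1) ^ Suc j * qbin q ?M (Suc j) - (-1) ^ j * (q ^ (?M - j) * qbin q ?M j))"
    using assms by (intro sum.cong refl) (simp add: qbin_pascal algebra_simps del: power_Suc, simp)
  also have "\<dots> = (\<Sum>j\<le>?M. (-1) ^ Suc j * qbin q ?M (Suc j))
      - (\<Sum>j\<le>?M. (-1) ^ j * (q ^ (?M - j) * qbin q ?M j))"
    by (rule sum_subtractf)
  also have "1 + \<dots> = (1 + (\<Sum>j\<le>?M. (-1) ^ Suc j * qbin q ?M (Suc j)))
      - (\<Sum>j\<le>?M. (-1) ^ j * (q ^ (?M - j) * qbin q ?M j))"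
    by (rule add_diff_eq)
  also have "1 + (\<Sum>j\<le>?M. (-1) ^ Suc j * qbin q ?M (Suc j)) = (\<Sum>j\<le>Suc ?M. (-1) ^ j * qbin q ?M j)"
    by (subst (2) sum.atMost_Suc_shift) simp
  \<comment> \<open>The shifted sum ends at \<open>Suc ?M\<close>, where \<open>qbin q ?M\<close> is
    0.\<close>
  also have "\<dots> = (\<Sum>j\<le>?M. (-1) ^ j * qbin q ?M j)"
    by (subst sum.atMost_Suc) simp
  also have "\<dots> - (\<Sum>j\<le>?M. (-1) ^ j * (q ^ (?M - j) * qbin q ?M j))
      = (\<Sum>j\<le>?M. (-1) ^ j * ((1 - q ^ (?M - j)) * qbin q ?M j))"
    by (simp only: sum_subtractf[symmetric] left_diff_distrib right_diff_distrib mult_1)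
  also have "\<dots> = (\<Sum>j\<le>?M. (1 - q ^ ?M) * ((-1) ^ j * qbin q m j))"
    by (simp only: qbin_absorb mult.left_commute)
  also have "\<dots> = (1 - q ^ ?M) * (\<Sum>j\<le>?M. (-1) ^ j * qbin q m j)"
    by (rule sum_distrib_left[symmetric])
  finally show ?thesis by simp
qed

lemma alternating_qbin_sum:
  assumes "\<And>i. 1 \<le> i \<Longrightarrow> i \<le> 2 * n \<Longrightarrow> q ^ i \<noteq> 1"
  shows "(\<Sum>j\<le>2*n. (-1) ^ j * qbin q (2*n) j) = (\<Prod>k<n. 1 - q ^ Suc (2 * k))"
  using assms
proof (induction n)
  case (Suc n)
  have "(\<Sum>j\<le>2*n. (-1) ^ j * qbin q (2*n) j) = (\<Prod>k<n. 1 - q ^ Suc (2 * k))"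
    by (rule Suc.IH) (use Suc.prems in auto)
  then show ?case
    using alternating_qbin_sum_rec[of "2 * n" q] Suc.prems by (simp add: mult.commute)
qed simp

text \<open>Here q^(m-j) is the inverse of q^(j+1), so each new factor equals -q^(-(j+1)), and the
  exponents add up to a triangular number.\<close>

lemma qbin_root_of_unity:
  assumes "q ^ Suc m = 1" "\<And>i. 1 \<le> i \<Longrightarrow> i \<le> m \<Longrightarrow> q ^ i \<noteq> 1" "j \<le> m"
  shows "qbin q m j * q ^ (\<Sum>{..j}) = (-1) ^ j"
  using assms(3)
proof (induction j)
  case (Suc j)
  have "q ^ Suc j * q ^ (m - j) = q ^ Suc m"
    unfolding power_add[symmetric] using Suc.prems by simp
  then have e: "(1 - q ^ (m - j)) * q ^ Suc j = - (1 - q ^ Suc j)"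
    using assms(1) by (simp only: left_diff_distrib mult.commute[of "q ^ (m - j)"]) simp
  have nz: "1 - q ^ Suc j \<noteq> 0" using assms(2)[of "Suc j"] Suc.prems by simp
  have "qbin q m (Suc j) * q ^ (\<Sum>{..Suc j})
      = (qbin q m j * q ^ (\<Sum>{..j})) * ((1 - q ^ (m - j)) * q ^ Suc j / (1 - q ^ Suc j))"
    unfolding qbin_Suc_right sum.atMost_Suc power_add by (simp only: times_divide_eq_right times_divide_eq_left mult_ac)
  also have "\<dots> = (-1) ^ j * (-1)"
    using Suc nz minus_divide_left[of "1 - q ^ Suc j" "1 - q ^ Suc j"] by (simp add: e del: power_Suc minus_diff_eq)
  finally show ?case by simp
qed simp

text \<open>The signs from \<open>qbin_root_of_unity\<close> cancel those of the alternating sum.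
  Left is a sum of roots of unity with triangular exponents, which is a Gauss sum up to completing
  the square.\<close>

lemma sum_root_of_unity_triangular:
  fixes q :: "'a::field"
  assumes "q ^ Suc (2 * n) = 1" "\<And>i. 1 \<le> i \<Longrightarrow> i \<le> 2 * n \<Longrightarrow> q ^ i \<noteq> 1"
  shows "(\<Sum>j\<le>2*n. inverse (q ^ (\<Sum>{..j}))) = (\<Prod>k<n. 1 - q ^ Suc (2 * k))"
proof -
  have "q \<noteq> 0" using assms(1) by (auto)
  then have "inverse (q ^ (\<Sum>{..j})) = (-1) ^ j * qbin q (2*n) j" if "j \<le> 2 * n" for j
    using qbin_root_of_unity[OF assms that]
    by (auto simp: field_simps simp flip: power_add mult_2)
  then show ?thesis
    using alternating_qbin_sum[OF assms(2)] by simp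
qed

section \<open>Quadratic Gauss sums\<close>

text \<open>The exponent is positive, opposite to that of \<open>padic_char\<close>; the minus sign
  in \<open>padic_char_of_int_div\<close> accounts for this.\<close>

definition gauss_char :: "'p::prime_card mod_ring \<Rightarrow> complex" where
  "gauss_char x = cis (2 * pi * of_int (to_int_mod_ring x) / real CARD('p))"

definition qchar :: "'p::prime_card mod_ring \<Rightarrow> int" where
  "qchar x = Legendre (to_int_mod_ring x) (int CARD('p))"

lemma to_int_mod_ring_of_int: "to_int_mod_ring (of_int k :: 'p::prime_card mod_ring) = k mod int CARD('p)"
  unfolding of_int_of_int_mod_ring by transfer simp

lemma of_int_mod_ring_cases: obtains k where "(x :: 'p::prime_card mod_ring) = of_int k"
  by (metis of_int_of_int_mod_ring of_int_mod_ring_to_int_mod_ring)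

lemma of_int_mod_ring_eq_iff:
  "(of_int a :: 'p::prime_card mod_ring) = of_int b \<longleftrightarrow> [a = b] (mod int CARD('p))"
  by (simp add: of_int_eq_iff_cong_CHAR)

lemma gauss_char_of_int:
  "gauss_char (of_int k :: 'p::prime_card mod_ring) = cis (2 * pi * of_int k / real CARD('p))"
proof -
  let ?p = "real CARD('p)"
  have p: "?p > 0" by simp
  define m where "m = k div int CARD('p)"
  have "2 * pi * of_int k / ?p = 2 * pi * of_int (k mod int CARD('p)) / ?p + 2 * pi * of_int m"
  proof -
    have "k = k mod int CARD('p) + int CARD('p) * m" by (simp add: m_def)
    then have "real_of_int k = of_int (k mod int CARD('p)) + ?p * of_int m"
      by (metis of_int_add of_int_mult of_int_of_nat_eq)
    then show ?thesis using p by (simp add: field_simps)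
  qed
  then show ?thesis
    by (simp add: gauss_char_def to_int_mod_ring_of_int cis_mult[symmetric] cis_multiple_2pi)
qed

lemma gauss_char_add: "gauss_char (x + y) = gauss_char x * gauss_char y"
proof -
  obtain a b where "x = of_int a" "y = of_int b" by (metis of_int_mod_ring_cases)
  then show ?thesis
    by (simp add: gauss_char_of_int cis_mult add_divide_distrib distrib_left del: of_int_add flip: of_int_add[where 'a="'a mod_ring"])
       (simp add: add_divide_distrib distrib_left)
qed

lemma gauss_char_0 [simp]: "gauss_char 0 = 1"
  by (simp add: gauss_char_def)

lemma gauss_char_minus: "gauss_char (- x) = inverse (gauss_char x)"
  by (metis add.right_inverse gauss_char_0 gauss_char_add inverse_unique)

lemma cnj_gauss_char: "cnj (gauss_char x) = gauss_char (- x)"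
  by (simp add: gauss_char_minus) (simp add: gauss_char_def cis_cnj cis_inverse)

lemma gauss_char_of_nat:
  "gauss_char (of_nat k :: 'p::prime_card mod_ring) = cis (2 * pi / real CARD('p)) ^ k"
  using gauss_char_of_int[of "int k", where 'p='p] by (simp add: Complex.DeMoivre mult.commute[of "real k"])

lemma gauss_char_of_nat_eq_1_iff:
  "gauss_char (of_nat k :: 'p::prime_card mod_ring) = 1 \<longleftrightarrow> CARD('p) dvd k"
proof
  assume "gauss_char (of_nat k :: 'p mod_ring) = 1"
  then have "cis (2 * pi * real k / real CARD('p)) = 1"
    using gauss_char_of_int[of "int k", where 'p='p] by simp
  then obtain n :: int where "2 * pi * real k / real CARD('p) = of_int n * 2 * pi"
    by (metis cis.sel(1) cos_one_2pi_int one_complex.sel(1))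
  then have "real k = of_int (n * int CARD('p))" by (simp add: field_simps)
  then have "int k = n * int CARD('p)" by linarith
  then show "CARD('p) dvd k" by (metis dvd_triv_right int_dvd_int_iff)
next
  assume "CARD('p) dvd k"
  then have "(of_nat k :: 'p mod_ring) = 0"
    by (simp add: of_nat_eq_0_iff_char_dvd)
  then show "gauss_char (of_nat k :: 'p mod_ring) = 1" by simp
qed

text \<open>Replacing x by x + 1/a permutes the field and multiplies the sum by
  \<open>gauss_char 1\<close>, which is not 1.\<close>

lemma sum_gauss_char:
  fixes a :: "'p::prime_card mod_ring"
  assumes "a \<noteq> 0"
  shows "(\<Sum>x\<in>UNIV. gauss_char (a * x)) = 0"
proof -
  let ?S = "\<Sum>x\<in>UNIV. gauss_char (a * x)"
  have "?S = (\<Sum>x\<in>UNIV. gauss_char (a * (x + 1 / a)))"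
    by (rule sum.reindex_bij_witness[of _ "\<lambda>x. x + 1 / a" "\<lambda>x. x - 1 / a"]) auto
  also have "\<dots> = ?S * gauss_char (1 :: 'p mod_ring)"
    unfolding distrib_left gauss_char_add sum_distrib_right using assms by simp
  finally have "?S = 0 \<or> gauss_char (1 :: 'p mod_ring) = 1"
    by simp
  moreover have "gauss_char (1 :: 'p mod_ring) \<noteq> 1"
    using gauss_char_of_nat_eq_1_iff[of 1, where 'p='p] prime_gt_1_nat[OF prime_card[where 'a='p]] by simp
  ultimately show ?thesis by blast
qed

lemma sum_mod_ring: "(\<Sum>x\<in>UNIV. h x) = (\<Sum>j<CARD('p). h (of_nat j :: 'p::prime_card mod_ring))"
proof -
  have "inj_on (of_nat :: nat \<Rightarrow> 'p mod_ring) {..<CARD('p)}"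
    by (auto simp: inj_on_def of_nat_eq_iff_cong_CHAR cong_def)
  moreover have "of_nat ` {..<CARD('p)} = (UNIV :: 'p mod_ring set)"
    using surj_of_nat_mod_ring[where 'a='p] by auto
  ultimately show ?thesis by (metis (no_types, lifting) o_apply sum.cong sum.reindex)
qed

section \<open>The quadratic character of the residue field\<close>

lemma qchar_of_int: "qchar (of_int k :: 'p::prime_card mod_ring) = Legendre k (int CARD('p))"
  by (simp add: qchar_def to_int_mod_ring_of_int Legendre_def QuadRes_def cong_def)

lemma qchar_0 [simp]: "qchar 0 = 0"
  by (simp add: qchar_def Legendre_def)

lemma qchar_eq: "qchar x = (if x = 0 then 0 else if \<exists>y. y ^ 2 = x then 1 else -1)"
proof -
  obtain a where a: "x = of_int a" by (rule of_int_mod_ring_cases)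
  have "(\<exists>y. y ^ 2 = x) \<longleftrightarrow> (\<exists>b. (of_int b)\<^sup>2 = x)" by (metis of_int_mod_ring_cases)
  then show ?thesis
    using of_int_mod_ring_eq_iff[of a 0, where 'p='a]
    by (simp add: a qchar_of_int Legendre_def QuadRes_def of_int_mod_ring_eq_iff flip: of_int_power)
qed

lemma two_neq_0_mod_ring:
  assumes "CARD('p) \<ge> 3"
  shows "(2 :: 'p::prime_card mod_ring) \<noteq> 0"
proof
  assume "(2 :: 'p mod_ring) = 0"
  then have "CARD('p) dvd 2" by (intro of_nat_0_mod_ring_dvd) simp
  with assms show False by (auto dest!: dvd_imp_le)
qed

lemma card_sqrts:
  assumes "CARD('p) \<ge> 3"
  shows "int (card {x. x ^ 2 = (y :: 'p::prime_card mod_ring)}) = 1 + qchar y"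
proof (cases "\<exists>x. x ^ 2 = y")
  case True
  then obtain x where x: "x ^ 2 = y" by blast
  have "(2 :: 'p mod_ring) \<noteq> 0"
    by (rule two_neq_0_mod_ring[OF assms])
  then have "x = - x \<longleftrightarrow> x = 0" by (simp add: eq_neg_iff_add_eq_0 flip: mult_2)
  moreover have "{z. z ^ 2 = y} = {x, - x}" using x by (auto simp: power2_eq_iff)
  ultimately show ?thesis using x by (auto simp: qchar_eq)
next
  case False
  then have "{x. x ^ 2 = y} = {}" "y \<noteq> 0" by (auto intro: exI[of _ 0])
  with False show ?thesis by (simp add: qchar_eq)
qed

lemma sum_squares:
  fixes h :: "'p::prime_card mod_ring \<Rightarrow> complex"
  assumes "CARD('p) \<ge> 3"
  shows "(\<Sum>x\<in>UNIV. h (x ^ 2)) = (\<Sum>y\<in>UNIV. (1 + of_int (qchar y)) * h y)"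
proof -
  have "(\<Sum>x\<in>UNIV. h (x ^ 2)) = (\<Sum>y\<in>UNIV. \<Sum>x\<in>{x\<in>UNIV. x ^ 2 = y}. h (x ^ 2))"
    by (rule sum.group[symmetric]) auto
  also have "\<dots> = (\<Sum>y\<in>UNIV. of_int (int (card {x. x ^ 2 = y})) * h y)"
    by (intro sum.cong refl) simp
  finally show ?thesis by (simp add: card_sqrts[OF assms] del: of_int_of_nat_eq)
qed

text \<open>For the constant function 1, \<open>sum_squares\<close> counts the elements of the field
  on both sides.\<close>

lemma sum_qchar:
  assumes "CARD('p::prime_card) \<ge> 3"
  shows "(\<Sum>y\<in>(UNIV :: 'p mod_ring set). of_int (qchar y)) = (0 :: complex)"
  using sum_squares[OF assms, of "\<lambda>_. 1"] by (simp add: sum.distrib)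

lemma qchar_mult:
  assumes "CARD('p) \<ge> 3"
  shows "qchar (x * y :: 'p::prime_card mod_ring) = qchar x * qchar y"
proof -
  obtain a b where ab: "x = of_int a" "y = of_int b" by (metis of_int_mod_ring_cases)
  let ?p = "CARD('p)" let ?e = "(CARD('p) - 1) div 2"
  note ec = euler_criterion[OF prime_card[where 'a='p]]
  have "[Legendre (a * b) ?p = (a * b) ^ ?e] (mod ?p)" using ec assms by simp
  moreover have "[Legendre a ?p * Legendre b ?p = a ^ ?e * b ^ ?e] (mod ?p)"
    using ec assms by (intro cong_mult) simp_all
  ultimately have "[Legendre (a * b) ?p = Legendre a ?p * Legendre b ?p] (mod ?p)"
    unfolding power_mult_distrib by (rule cong_trans[OF _ cong_sym])
  then have "int ?p dvd qchar (x * y) - qchar x * qchar y"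
    by (simp add: ab qchar_of_int cong_iff_dvd_diff flip: of_int_mult)
  \<comment> \<open>Euler's criterion gives the identity only modulo p. Both sides lie in {-1, 0,
    1}, so a difference divisible by p \<ge> 3 is 0.\<close>
  moreover have "\<bar>qchar (x * y) - qchar x * qchar y\<bar> \<le> 2"
    by (simp add: qchar_eq)
  ultimately have "qchar (x * y) - qchar x * qchar y = 0"
    using assms dvd_imp_le_int[of "qchar (x * y) - qchar x * qchar y" "int ?p"] by linarith
  then show ?thesis by simp
qed

lemma qchar_square_eq_1: "x \<noteq> 0 \<Longrightarrow> qchar x * qchar x = 1"
  by (simp add: qchar_eq)

section \<open>Gauss sums: twisting, absolute value and sign\<close>

definition gauss_sum :: "'p::prime_card itself \<Rightarrow> complex" where
  "gauss_sum _ = (\<Sum>x\<in>(UNIV :: 'p mod_ring set). gauss_char (x ^ 2))"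

text \<open>For a = 1, \<open>sum_squares\<close> and the vanishing of the untwisted sum identify
  the twisted sum with the sum over squares. In general the substitution of y / a for y pulls out
  the symbol of 1 / a, which is that of a.\<close>

lemma sum_qchar_gauss_char:
  fixes a :: "'p::prime_card mod_ring"
  assumes "CARD('p) \<ge> 3" "a \<noteq> 0"
  shows "(\<Sum>y\<in>UNIV. of_int (qchar y) * gauss_char (a * y)) = of_int (qchar a) * gauss_sum TYPE('p)"
proof -
  have *: "(\<Sum>y\<in>(UNIV :: 'p mod_ring set). of_int (qchar y) * gauss_char y) = gauss_sum TYPE('p)"
    using sum_squares[OF assms(1), of gauss_char] sum_gauss_char[of "1 :: 'p mod_ring"]
    unfolding gauss_sum_def by (simp add: distrib_right sum.distrib)
  have "(\<Sum>y\<in>UNIV. of_int (qchar y) * gauss_char (a * y))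
      = (\<Sum>y\<in>UNIV. of_int (qchar (y / a)) * gauss_char y)"
    using assms(2) by (intro sum.reindex_bij_witness[of _ "\<lambda>y. y / a" "\<lambda>y. a * y"]) auto
  also have "\<dots> = (\<Sum>y\<in>(UNIV :: 'p mod_ring set). of_int (qchar a) * (of_int (qchar y) * gauss_char y))"
  proof (intro sum.cong refl)
    fix y :: "'p mod_ring"
    have "qchar y = qchar (y / a) * qchar a"
      using assms qchar_mult[OF assms(1), of "y / a" a] by simp
    then have "qchar a * qchar y = qchar (y / a)"
      using qchar_square_eq_1[OF assms(2)] by (simp add: mult_ac)
    then show "of_int (qchar (y / a)) * gauss_char y = of_int (qchar a) * (of_int (qchar y) * gauss_char y)"
      by (metis mult.assoc of_int_mult)
  qed
  finally show ?thesis by (simp add: * flip: sum_distrib_left)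
qed

lemma sum_gauss_char_squares:
  fixes a :: "'p::prime_card mod_ring"
  assumes "CARD('p) \<ge> 3" "a \<noteq> 0"
  shows "(\<Sum>x\<in>UNIV. gauss_char (a * x ^ 2)) = of_int (qchar a) * gauss_sum TYPE('p)"
  using sum_squares[OF assms(1), of "\<lambda>y. gauss_char (a * y)"] sum_gauss_char[OF assms(2)]
    sum_qchar_gauss_char[OF assms] by (simp add: distrib_right sum.distrib)

text \<open>Substituting x = y + d makes x^2 - y^2 = d^2 + 2 d y linear in y, and the sum over y
  vanishes unless d = 0, since 2 is invertible.\<close>

lemma gauss_sum_norm:
  assumes "CARD('p::prime_card) \<ge> 3"
  shows "gauss_sum TYPE('p) * cnj (gauss_sum TYPE('p)) = of_nat CARD('p)"
proof -
  note two = two_neq_0_mod_ring[OF assms]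
  have "gauss_sum TYPE('p) * cnj (gauss_sum TYPE('p))
      = (\<Sum>y\<in>UNIV. \<Sum>x\<in>UNIV. gauss_char (x ^ 2 - y ^ 2 :: 'p mod_ring))"
    unfolding gauss_sum_def cnj_sum sum_product cnj_gauss_char
    by (subst sum.swap) (simp only: gauss_char_add[symmetric] add_uminus_conv_diff)
  also have "\<dots> = (\<Sum>y\<in>UNIV. \<Sum>d\<in>UNIV. gauss_char (d ^ 2 + (2 * d) * y :: 'p mod_ring))"
  proof (rule sum.cong[OF refl])
    fix y :: "'p mod_ring"
    show "(\<Sum>x\<in>UNIV. gauss_char (x ^ 2 - y ^ 2)) = (\<Sum>d\<in>UNIV. gauss_char (d ^ 2 + (2 * d) * y))"
      by (rule sum.reindex_bij_witness[of _ "\<lambda>d. d + y" "\<lambda>x. x - y"])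
        (simp_all add: power2_sum power2_diff left_diff_distrib right_diff_distrib power2_eq_square[of y])
  qed
  also have "\<dots> = (\<Sum>d\<in>UNIV. gauss_char (d ^ 2) * (\<Sum>y\<in>UNIV. gauss_char ((2 * d) * y :: 'p mod_ring)))"
    unfolding sum_distrib_left by (subst sum.swap) (simp only: gauss_char_add)
  also have "\<dots> = (\<Sum>d\<in>(UNIV :: 'p mod_ring set). if d = 0 then of_nat CARD('p) else 0 :: complex)"
  proof (intro sum.cong refl)
    fix d :: "'p mod_ring"
    show "gauss_char (d ^ 2) * (\<Sum>y\<in>UNIV. gauss_char ((2 * d) * y)) = (if d = 0 then of_nat CARD('p) else 0)"
    proof (cases "d = 0")
      case False
      then have "(\<Sum>y\<in>UNIV. gauss_char ((2 * d) * y)) = 0"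
        using two by (intro sum_gauss_char) simp
      with False show ?thesis by simp
    qed simp
  qed
  finally show ?thesis by simp
qed

lemma gauss_sum_eq_prod:
  assumes p: "CARD('p::prime_card) = 2 * n + 1"
  shows "gauss_sum TYPE('p) = (\<Prod>k<n. 2 * \<i> * of_real (sin (real (Suc (2 * k)) * (2 * pi / real CARD('p)))))"
proof -
  define \<zeta> where "\<zeta> = cis (2 * pi / real CARD('p))"
  \<comment> \<open>With q = zeta^(-2) the inverse powers with triangular exponents become
    zeta^(j(j+1)), and q is still of order p because p is odd.\<close>
  define q where "q = inverse (\<zeta> ^ 2)"
  have \<zeta>0: "\<zeta> \<noteq> 0" by (simp add: \<zeta>_def)
  have q_pow: "q ^ i = inverse (\<zeta> ^ (2 * i))" for i
    by (simp add: q_def power_inverse power_mult)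
  have \<zeta>_pow: "\<zeta> ^ i = gauss_char (of_nat i :: 'p mod_ring)" for i
    by (simp add: \<zeta>_def gauss_char_of_nat)
  have q1: "q ^ i = 1 \<longleftrightarrow> CARD('p) dvd i" for i
  proof -
    have "coprime CARD('p) 2" using p by (simp add: coprime_commute)
    then show ?thesis
      unfolding q_pow \<zeta>_pow by (simp add: gauss_char_of_nat_eq_1_iff coprime_dvd_mult_right_iff del: of_nat_mult)
  qed
  have tri: "2 * \<Sum>{..j} = j * (j + 1)" for j :: nat
    by (induction j) simp_all
  have "(\<Prod>k<n. 1 - q ^ Suc (2 * k)) = (\<Sum>j\<le>2*n. inverse (q ^ (\<Sum>{..j})))"
    by (rule sum_root_of_unity_triangular[symmetric]) (use p in \<open>auto simp: q1 dest!: dvd_imp_le simp del: power_Suc\<close>)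
  also have "\<dots> = (\<Sum>j<CARD('p). \<zeta> ^ (j * (j + 1)))"
    unfolding q_pow tri inverse_inverse_eq using p by (intro sum.cong) auto
  also have "\<dots> = (\<Sum>x\<in>(UNIV :: 'p mod_ring set). gauss_char (x * (x + 1)))"
    unfolding sum_mod_ring \<zeta>_pow by (simp add: algebra_simps)
  finally have prod: "(\<Prod>k<n. 1 - q ^ Suc (2 * k)) = (\<Sum>x\<in>(UNIV :: 'p mod_ring set). gauss_char (x * (x + 1)))" .
  have z: "(2 * of_nat n + 1 :: 'p mod_ring) = 0"
    using of_nat_card_eq_0[where 'a='p] p by (metis of_nat_1 of_nat_add of_nat_mult of_nat_numeral)
  \<comment> \<open>Since 2n + 1 = 0 in the field, n + 1 is one half and its square 1/4 equals n^2.
    This completes the square in x (x + 1).\<close>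
  have sq: "(x + (of_nat n + 1)) ^ 2 = of_nat (n\<^sup>2) + x * (x + 1)" for x :: "'p mod_ring"
  proof -
    have "(x + (of_nat n + 1)) ^ 2 = of_nat n ^ 2 + x * (x + 1) + (2 * of_nat n + 1) * (x + 1)"
      by (simp add: power2_eq_square algebra_simps)
    then show ?thesis by (simp only: z of_nat_power) simp
  qed
  have "gauss_sum TYPE('p) = (\<Sum>x\<in>UNIV. gauss_char ((x + (of_nat n + 1)) ^ 2 :: 'p mod_ring))"
    unfolding gauss_sum_def
    by (rule sum.reindex_bij_witness[of _ "\<lambda>x. x + (of_nat n + 1)" "\<lambda>x. x - (of_nat n + 1)"]) auto
  also have "\<dots> = \<zeta> ^ n\<^sup>2 * (\<Prod>k<n. 1 - q ^ Suc (2 * k))"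
    unfolding sq gauss_char_add prod \<zeta>_pow by (rule sum_distrib_left[symmetric])
  \<comment> \<open>As the sum of the first n odd numbers, n^2 hands one odd power zeta^m to each
    factor, which turns it into zeta^m - zeta^(-m).\<close>
  also have "n\<^sup>2 = (\<Sum>k<n. Suc (2 * k))"
    by (induction n) (simp_all add: power2_eq_square)
  also have "\<zeta> ^ \<dots> * (\<Prod>k<n. 1 - q ^ Suc (2 * k)) = (\<Prod>k<n. \<zeta> ^ Suc (2 * k) * (1 - q ^ Suc (2 * k)))"
    by (simp only: power_sum prod.distrib)
  also have "\<dots> = (\<Prod>k<n. 2 * \<i> * of_real (sin (real (Suc (2 * k)) * (2 * pi / real CARD('p)))))"
  proof (rule prod.cong[OF refl])
    fix k
    let ?m = "Suc (2 * k)"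
    have "\<zeta> ^ ?m * (1 - q ^ ?m) = \<zeta> ^ ?m - inverse (\<zeta> ^ ?m)"
      unfolding q_pow using \<zeta>0 by (simp only: mult_2 power_add) (simp add: field_simps)
    also have "\<dots> = cis (real ?m * (2 * pi / real CARD('p))) - cis (- (real ?m * (2 * pi / real CARD('p))))"
      unfolding \<zeta>_def Complex.DeMoivre cis_inverse ..
    also have "\<dots> = 2 * \<i> * of_real (sin (real ?m * (2 * pi / real CARD('p))))"
      by (simp add: complex_eq_iff)
    finally show "\<zeta> ^ ?m * (1 - q ^ ?m) = 2 * \<i> * of_real (sin (real ?m * (2 * pi / real CARD('p))))" .
  qed
  finally show ?thesis .
qed

text \<open>The absolute value is known from \<open>gauss_sum_norm\<close>, so the product of sines
  has to supply only the sign.\<close>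

lemma gauss_sum_value:
  assumes "CARD('p::prime_card) \<ge> 3"
  shows "gauss_sum TYPE('p) = eps CARD('p) * of_real (sqrt (real CARD('p)))"
proof -
  have "odd CARD('p)" using assms prime_card[where 'a='p] by (auto dest: prime_odd_nat)
  then obtain n where n: "CARD('p) = 2 * n + 1" by (elim oddE)
  \<comment> \<open>The angle (2k + 1) 2 pi / p is below pi exactly when 2k + 1 \<le> n, that is,
    for the first n - n div 2 indices; the remaining n div 2 sines are negative.\<close>
  define h where "h = n - n div 2"
  define f where "f k = 2 * sin (real (Suc (2 * k)) * (2 * pi / real CARD('p)))" for k
  have "gauss_sum TYPE('p) = (\<Prod>k<n. \<i> * of_real (f k))"
    unfolding gauss_sum_eq_prod[OF n] f_def by (intro prod.cong) simp_all
  then have g: "gauss_sum TYPE('p) = \<i> ^ n * of_real (\<Prod>k<n. f k)"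
    by (simp add: prod.distrib)
  have pos: "f k > 0" if "k < h" for k
  proof -
    have "2 * Suc (2 * k) < CARD('p)" using that n by (simp add: h_def)
    then have "real (2 * Suc (2 * k)) < real CARD('p)" by (simp only: of_nat_less_iff)
    then have "pi * real (2 * Suc (2 * k)) < pi * real CARD('p)" by (intro mult_strict_left_mono) simp_all
    then have "real (Suc (2 * k)) * (2 * pi / real CARD('p)) < pi" by (simp add: field_simps)
    then show ?thesis by (simp add: f_def sin_gt_zero)
  qed
  have neg: "- f k > 0" if "h \<le> k" "k < n" for k
  proof -
    have "CARD('p) < 2 * Suc (2 * k)" "2 * Suc (2 * k) < 2 * CARD('p)"
      using that n by (simp_all add: h_def)
    then have "real CARD('p) < real (2 * Suc (2 * k))" "real (2 * Suc (2 * k)) < real (2 * CARD('p))"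
      by (simp_all only: of_nat_less_iff)
    then have "pi * real CARD('p) < pi * real (2 * Suc (2 * k))" "pi * real (2 * Suc (2 * k)) < pi * real (2 * CARD('p))"
      by (auto intro!: mult_strict_left_mono simp del: of_nat_mult of_nat_Suc)
    then have "pi < real (Suc (2 * k)) * (2 * pi / real CARD('p))"
      "real (Suc (2 * k)) * (2 * pi / real CARD('p)) < 2 * pi" by (simp_all add: field_simps)
    then show ?thesis by (simp add: f_def sin_lt_zero)
  qed
  have "{..<n} = {..<h} \<union> {h..<n}" by (auto simp: h_def)
  then have "(\<Prod>k<n. f k) = (\<Prod>k<h. f k) * (\<Prod>k=h..<n. (-1) * (- f k))"
    by (simp add: prod.union_disjoint ivl_disj_int)
  also have "\<dots> = (-1) ^ (n div 2) * ((\<Prod>k<h. f k) * (\<Prod>k=h..<n. - f k))"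
    by (simp only: prod.distrib prod_constant card_atLeastLessThan) (simp add: h_def)
  finally have sgn: "(\<Prod>k<n. f k) = (-1) ^ (n div 2) * ((\<Prod>k<h. f k) * (\<Prod>k=h..<n. - f k))" .
  have P0: "(\<Prod>k<h. f k) * (\<Prod>k=h..<n. - f k) > 0"
    using pos neg by (intro mult_pos_pos prod_pos) auto
  have "of_real (real CARD('p)) = gauss_sum TYPE('p) * cnj (gauss_sum TYPE('p))"
    using gauss_sum_norm[OF assms] by simp
  also have "\<dots> = of_real ((norm (gauss_sum TYPE('p)))\<^sup>2)"
    by (rule complex_norm_square[symmetric])
  finally have "(norm (gauss_sum TYPE('p)))\<^sup>2 = real CARD('p)"
    by (simp only: of_real_eq_iff)
  then have "norm (gauss_sum TYPE('p)) = sqrt (real CARD('p))"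
    by (metis norm_ge_zero real_sqrt_unique)
  then have "\<bar>\<Prod>k<n. f k\<bar> = sqrt (real CARD('p))"
    unfolding g norm_mult norm_power norm_of_real by simp
  then have "(\<Prod>k<n. f k) = (-1) ^ (n div 2) * sqrt (real CARD('p))"
    using abs_of_pos[OF P0] unfolding sgn by (simp add: abs_mult)
  then have "gauss_sum TYPE('p) = \<i> ^ n * (-1) ^ (n div 2) * of_real (sqrt (real CARD('p)))"
    unfolding g by simp
  \<comment> \<open>If n is even, then p is 1 modulo 4 and i^n already equals (-1)^(n/2); if n is
    odd, one factor i is left over.\<close>
  also have "\<i> ^ n * (-1) ^ (n div 2) = eps CARD('p)"
  proof (cases "even n")
    case True
    then obtain m where m: "n = 2 * m" by (elim evenE)
    then show ?thesis using n by (simp add: eps_def power_mult flip: power_mult_distrib)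
  next
    case False
    then obtain m where m: "n = 2 * m + 1" by (elim oddE)
    then have "CARD('p) mod 4 \<noteq> 1" using n by presburger
    then show ?thesis using m by (simp add: eps_def power_mult flip: power_mult_distrib)
  qed
  finally show ?thesis .
qed

section \<open>Arithmetic of the field of p-adic numbers\<close>

lemma CARD_gt_1: "real CARD('p::prime_card) > 1"
  using prime_gt_1_nat[OF prime_card[where 'a='p]] by simp

lemma CARD_powi_le_iff [simp]: "real CARD('p::prime_card) powi a \<le> real CARD('p) powi b \<longleftrightarrow> a \<le> b"
  using power_int_increasing[of a b "real CARD('p)"] power_int_strict_increasing[of b a "real CARD('p)"]
    CARD_gt_1[where 'p='p] by (cases "a \<le> b") auto

lemma padic_norm_0 [simp]: "padic_norm 0 = 0"
  by (simp add: padic_norm_eq_0_iff)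

lemma padic_norm_1 [simp]: "padic_norm (1 :: 'p::prime_card padic) = 1"
  using padic_norm_of_nat[of 1, where 'p='p] by simp

lemma padic_norm_power: "padic_norm (x ^ k) = padic_norm x ^ k"
  by (induction k) (simp_all add: padic_norm_mult)

lemma padic_norm_inverse: "padic_norm (inverse x) = inverse (padic_norm x)"
proof (cases "x = 0")
  case False
  then have "padic_norm x * padic_norm (inverse x) = 1"
    using padic_norm_mult[of x "inverse x"] by simp
  then show ?thesis by (metis inverse_unique)
qed simp

lemma padic_norm_divide: "padic_norm (x / y) = padic_norm x / padic_norm y"
  by (simp add: divide_inverse padic_norm_mult padic_norm_inverse)

lemma padic_norm_powi: "padic_norm (x powi k) = padic_norm x powi k"
  by (simp add: power_int_def padic_norm_power padic_norm_inverse)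

lemma padic_norm_of_int: "padic_norm (of_int k :: 'p::prime_card padic) = rat_abs CARD('p) (of_int k)"
  by (cases k rule: int_cases2) (simp_all add: padic_norm_of_nat padic_norm_minus)

lemma padic_norm_of_int_le_iff:
  "padic_norm (of_int k :: 'p::prime_card padic) \<le> real CARD('p) powi (- int j) \<longleftrightarrow> int CARD('p) ^ j dvd k"
proof (cases "k = 0")
  case False
  have "\<not> is_unit (int CARD('p))"
    using prime_gt_1_nat[OF prime_card[where 'a='p]] by simp
  moreover have "rat_ord CARD('p) (of_int k) = int (multiplicity (int CARD('p)) k)"
    using rat_ord_divide[OF prime_card[where 'a='p] False, of 1] by simp
  ultimately show ?thesis
    using False by (simp add: padic_norm_of_int rat_abs_def power_dvd_iff_le_multiplicity)
qed simp

lemma padic_norm_CARD: "padic_norm (of_nat CARD('p) :: 'p::prime_card padic) = inverse (real CARD('p))"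
proof -
  have "rat_ord CARD('p) (of_nat CARD('p)) = 1"
    using rat_ord_divide[OF prime_card[where 'a='p], of "int CARD('p)" 1] prime_card_int[where 'a='p]
    by (simp add: multiplicity_self)
  then show ?thesis by (simp add: padic_norm_of_nat rat_abs_def power_int_minus)
qed

abbreviation uniformizer :: "'p::prime_card padic" where
  "uniformizer \<equiv> of_nat CARD('p)"

lemma padic_norm_uniformizer_powi:
  "padic_norm (uniformizer powi k :: 'p::prime_card padic) = real CARD('p) powi (- k)"
  by (simp add: padic_norm_powi padic_norm_CARD power_int_minus power_int_inverse)

text \<open>The fractional ideal p^(-m) Z_p, indexed by the exponent of its radius. Congruence
  modulo p^j is membership of the difference in \<open>zball (- int j)\<close>, so most p-adic
  estimates become closure properties of these groups.\<close>

definition zball :: "int \<Rightarrow> 'p::prime_card padic set" where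
  "zball m = {x. padic_norm x \<le> real CARD('p) powi m}"

lemma padic_ints_eq_zball: "padic_ints = zball 0"
  by (simp add: padic_ints_def zball_def)

lemma padic_ball_eq_zball: "padic_ball T = zball (int T)"
  by (simp add: padic_ball_def zball_def)

lemma zball_0 [simp]: "0 \<in> zball m"
  by (simp add: zball_def)

lemma zball_add: "x \<in> zball m \<Longrightarrow> y \<in> zball m \<Longrightarrow> x + y \<in> zball m"
  using padic_norm_add[of x y] by (simp add: zball_def)

lemma zball_minus_iff [simp]: "- x \<in> zball m \<longleftrightarrow> x \<in> zball m"
  by (simp add: zball_def padic_norm_minus)

lemma zball_diff: "x \<in> zball m \<Longrightarrow> y \<in> zball m \<Longrightarrow> x - y \<in> zball m"
  using zball_add[of x m "- y"] by simp

lemma zball_add_cancel: "y \<in> zball m \<Longrightarrow> x + y \<in> zball m \<longleftrightarrow> x \<in> zball m"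
  using zball_add zball_diff by (metis add_diff_cancel_right')

lemma zball_sum: "(\<And>i. i \<in> A \<Longrightarrow> f i \<in> zball m) \<Longrightarrow> (\<Sum>i\<in>A. f i) \<in> zball m"
  by (induction A rule: infinite_finite_induct) (auto intro: zball_add)

lemma zball_mono: "x \<in> zball m \<Longrightarrow> m \<le> m' \<Longrightarrow> (x :: 'p::prime_card padic) \<in> zball m'"
  using CARD_powi_le_iff[of m m', where 'p='p] by (auto simp: zball_def intro: order_trans)

lemma zball_mult: "x \<in> zball m \<Longrightarrow> y \<in> zball m' \<Longrightarrow> (x * y :: 'p::prime_card padic) \<in> zball (m + m')"
  using CARD_gt_1[where 'p='p]
  by (auto simp: zball_def padic_norm_mult power_int_add intro!: mult_mono padic_norm_nonneg)

lemma zball_mult_ints: "x \<in> zball m \<Longrightarrow> y \<in> zball 0 \<Longrightarrow> x * y \<in> zball m"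
  using zball_mult[of x m y 0] by simp

lemma zball_powi_mult_iff:
  "uniformizer powi k * x \<in> zball m \<longleftrightarrow> (x :: 'p::prime_card padic) \<in> zball (m + k)"
  using CARD_gt_1[where 'p='p]
  by (simp add: zball_def padic_norm_mult padic_norm_uniformizer_powi power_int_add power_int_minus field_simps)

lemma uniformizer_powi_in_zball: "(uniformizer powi k :: 'p::prime_card padic) \<in> zball (- k)"
  by (simp add: zball_def padic_norm_uniformizer_powi)

lemma of_int_in_zball_iff:
  "(of_int k :: 'p::prime_card padic) \<in> zball (- int j) \<longleftrightarrow> int CARD('p) ^ j dvd k"
  by (simp add: zball_def padic_norm_of_int_le_iff)

lemma of_int_in_zball [simp]: "of_int k \<in> zball 0"
  using of_int_in_zball_iff[of k 0] by simp

lemma of_nat_in_zball [simp]: "of_nat k \<in> zball 0"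
  using of_int_in_zball[of "int k"] by simp

lemma zball_iff_val: "(x :: 'p::prime_card padic) \<in> zball m \<longleftrightarrow> x = 0 \<or> - m \<le> padic_val x"
proof (cases "x = 0")
  case False
  then show ?thesis by (auto simp: zball_def padic_norm_eq_val)
qed simp

lemma padic_val_eqI: "padic_norm x = real CARD('p) powi (- k) \<Longrightarrow> padic_val (x :: 'p::prime_card padic) = k"
  unfolding padic_val_def
  by (rule the_equality)
    (use CARD_gt_1[where 'p='p] power_int_strict_increasing[OF _ CARD_gt_1[where 'p='p]] in
      \<open>auto, metis less_irrefl linorder_neqE minus_minus\<close>)

lemma padic_val_mult:
  "x \<noteq> 0 \<Longrightarrow> y \<noteq> 0 \<Longrightarrow> padic_val (x * y) = padic_val x + padic_val (y :: 'p::prime_card padic)"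
  by (intro padic_val_eqI) (simp add: padic_norm_mult padic_norm_eq_val flip: power_int_add)

lemma padic_val_uniformizer_powi [simp]: "padic_val (uniformizer powi k :: 'p::prime_card padic) = k"
  by (intro padic_val_eqI padic_norm_uniformizer_powi)

lemma padic_unit_part_norm: "x \<noteq> 0 \<Longrightarrow> padic_norm (padic_unit_part (x :: 'p::prime_card padic)) = 1"
  by (simp add: padic_unit_part_def padic_norm_mult padic_norm_uniformizer_powi padic_norm_eq_val flip: power_int_add)

lemma padic_unit_part_mult:
  "x \<noteq> 0 \<Longrightarrow> y \<noteq> 0 \<Longrightarrow> padic_unit_part (x * y) = padic_unit_part x * padic_unit_part (y :: 'p::prime_card padic)"
  by (simp add: padic_unit_part_def padic_val_mult power_int_add power_int_minus power_int_diff field_simps)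

section \<open>Density of the rationals and residues modulo powers of p\<close>

lemma abs_padic_const: "abs_padic (Cauchy_seq (\<lambda>_. q)) = (of_rat q :: 'p::prime_card padic)"
proof -
  define c where "c q = (Cauchy_seq (\<lambda>_. q) :: 'p cauchy_seq)" for q
  have c: "seq_of (c q) = (\<lambda>_. q)" for q
    by (simp add: c_def Cauchy_seq_inverse)
  have c_of_nat: "c (of_nat k) = of_nat k" for k
    by (simp add: c seq_of_of_nat flip: seq_of_inject)
  have c_mult: "c (x * y) = c x * c y" for x y
    by (simp add: c times_cauchy_seq.rep_eq flip: seq_of_inject)
  have c_minus: "c (- x) = - c x" for x
    by (simp add: c uminus_cauchy_seq.rep_eq flip: seq_of_inject)
  have c_of_int: "abs_padic (c (of_int k)) = of_int k" for k
    by (cases k rule: int_cases2) (simp_all add: c_of_nat c_minus of_nat_padic flip: uminus_padic.abs_eq)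
  obtain a b where ab: "quotient_of q = (a, b)" by fastforce
  have q: "q = of_int a / of_int b" and b: "b > 0"
    using quotient_of_div[OF ab] quotient_of_denom_pos[OF ab] .
  have "abs_padic (c q) * abs_padic (c (of_int b)) = abs_padic (c (of_int a))"
    using b by (simp add: q times_padic.abs_eq flip: c_mult)
  then have "abs_padic (c q) = of_int a / of_int b"
    using b by (simp add: c_of_int field_simps)
  then show ?thesis by (simp add: q of_rat_divide c_def)
qed

lemma padic_dense_rat:
  assumes "e > 0"
  obtains q where "padic_norm (x - of_rat q) < (e :: real)"
proof -
  obtain X where X: "x = abs_padic X" by (metis Quotient_abs_rep Quotient_padic)
  have "padic_cauchy CARD('a) (seq_of X)" using seq_of by blast
  \<comment> \<open>A limit preserves only the weak inequality, so the sequence is controlled by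
    \<open>e / 2\<close>.\<close>
  then obtain M where M: "\<forall>m\<ge>M. \<forall>n\<ge>M. rat_abs CARD('a) (seq_of X m - seq_of X n) < e / 2"
    using assms unfolding padic_cauchy_def by (meson half_gt_zero)
  define q where "q = seq_of X M"
  let ?c = "Cauchy_seq (\<lambda>_. q) :: 'a cauchy_seq"
  have "x - of_rat q = abs_padic (X - ?c)"
    unfolding X abs_padic_const[symmetric] minus_padic_def uminus_padic.abs_eq plus_padic.abs_eq by simp
  then have "padic_norm (x - of_rat q) = abs_seq (X - ?c)"
    by (simp add: padic_norm.abs_eq)
  also have "\<dots> \<le> e / 2"
  proof (rule LIMSEQ_le_const2[OF abs_seq_LIMSEQ])
    show "\<exists>N. \<forall>n\<ge>N. rat_abs CARD('a) (seq_of (X - ?c) n) \<le> e / 2"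
      using M by (intro exI[of _ M]) (auto simp: minus_cauchy_seq.rep_eq Cauchy_seq_inverse q_def less_imp_le)
  qed
  finally show ?thesis using that[of q] assms by simp
qed

text \<open>Density reduces this to a p-adically integral fraction c / d. In lowest terms p cannot
  divide d, so d is invertible modulo p^j and the quotient has a representative below p^j.\<close>

lemma zball_residue:
  assumes "(x :: 'p::prime_card padic) \<in> zball 0"
  obtains a where "a < CARD('p) ^ j" "x - of_nat a \<in> zball (- int j)"
proof -
  let ?p = "CARD('p)"
  have p: "prime ?p" by (rule prime_card)
  have "real ?p powi (- int j) > 0" using CARD_gt_1[where 'p='p] by simp
  then obtain q where q: "padic_norm (x - of_rat q) < real ?p powi (- int j)"
    by (rule padic_dense_rat)
  then have xq: "x - of_rat q \<in> zball (- int j)" by (simp add: zball_def)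
  then have "x - of_rat q \<in> zball 0" by (rule zball_mono) simp
  then have q0: "of_rat q \<in> (zball 0 :: 'p padic set)"
    using assms zball_diff[of x 0 "x - of_rat q"] by simp
  obtain c d where cd: "quotient_of q = (c, d)" by fastforce
  have d: "d > 0" "q = of_int c / of_int d" "coprime c d"
    using quotient_of_denom_pos[OF cd] quotient_of_div[OF cd] quotient_of_coprime[OF cd] .
  have "of_int c = of_rat q * (of_int d :: 'p padic)"
    using d(1) by (simp add: d(2) of_rat_divide)
  then have cq: "padic_norm (of_int c :: 'p padic) \<le> padic_norm (of_int d :: 'p padic)"
    using q0 padic_norm_nonneg[of "of_int d :: 'p padic"]
    by (simp add: padic_norm_mult zball_def mult_left_le_one_le padic_norm_nonneg)
  have "\<not> int ?p dvd d"
  proof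
    assume dvd: "int ?p dvd d"
    then have "of_int d \<in> (zball (- int 1) :: 'p padic set)"
      unfolding of_int_in_zball_iff by simp
    with cq have "of_int c \<in> (zball (- int 1) :: 'p padic set)"
      unfolding zball_def by simp
    then have "int ?p dvd c" unfolding of_int_in_zball_iff by simp
    with dvd d(3) p show False
      by (meson coprime_common_divisor not_prime_unit prime_nat_int_transfer)
  qed
  then have cop: "coprime d (int ?p ^ j)"
    using prime_imp_coprime[OF prime_card_int[where 'a='p]] by (simp add: coprime_commute[of d])
  then obtain y where y: "[d * y = 1] (mod int ?p ^ j)"
    using cong_solve_coprime_int by blast
  have "\<not> of_int d \<in> (zball (- int 1) :: 'p padic set)"
    unfolding of_int_in_zball_iff using \<open>\<not> int ?p dvd d\<close> by simp
  then have "padic_val (of_int d :: 'p padic) = 0"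
    using d(1) of_int_in_zball[of d, where 'a='p] zball_iff_val[of "of_int d :: 'p padic" 0]
      zball_iff_val[of "of_int d :: 'p padic" "- 1"] by simp
  then have nd: "padic_norm (of_int d :: 'p padic) = 1"
    using d(1) by (simp add: padic_norm_eq_val)
  define a where "a = nat ((c * y) mod int ?p ^ j)"
  have ia: "int a = (c * y) mod int ?p ^ j"
    using CARD_gt_1[where 'p='p] by (simp add: a_def)
  have "[d * int a = d * (c * y)] (mod int ?p ^ j)"
    unfolding ia by (intro cong_mult cong_refl) (simp add: cong_def)
  also have "d * (c * y) = c * (d * y)" by simp
  also have "[\<dots> = c * 1] (mod int ?p ^ j)" by (intro cong_mult y cong_refl)
  finally have "int ?p ^ j dvd c - d * int a"
    by (simp add: cong_sym_eq cong_iff_dvd_diff)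
  then have "of_int (c - d * int a) \<in> (zball (- int j) :: 'p padic set)"
    unfolding of_int_in_zball_iff .
  moreover have "of_int (c - d * int a) = of_int d * (of_rat q - of_nat a :: 'p padic)"
    using d(1) by (simp add: d(2) of_rat_divide field_simps)
  ultimately have "of_rat q - of_nat a \<in> (zball (- int j) :: 'p padic set)"
    by (simp add: zball_def padic_norm_mult nd)
  from zball_add[OF xq this] have "x - of_nat a \<in> zball (- int j)" by simp
  moreover have "a < ?p ^ j"
    using ia CARD_gt_1[where 'p='p] by (metis of_nat_0_less_iff of_nat_less_iff of_nat_power pos_mod_bound zero_less_card_finite zero_less_power)
  ultimately show ?thesis using that by blast
qed

lemma zball_residue_unique:
  assumes "a < CARD('p) ^ j" "b < CARD('p) ^ j" "(x :: 'p::prime_card padic) - of_nat a \<in> zball (- int j)" "x - of_nat b \<in> zball (- int j)"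
  shows "a = b"
proof -
  have "(x - of_nat a) - (x - of_nat b) \<in> zball (- int j)" using assms(3,4) by (rule zball_diff)
  then have "of_int (int b - int a) \<in> (zball (- int j) :: 'p padic set)" by simp
  then have "int (CARD('p) ^ j) dvd int b - int a" unfolding of_int_in_zball_iff by simp
  then have "[int b = int a] (mod int (CARD('p) ^ j))" by (simp add: cong_iff_dvd_diff)
  then have "[b = a] (mod CARD('p) ^ j)" by (simp only: cong_int_iff)
  with assms(1,2) show ?thesis by (simp add: cong_def)
qed

section \<open>The additive character\<close>

text \<open>The rational numbers among which \<^const>\<open>padic_char\<close> makes its choice.\<close>

definition frac_repr :: "'p::prime_card padic \<Rightarrow> rat \<Rightarrow> bool" where
  "frac_repr \<alpha> a \<longleftrightarrow> (\<exists>t\<ge>1. \<exists>m::int. a = of_int m / of_nat CARD('p) ^ t) \<and> \<alpha> - of_rat a \<in> padic_ints"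

lemma of_rat_frac: "of_rat (of_int m / of_nat k ^ t) = (of_int m / of_nat k ^ t :: 'a::field_char_0)"
  by (simp only: of_rat_divide of_rat_power of_rat_of_int_eq of_rat_of_nat_eq)

lemma frac_reprI:
  assumes "(\<alpha> :: 'p::prime_card padic) - of_int m / uniformizer ^ t \<in> zball 0"
  shows "frac_repr \<alpha> (of_int m / of_nat CARD('p) ^ t)"
proof -
  \<comment> \<open>\<open>frac_repr\<close> asks for an exponent of at least 1; expanding the
    fraction by p covers t = 0.\<close>
  have "(of_int m / of_nat CARD('p) ^ t :: rat) = of_int (m * int CARD('p)) / of_nat CARD('p) ^ Suc t"
    by simp
  moreover have "\<alpha> - of_rat (of_int m / of_nat CARD('p) ^ t) \<in> padic_ints"
    unfolding of_rat_frac padic_ints_eq_zball by (rule assms)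
  ultimately show ?thesis
    unfolding frac_repr_def by (metis Suc_eq_plus1 le_add2)
qed

text \<open>Scaling by p^t moves \<open>\<alpha>\<close> into Z_p; its residue a modulo p^t there
  yields the fraction a / p^t.\<close>

lemma frac_repr_exists: "\<exists>a. frac_repr (\<alpha> :: 'p::prime_card padic) a"
proof -
  obtain t where "padic_norm \<alpha> < real CARD('p) ^ t"
    using real_arch_pow[OF CARD_gt_1[where 'p='p]] by blast
  then have "\<alpha> \<in> zball (int t)" by (simp add: zball_def)
  then have "uniformizer powi int t * \<alpha> \<in> zball 0" by (subst zball_powi_mult_iff) simp
  then obtain a where "uniformizer powi int t * \<alpha> - of_nat a \<in> zball (- int t)"
    by (rule zball_residue)
  moreover have "uniformizer powi int t * \<alpha> - of_nat a
      = uniformizer powi int t * (\<alpha> - of_int (int a) / uniformizer ^ t)"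
    by (simp add: field_simps)
  ultimately have "\<alpha> - of_int (int a) / uniformizer ^ t \<in> zball 0"
    by (simp only: zball_powi_mult_iff) simp
  then show ?thesis using frac_reprI by blast
qed

text \<open>The difference has the form N / p^(t+s) and is p-adically integral, so p^(t+s) divides
  N.\<close>

lemma frac_repr_unique:
  assumes "frac_repr (\<alpha> :: 'p::prime_card padic) a" "frac_repr \<alpha> b"
  shows "\<exists>k::int. a = b + of_int k"
proof -
  let ?p = "CARD('p)"
  obtain t m where a: "a = of_int m / of_nat ?p ^ t" "\<alpha> - of_rat a \<in> zball 0"
    using assms(1) by (auto simp: frac_repr_def padic_ints_eq_zball)
  obtain s n where b: "b = of_int n / of_nat ?p ^ s" "\<alpha> - of_rat b \<in> zball 0"
    using assms(2) by (auto simp: frac_repr_def padic_ints_eq_zball)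
  define N where "N = m * int ?p ^ s - n * int ?p ^ t"
  have ab: "a - b = of_int N / of_nat ?p ^ (t + s)"
    by (simp add: a(1) b(1) N_def power_add field_simps)
  have "(\<alpha> - of_rat b) - (\<alpha> - of_rat a) \<in> zball 0" by (rule zball_diff[OF b(2) a(2)])
  then have "of_rat (a - b) \<in> (zball 0 :: 'p padic set)" by (simp add: of_rat_diff)
  then have "uniformizer powi - int (t + s) * of_int N \<in> (zball 0 :: 'p padic set)"
    unfolding ab of_rat_frac power_int_minus power_int_of_nat by (simp only: divide_inverse mult.commute)
  then have "of_int N \<in> (zball (- int (t + s)) :: 'p padic set)"
    by (simp only: zball_powi_mult_iff add_0)
  then obtain k where "N = int ?p ^ (t + s) * k"
    unfolding of_int_in_zball_iff by (elim dvdE)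
  then have "a - b = of_int k" by (simp add: ab)
  then show ?thesis by (intro exI[of _ k]) (simp add: algebra_simps)
qed

text \<open>Two representatives differ by an integer, which the exponential does not see; any of
  them may therefore replace the chosen one.\<close>

lemma padic_char_eq:
  assumes "frac_repr \<alpha> a"
  shows "padic_char \<alpha> = exp (- 2 * of_real pi * \<i> * of_rat a)"
proof -
  define b where "b = (SOME a. frac_repr \<alpha> a)"
  have "frac_repr \<alpha> b" unfolding b_def using assms by (rule someI)
  then obtain k :: int where k: "b = a + of_int k" using frac_repr_unique[OF _ assms] by blast
  have "padic_char \<alpha> = exp (- 2 * of_real pi * \<i> * of_rat b)"
    unfolding padic_char_def b_def frac_repr_def ..
  also have "\<dots> = exp (- 2 * of_real pi * \<i> * of_rat a) * exp ((2 * of_int (- k) * of_real pi) * \<i>)"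
    unfolding exp_add[symmetric] by (simp add: k of_rat_add algebra_simps)
  also have "exp ((2 * of_int (- k) * of_real pi) * \<i>) = 1"
    using exp_integer_2pi[of "of_int (- k)"] by simp
  finally show ?thesis by simp
qed

lemma padic_char_add: "padic_char (x + y) = padic_char x * padic_char (y :: 'p::prime_card padic)"
proof -
  let ?p = "CARD('p)"
  obtain a b where ab: "frac_repr x a" "frac_repr y b" using frac_repr_exists by metis
  then obtain t m s n where a: "a = of_int m / of_nat ?p ^ t" "x - of_rat a \<in> zball 0"
    and b: "b = of_int n / of_nat ?p ^ s" "y - of_rat b \<in> zball 0"
    by (auto simp: frac_repr_def padic_ints_eq_zball)
  have e: "a + b = of_int (m * int ?p ^ s + n * int ?p ^ t) / of_nat ?p ^ (t + s)"
    by (simp add: a(1) b(1) power_add field_simps)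
  have "(x - of_rat a) + (y - of_rat b) \<in> zball 0" by (rule zball_add[OF a(2) b(2)])
  also have "(x - of_rat a) + (y - of_rat b) = x + y - of_rat (a + b)" by (simp add: of_rat_add)
  also have "(of_rat (a + b) :: 'p padic) = of_int (m * int ?p ^ s + n * int ?p ^ t) / uniformizer ^ (t + s)"
    unfolding e by (rule of_rat_frac)
  finally have "frac_repr (x + y) (a + b)" unfolding e by (rule frac_reprI)
  then show ?thesis using ab
    by (simp add: padic_char_eq of_rat_add exp_add[symmetric] algebra_simps)
qed

lemma padic_char_zball [simp]: "\<alpha> \<in> zball 0 \<Longrightarrow> padic_char \<alpha> = 1"
  using padic_char_eq[OF frac_reprI[of \<alpha> 0 0]] by simp

lemma padic_char_cong: "x - y \<in> zball 0 \<Longrightarrow> padic_char x = padic_char y"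
  using padic_char_add[of "x - y" y] by simp

lemma padic_char_of_int_div:
  "padic_char (of_int m / uniformizer :: 'p::prime_card padic) = gauss_char (- of_int m :: 'p mod_ring)"
proof -
  have "frac_repr (of_int m / uniformizer :: 'p padic) (of_int m / of_nat CARD('p) ^ 1)"
    by (rule frac_reprI) simp
  then have "padic_char (of_int m / uniformizer :: 'p padic)
      = exp (- 2 * of_real pi * \<i> * (of_int m / of_nat CARD('p)))"
    by (simp add: padic_char_eq of_rat_divide)
  also have "\<dots> = cis (2 * pi * of_int (- m) / real CARD('p))"
    by (simp add: cis_conv_exp mult_ac)
  also have "\<dots> = gauss_char (of_int (- m) :: 'p mod_ring)"
    by (rule gauss_char_of_int[symmetric])
  finally show ?thesis by simp
qed

section \<open>Integration of locally constant functions\<close>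

text \<open>Division with remainder, c = a + m b. With m = p this isolates the lowest p-adic digit
  a.\<close>

lemma sum_lessThan_mult:
  "(\<Sum>c<m * n. h (c :: nat)) = (\<Sum>a<m. \<Sum>b<n. h (a + m * b))" if "m > 0"
proof -
  have "(\<Sum>a<m. \<Sum>b<n. h (a + m * b)) = (\<Sum>(a, b)\<in>{..<m} \<times> {..<n}. h (a + m * b))"
    by (simp add: sum.cartesian_product)
  also have "\<dots> = (\<Sum>c<m * n. h c)"
  proof (rule sum.reindex_bij_witness[of _ "\<lambda>c. (c mod m, c div m)" "\<lambda>(a, b). a + m * b"])
    fix x assume "x \<in> {..<m} \<times> {..<n}"
    then obtain a b where ab: "x = (a, b)" "a < m" "b < n" by auto
    have "a + m * b < m + m * b" using ab by simp
    also have "\<dots> = m * Suc b" by simp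
    also have "\<dots> \<le> m * n" using ab by (intro mult_left_mono) auto
    finally show "(case x of (a, b) \<Rightarrow> a + m * b) \<in> {..<m * n}" using ab by simp
  qed (use that in \<open>auto simp: less_mult_imp_div_less mult.commute\<close>)
  finally show ?thesis ..
qed

section \<open>Volumes of balls and Riemann sums\<close>

locale padic_haar =
  fixes \<mu> :: "'p::prime_card padic measure"
  assumes haar: "is_padic_haar \<mu>"
begin

lemma sets_haar [measurable_cong, simp]: "sets \<mu> = sets borel"
  using haar by (simp add: is_padic_haar_def)

lemma space_haar [simp]: "space \<mu> = UNIV"
  using sets_eq_imp_space_eq[OF sets_haar] by simp

lemma zball_measurable: "(zball m :: 'p padic set) \<in> sets \<mu>"
proof -
  have "zball m = cball (0 :: 'p padic) (real CARD('p) powi m)"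
    by (auto simp: zball_def cball_def dist_padic_def padic_norm_minus)
  then show ?thesis by simp
qed

definition zcoset :: "'p padic \<Rightarrow> int \<Rightarrow> 'p padic set" where
  "zcoset a m = {x. x - a \<in> zball m}"

lemma zcoset_eq_image: "zcoset a m = (+) a ` zball m"
proof (intro equalityI subsetI)
  fix x assume "x \<in> zcoset a m"
  then show "x \<in> (+) a ` zball m" by (intro image_eqI[of _ _ "x - a"]) (simp_all add: zcoset_def)
qed (auto simp: zcoset_def)

lemma zcoset_measurable: "zcoset a m \<in> sets \<mu>"
proof -
  have "zcoset a m = cball a (real CARD('p) powi m)"
    by (auto simp: zcoset_def zball_def cball_def dist_padic_def) (metis minus_diff_eq padic_norm_minus)+
  then show ?thesis by simp
qed

lemma emeasure_zcoset: "emeasure \<mu> (zcoset a m) = emeasure \<mu> (zball m)"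
  using haar zball_measurable[of m] unfolding zcoset_eq_image is_padic_haar_def by simp

lemma zball_eq_UN_zcoset:
  "zball m = (\<Union>a<CARD('p) ^ j. zcoset (of_nat a * uniformizer powi - m) (m - int j))"
proof (intro equalityI subsetI)
  fix x :: "'p padic" assume "x \<in> zball m"
  then have "uniformizer powi m * x \<in> zball 0" by (simp add: zball_powi_mult_iff)
  then obtain a where a: "a < CARD('p) ^ j" "uniformizer powi m * x - of_nat a \<in> zball (- int j)"
    by (rule zball_residue)
  have "uniformizer powi m * x - of_nat a = uniformizer powi m * (x - of_nat a * uniformizer powi - m)"
    by (simp add: power_int_minus right_diff_distrib)
  with a(2) have "x - of_nat a * uniformizer powi - m \<in> zball (m - int j)"
    by (simp only: zball_powi_mult_iff) simp
  with a(1) show "x \<in> (\<Union>a<CARD('p) ^ j. zcoset (of_nat a * uniformizer powi - m) (m - int j))"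
    by (auto simp: zcoset_def)
next
  fix x :: "'p padic" assume "x \<in> (\<Union>a<CARD('p) ^ j. zcoset (of_nat a * uniformizer powi - m) (m - int j))"
  then obtain a where "x - of_nat a * uniformizer powi - m \<in> zball (m - int j)"
    by (auto simp: zcoset_def)
  then have "x - of_nat a * uniformizer powi - m \<in> zball m" by (rule zball_mono) simp
  moreover have "of_nat a * (uniformizer powi - m :: 'p padic) \<in> zball m"
    using zball_mult[OF of_nat_in_zball uniformizer_powi_in_zball[of "- m"], of a] by simp
  ultimately show "x \<in> zball m" using zball_add by fastforce
qed

lemma disjoint_zcosets:
  "disjoint_family_on (\<lambda>a. zcoset (of_nat a * uniformizer powi - m) (m - int j)) {..<CARD('p) ^ j}"
proof -
  have "a = b" if "a < CARD('p) ^ j" "b < CARD('p) ^ j"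
    "x \<in> zcoset (of_nat a * uniformizer powi - m) (m - int j)"
    "x \<in> zcoset (of_nat b * uniformizer powi - m) (m - int j)" for a b x
  proof -
    have e: "uniformizer powi m * x - of_nat c = uniformizer powi m * (x - of_nat c * uniformizer powi - m)" for c
      by (simp add: power_int_minus right_diff_distrib)
    show ?thesis
      using that(3,4) by (intro zball_residue_unique[OF that(1,2), of "uniformizer powi m * x"])
        (simp_all only: e zball_powi_mult_iff zcoset_def mem_Collect_eq, simp_all)
  qed
  then show ?thesis by (fastforce simp: disjoint_family_on_def)
qed

lemma emeasure_zball_subdivide:
  "emeasure \<mu> (zball m) = of_nat (CARD('p) ^ j) * emeasure \<mu> (zball (m - int j))"
proof -
  have "emeasure \<mu> (zball m) = (\<Sum>a<CARD('p) ^ j. emeasure \<mu> (zcoset (of_nat a * uniformizer powi - m) (m - int j)))"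
    unfolding zball_eq_UN_zcoset[of m j]
    by (rule sum_emeasure[symmetric]) (auto intro: disjoint_zcosets zcoset_measurable simp del: sets_haar)
  then show ?thesis by (simp add: emeasure_zcoset)
qed

text \<open>Subdivision is used in both directions: a ball larger than Z_p consists of translates of
  Z_p, and Z_p consists of translates of any smaller ball.\<close>

lemma emeasure_zball: "emeasure \<mu> (zball m) = ennreal (real CARD('p) powi m)"
proof -
  have one: "emeasure \<mu> (zball 0) = 1"
    using haar by (simp add: is_padic_haar_def padic_ints_eq_zball)
  show ?thesis
  proof (cases "m \<ge> 0")
    case True
    then obtain k where k: "m = int k" by (metis nonneg_int_cases)
    show ?thesis
      using emeasure_zball_subdivide[of m k] by (simp add: k one ennreal_of_nat_eq_real_of_nat ennreal_power)
  next
    case False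
    then obtain k where k: "m = - int k" by (metis int_cases2 neg_int_cases not_le)
    have sub: "1 = of_nat (CARD('p) ^ k) * emeasure \<mu> (zball m)"
      using emeasure_zball_subdivide[of 0 k] by (simp add: k one)
    \<comment> \<open>The equation can be divided by p^k only in the reals. An infinite volume is
      excluded because it would make the right-hand side infinite.\<close>
    then have "emeasure \<mu> (zball m) \<noteq> \<infinity>" by (auto simp: ennreal_mult_eq_top_iff)
    then obtain x where x: "emeasure \<mu> (zball m) = ennreal x" "x \<ge> 0"
      by (cases "emeasure \<mu> (zball m)") auto
    have "ennreal 1 = ennreal (real (CARD('p) ^ k) * x)"
      using sub x by (simp add: ennreal_mult ennreal_of_nat_eq_real_of_nat)
    then have "1 = real (CARD('p) ^ k) * x" using x(2) by (subst (asm) ennreal_inj) simp_all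
    then have "x = real CARD('p) powi m" by (simp add: k power_int_minus field_simps)
    with x(1) show ?thesis by simp
  qed
qed

lemma measure_zcoset: "measure \<mu> (zcoset a m) = real CARD('p) powi m"
  by (simp add: measure_def emeasure_zcoset emeasure_zball)

lemma sigma_finite_haar: "sigma_finite_measure \<mu>"
proof
  have "x \<in> (\<Union>T. zball (int T))" for x :: "'p padic"
    using real_arch_pow[OF CARD_gt_1[where 'p='p], of "padic_norm x"] by (auto simp: zball_def intro: less_imp_le)
  then show "\<exists>A. countable A \<and> A \<subseteq> sets \<mu> \<and> \<Union>A = space \<mu> \<and> (\<forall>a\<in>A. emeasure \<mu> a \<noteq> \<infinity>)"
    by (intro exI[of _ "range (\<lambda>T. zball (int T))"]) (auto simp: emeasure_zball zball_measurable simp del: sets_haar)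
qed

text \<open>On the ball, f is constant on each of p^j disjoint translates of
  \<open>zball (m - int j)\<close>, hence a step function; this gives integrability and the value
  together. All later integrals over balls rest on it.\<close>

lemma has_integral_zball:
  fixes f :: "'p padic \<Rightarrow> complex"
  assumes "\<And>x y. x \<in> zball m \<Longrightarrow> y \<in> zball (m - int j) \<Longrightarrow> f (x + y) = f x"
  shows "has_bochner_integral \<mu> (\<lambda>x. indicator (zball m) x *\<^sub>R f x)
    (of_real (real CARD('p) powi (m - int j)) * (\<Sum>a<CARD('p) ^ j. f (of_nat a * uniformizer powi - m)))"
proof -
  define c where "c a = (of_nat a * uniformizer powi - m :: 'p padic)" for a
  define S where "S a = zcoset (c a) (m - int j)" for a
  have c: "c a \<in> zball m" for a
    using zball_mult[OF of_nat_in_zball uniformizer_powi_in_zball[of "- m"], of a] by (simp add: c_def)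
  have U: "zball m = (\<Union>a<CARD('p) ^ j. S a)"
    unfolding S_def c_def by (rule zball_eq_UN_zcoset)
  have D: "disjoint_family_on S {..<CARD('p) ^ j}"
    unfolding S_def c_def by (rule disjoint_zcosets)
  have f: "f x = f (c a)" if "x \<in> S a" for x a
    using assms[OF c, of "x - c a" a] that by (simp add: S_def zcoset_def)
  have "indicator (zball m) x *\<^sub>R f x = (\<Sum>a<CARD('p) ^ j. indicator (S a) x *\<^sub>R f (c a))" for x
  proof (cases "x \<in> zball m")
    case True
    then obtain b where b: "b < CARD('p) ^ j" "x \<in> S b" using U by auto
    then have "x \<notin> S a" if "a < CARD('p) ^ j" "a \<noteq> b" for a
      using D that by (auto simp: disjoint_family_on_def)
    then have "(\<Sum>a<CARD('p) ^ j. indicator (S a) x *\<^sub>R f (c a)) = (\<Sum>a<CARD('p) ^ j. if a = b then f (c b) else 0)"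
      using b by (intro sum.cong) (auto simp: indicator_def)
    then show ?thesis using b f[OF b(2)] True by simp
  next
    case False
    then have "\<forall>a<CARD('p) ^ j. x \<notin> S a" using U by auto
    with False show ?thesis by simp
  qed
  moreover have "has_bochner_integral \<mu> (\<lambda>x. \<Sum>a<CARD('p) ^ j. indicator (S a) x *\<^sub>R f (c a))
      (\<Sum>a<CARD('p) ^ j. measure \<mu> (S a) *\<^sub>R f (c a))"
    by (intro has_bochner_integral_sum has_bochner_integral_indicator)
      (simp_all add: S_def emeasure_zcoset emeasure_zball zcoset_measurable del: sets_haar)
  ultimately show ?thesis
    by (simp add: S_def measure_zcoset c_def scaleR_conv_of_real sum_distrib_left)
qed

text \<open>On the compact set \<open>Z\<^sub>p\<close>, local constancy is uniform.\<close>

definition loc_const :: "('p padic \<Rightarrow> complex) \<Rightarrow> bool" where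
  "loc_const f \<longleftrightarrow> (\<exists>j. \<forall>x\<in>zball 0. \<forall>y\<in>zball (- int j). f (x + y) = f x)"

definition zint :: "('p padic \<Rightarrow> complex) \<Rightarrow> complex" where
  "zint f = (LINT x:padic_ints|\<mu>. f x)"

lemma zint_eq_sum:
  assumes "\<And>x y. x \<in> zball 0 \<Longrightarrow> y \<in> zball (- int j) \<Longrightarrow> f (x + y) = f x"
  shows "zint f = (\<Sum>a<CARD('p) ^ j. f (of_nat a)) / of_nat CARD('p) ^ j"
proof -
  have "zint f = of_real (real CARD('p) powi (0 - int j)) * (\<Sum>a<CARD('p) ^ j. f (of_nat a * uniformizer powi - 0))"
    unfolding zint_def set_lebesgue_integral_def padic_ints_eq_zball
    by (rule has_bochner_integral_integral_eq[OF has_integral_zball]) (use assms in simp)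
  then show ?thesis by (simp add: power_int_minus divide_inverse mult.commute)
qed

lemma zint_integrable:
  assumes "loc_const f"
  shows "integrable \<mu> (\<lambda>x. indicator padic_ints x *\<^sub>R f x)"
proof -
  obtain j where "\<And>x y. x \<in> zball 0 \<Longrightarrow> y \<in> zball (- int j) \<Longrightarrow> f (x + y) = f x"
    using assms by (auto simp: loc_const_def)
  then show ?thesis
    unfolding padic_ints_eq_zball using has_integral_zball[of 0 j f] by (auto simp: integrable.simps)
qed

lemma zint_const [simp]: "zint (\<lambda>_. c) = c"
  using zint_eq_sum[of 0 "\<lambda>_. c"] by simp

lemma zint_cong: "(\<And>x. x \<in> zball 0 \<Longrightarrow> f x = g x) \<Longrightarrow> zint f = zint g"
  unfolding zint_def set_lebesgue_integral_def padic_ints_eq_zball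
  by (rule Bochner_Integration.integral_cong) (auto simp: indicator_def)

lemma zint_mult_left: "zint (\<lambda>x. c * f x) = c * zint f"
  unfolding zint_def set_lebesgue_integral_def by (simp flip: integral_mult_right_zero)

text \<open>The substitution x = a + p z on the residue class of a modulo p, each class having
  volume 1/p.\<close>

lemma zint_split:
  assumes "loc_const f"
  shows "zint f = (\<Sum>a<CARD('p). zint (\<lambda>z. f (of_nat a + uniformizer * z))) / of_nat CARD('p)"
proof -
  obtain j where j: "\<And>x y. x \<in> zball 0 \<Longrightarrow> y \<in> zball (- int j) \<Longrightarrow> f (x + y) = f x"
    using assms by (auto simp: loc_const_def)
  have U: "(uniformizer :: 'p padic) \<in> zball (-1)"
    using uniformizer_powi_in_zball[of 1] by simp
  have inner: "zint (\<lambda>z. f (of_nat a + uniformizer * z))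
      = (\<Sum>b<CARD('p) ^ j. f (of_nat (a + CARD('p) * b))) / of_nat CARD('p) ^ j" for a
  proof -
    have "f (of_nat a + uniformizer * (x + y)) = f (of_nat a + uniformizer * x)"
      if "x \<in> zball 0" "y \<in> zball (- int j)" for x y
    proof -
      have "of_nat a + uniformizer * x \<in> zball 0"
        using zball_mult[OF U that(1)] by (intro zball_add) (auto intro: zball_mono)
      moreover have "uniformizer * y \<in> zball (- int j)"
        using zball_mult[OF U that(2)] by (rule zball_mono) simp
      ultimately show ?thesis using j by (simp add: distrib_left flip: add.assoc)
    qed
    then show ?thesis using zint_eq_sum[of j "\<lambda>z. f (of_nat a + uniformizer * z)"] by simp
  qed
  \<comment> \<open>Level j + 1 is finer than f demands; it matches the inner Riemann sums at level
    j once the digit a is split off.\<close>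
  have "zint f = (\<Sum>c<CARD('p) ^ Suc j. f (of_nat c)) / of_nat CARD('p) ^ Suc j"
    by (rule zint_eq_sum) (use j zball_mono in fastforce)
  also have "(\<Sum>c<CARD('p) ^ Suc j. f (of_nat c)) = (\<Sum>a<CARD('p). \<Sum>b<CARD('p) ^ j. f (of_nat (a + CARD('p) * b)))"
    unfolding power_Suc by (rule sum_lessThan_mult) simp
  finally show ?thesis
    unfolding inner by (simp only: sum_divide_distrib[symmetric] divide_divide_eq_left power_Suc mult.commute)
qed

lemma integral_zball_scale:
  assumes "\<And>x y. x \<in> zball m \<Longrightarrow> y \<in> zball (m - int j) \<Longrightarrow> f (x + y) = f x"
  shows "(LINT x:zball m|\<mu>. f x) = of_real (real CARD('p) powi m) * zint (\<lambda>s. f (uniformizer powi - m * s))"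
proof -
  have "f (uniformizer powi - m * (x + y)) = f (uniformizer powi - m * x)"
    if "x \<in> zball 0" "y \<in> zball (- int j)" for x y
    using that assms[of "uniformizer powi - m * x" "uniformizer powi - m * y"]
    by (simp add: zball_powi_mult_iff distrib_left)
  then have "zint (\<lambda>s. f (uniformizer powi - m * s))
      = (\<Sum>a<CARD('p) ^ j. f (uniformizer powi - m * of_nat a)) / of_nat CARD('p) ^ j"
    by (rule zint_eq_sum)
  moreover have "(LINT x:zball m|\<mu>. f x)
      = of_real (real CARD('p) powi (m - int j)) * (\<Sum>a<CARD('p) ^ j. f (of_nat a * uniformizer powi - m))"
    unfolding set_lebesgue_integral_def
    by (rule has_bochner_integral_integral_eq[OF has_integral_zball]) (use assms in simp)
  ultimately show ?thesis by (simp add: power_int_diff mult.commute divide_inverse)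
qed

end

section \<open>Quadratic exponential integrals\<close>

lemma padic_norm_less_1_iff: "padic_norm (x :: 'p::prime_card padic) < 1 \<longleftrightarrow> x \<in> zball (- 1)"
proof (cases "x = 0")
  case False
  have "real CARD('p) powi (- padic_val x) < real CARD('p) powi 0 \<longleftrightarrow> - padic_val x < 0"
    by (simp only: CARD_powi_le_iff flip: not_le)
  with False show ?thesis by (simp add: zball_iff_val padic_norm_eq_val) linarith
qed simp

lemma of_int_in_zball_minus_1_iff:
  "(of_int k :: 'p::prime_card padic) \<in> zball (- 1) \<longleftrightarrow> (of_int k :: 'p mod_ring) = 0"
  using of_int_in_zball_iff[of k 1, where 'p='p] of_int_mod_ring_eq_iff[of k 0, where 'p='p]
  by (simp add: cong_0_iff)

lemma of_int_mod_ring_eqI: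
  "(u :: 'p::prime_card padic) - of_int a \<in> zball (- 1) \<Longrightarrow> u - of_int b \<in> zball (- 1) \<Longrightarrow>
    (of_int a :: 'p mod_ring) = of_int b"
  using zball_diff[of "u - of_int b" "- 1" "u - of_int a"] of_int_in_zball_minus_1_iff[of "a - b", where 'p='p]
  by simp

lemma padic_residue:
  assumes "(u :: 'p::prime_card padic) \<in> zball 0"
  shows "u - of_int (padic_residue u) \<in> zball (- 1)"
proof -
  obtain a where a: "a < CARD('p) ^ 1" "u - of_nat a \<in> zball (- int 1)"
    using zball_residue[OF assms] by blast
  have "0 \<le> padic_residue u \<and> padic_residue u < int CARD('p) \<and> padic_norm (u - of_int (padic_residue u)) < 1"
    unfolding padic_residue_def
  proof (rule theI)
    show "0 \<le> int a \<and> int a < int CARD('p) \<and> padic_norm (u - of_int (int a)) < 1"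
      using a by (simp add: padic_norm_less_1_iff)
    fix b assume b: "0 \<le> b \<and> b < int CARD('p) \<and> padic_norm (u - of_int b) < 1"
    then have "(of_int b :: 'p mod_ring) = of_int (int a)"
      using a by (intro of_int_mod_ring_eqI[of u]) (simp_all add: padic_norm_less_1_iff)
    then have "[b = int a] (mod int CARD('p))" unfolding of_int_mod_ring_eq_iff .
    with b a show "b = int a" by (simp add: cong_def)
  qed
  then show ?thesis by (simp add: padic_norm_less_1_iff)
qed

lemma padic_Legendre_eq:
  assumes "(u :: 'p::prime_card padic) - of_int a \<in> zball (- 1)"
  shows "padic_Legendre u = qchar (of_int a :: 'p mod_ring)"
proof -
  have "u - of_int a \<in> zball 0" using assms by (rule zball_mono) simp
  then have "u \<in> zball 0" using zball_add[of "u - of_int a" 0 "of_int a"] by simp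
  then have "(of_int (padic_residue u) :: 'p mod_ring) = of_int a"
    by (rule of_int_mod_ring_eqI[OF padic_residue assms])
  then show ?thesis by (simp add: padic_Legendre_def flip: qchar_of_int)
qed

lemma padic_Legendre_mult:
  assumes "CARD('p) \<ge> 3" "(u :: 'p::prime_card padic) \<in> zball 0" "v \<in> zball 0"
  shows "padic_Legendre (u * v) = padic_Legendre u * padic_Legendre v"
proof -
  define a b where "a = padic_residue u" and "b = padic_residue v"
  have a: "u - of_int a \<in> zball (- 1)" and b: "v - of_int b \<in> zball (- 1)"
    using assms by (simp_all add: a_def b_def padic_residue)
  have "(u - of_int a) * v + (v - of_int b) * of_int a \<in> zball (- 1)"
    using a b assms by (intro zball_add zball_mult_ints) simp_all
  also have "(u - of_int a) * v + (v - of_int b) * of_int a = u * v - of_int (a * b)"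
    by (simp add: algebra_simps)
  finally show ?thesis
    using padic_Legendre_eq[OF a] padic_Legendre_eq[OF b] padic_Legendre_eq[of "u * v" "a * b"]
      qchar_mult[OF assms(1), of "of_int a" "of_int b"] by simp
qed

lemma padic_val_of_nat:
  assumes "\<not> CARD('p) dvd a"
  shows "padic_val (of_nat a :: 'p::prime_card padic) = 0"
proof -
  have "a \<noteq> 0" using assms by (metis dvd_0_right)
  moreover have "\<not> of_nat a \<in> (zball (- 1) :: 'p padic set)"
    using of_int_in_zball_iff[of "int a" 1, where 'p='p] assms by simp
  ultimately show ?thesis
    using of_nat_in_zball[of a, where 'a='p] zball_iff_val[of "of_nat a :: 'p padic" 0]
      zball_iff_val[of "of_nat a :: 'p padic" "- 1"] by simp
qed

lemma exists_zball: "\<exists>j. (x :: 'p::prime_card padic) \<in> zball (int j)"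
  using real_arch_pow[OF CARD_gt_1[where 'p='p], of "padic_norm x"]
  by (auto simp: zball_def intro: less_imp_le)

text \<open>For \<open>\<gamma>\<close> in p^(-1) Z_p the value e_p(\<open>\<gamma>\<close> a)
  depends only on a modulo p. Here r is the residue of p \<open>\<gamma>\<close>, and the minus sign
  is that of \<open>padic_char\<close>.\<close>

lemma zball_1_residue:
  assumes "(\<gamma> :: 'p::prime_card padic) \<in> zball 1"
  obtains r :: int where "uniformizer * \<gamma> - of_int r \<in> zball (- 1)"
    "\<And>a. padic_char (\<gamma> * of_int a) = gauss_char (- of_int r * of_int a :: 'p mod_ring)"
proof -
  have "uniformizer powi 1 * \<gamma> \<in> zball 0" using assms by (subst zball_powi_mult_iff) simp
  then have r: "uniformizer * \<gamma> - of_int (padic_residue (uniformizer * \<gamma>)) \<in> zball (- 1)"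
    by (intro padic_residue) simp
  define r where "r = padic_residue (uniformizer * \<gamma>)"
  have "padic_char (\<gamma> * of_int a) = gauss_char (- of_int r * of_int a :: 'p mod_ring)" for a
  proof -
    have "uniformizer powi -1 * ((uniformizer * \<gamma> - of_int r) * of_int a) \<in> zball 0"
      using zball_mult_ints[OF r, of "of_int a"] by (simp only: zball_powi_mult_iff r_def) simp
    also have "uniformizer powi -1 * ((uniformizer * \<gamma> - of_int r) * of_int a)
        = \<gamma> * of_int a - of_int (r * a) / uniformizer"
      by (simp add: field_simps)
    finally have "padic_char (\<gamma> * of_int a) = padic_char (of_int (r * a) / uniformizer :: 'p padic)"
      by (rule padic_char_cong)
    also have "\<dots> = gauss_char (- of_int (r * a) :: 'p mod_ring)"
      by (rule padic_char_of_int_div)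
    finally show ?thesis by simp
  qed
  with r show ?thesis using that unfolding r_def by blast
qed

lemma sum_lessThan_periodic_shift:
  assumes "\<And>a. g (a + N) = (g a :: 'a::ab_group_add)"
  shows "(\<Sum>a<N. g (a + m)) = (\<Sum>a<N. g (a :: nat))"
proof (induction m)
  case (Suc m)
  have "(\<Sum>a<N. g (Suc a + m)) + g m = (\<Sum>a<Suc N. g (a + m))"
    by (subst sum.lessThan_Suc_shift) (simp add: add.commute)
  also have "\<dots> = (\<Sum>a<N. g (a + m)) + g m"
    using assms[of m] by (simp add: add.commute)
  finally show ?case using Suc.IH by simp
qed simp

lemma mult_uniformizer_in_zball_iff: "x * uniformizer \<in> zball m \<longleftrightarrow> (x :: 'p::prime_card padic) \<in> zball (m + 1)"
  using zball_powi_mult_iff[of 1 x m] by (simp add: mult.commute)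

lemma mult_uniformizer_sq_in_zball_iff: "x * uniformizer ^ 2 \<in> zball m \<longleftrightarrow> (x :: 'p::prime_card padic) \<in> zball (m + 2)"
  by (simp add: power2_eq_square mult_uniformizer_in_zball_iff add.commute flip: mult.assoc)

context padic_haar
begin

text \<open>Modulo p^j the shift h is a natural number m, and adding m permutes the residues modulo
  p^j.\<close>

lemma zint_shift:
  assumes f: "loc_const f" and h: "h \<in> zball 0"
  shows "zint (\<lambda>x. f (x + h)) = zint f"
proof -
  obtain j where j: "\<And>x y. x \<in> zball 0 \<Longrightarrow> y \<in> zball (- int j) \<Longrightarrow> f (x + y) = f x"
    using f by (auto simp: loc_const_def)
  obtain m where m: "h - of_nat m \<in> zball (- int j)"
    using zball_residue[OF h] by blast
  have "f (x + y + h) = f (x + h)" if "x \<in> zball 0" "y \<in> zball (- int j)" for x y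
    using j[OF zball_add[OF that(1) h] that(2)] by (simp add: add_ac)
  then have "zint (\<lambda>x. f (x + h)) = (\<Sum>a<CARD('p) ^ j. f (of_nat a + h)) / of_nat CARD('p) ^ j"
    by (rule zint_eq_sum)
  also have "(\<Sum>a<CARD('p) ^ j. f (of_nat a + h)) = (\<Sum>a<CARD('p) ^ j. f (of_nat (a + m)))"
  proof (rule sum.cong[OF refl])
    fix a
    show "f (of_nat a + h) = f (of_nat (a + m))"
      using j[OF of_nat_in_zball m, of "a + m"] by simp
  qed
  also have "\<dots> = (\<Sum>a<CARD('p) ^ j. f (of_nat a))"
  proof (rule sum_lessThan_periodic_shift)
    fix a
    have "of_nat (CARD('p) ^ j) \<in> (zball (- int j) :: 'p padic set)"
      using of_int_in_zball_iff[of "int (CARD('p) ^ j)" j, where 'p='p] by simp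
    then show "f (of_nat (a + CARD('p) ^ j)) = f (of_nat a)"
      using j[OF of_nat_in_zball, of "of_nat (CARD('p) ^ j)" a] by simp
  qed
  also have "\<dots> / of_nat CARD('p) ^ j = zint f"
    using j by (rule zint_eq_sum[symmetric])
  finally show ?thesis .
qed

text \<open>A linear coefficient is carried along even for pure squares, because splitting the
  variable modulo p creates linear terms.\<close>

definition qint :: "'p padic \<Rightarrow> 'p padic \<Rightarrow> complex" where
  "qint \<beta> \<gamma> = zint (\<lambda>x. padic_char (\<beta> * x ^ 2 + \<gamma> * x))"

text \<open>The increment of the polynomial is (\<open>\<beta>\<close> y)(2x + y) +
  \<open>\<gamma>\<close> y, and a sufficiently small y absorbs the denominators of
  \<open>\<beta>\<close> and \<open>\<gamma>\<close>.\<close>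

lemma loc_const_quadratic: "loc_const (\<lambda>x. padic_char (\<beta> * x ^ 2 + \<gamma> * x))"
proof -
  obtain k l where "\<beta> \<in> zball (int k)" "\<gamma> \<in> zball (int l)"
    using exists_zball by metis
  then have bg: "\<beta> \<in> zball (int (k + l))" "\<gamma> \<in> zball (int (k + l))"
    by (auto elim: zball_mono)
  have "padic_char (\<beta> * (x + y) ^ 2 + \<gamma> * (x + y)) = padic_char (\<beta> * x ^ 2 + \<gamma> * x)"
    if "x \<in> zball 0" "y \<in> zball (- int (k + l))" for x y
  proof -
    have y: "y \<in> zball 0" using that(2) by (rule zball_mono) simp
    have "x + x + y \<in> zball 0" using that(1) y by (intro zball_add)
    moreover have "\<beta> * y \<in> zball 0" "\<gamma> * y \<in> zball 0"
      using zball_mult[OF bg(1) that(2)] zball_mult[OF bg(2) that(2)] by simp_all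
    ultimately have "(\<beta> * y) * (x + x + y) + \<gamma> * y \<in> zball 0"
      by (metis zball_add zball_mult_ints)
    also have "(\<beta> * y) * (x + x + y) + \<gamma> * y = (\<beta> * (x + y) ^ 2 + \<gamma> * (x + y)) - (\<beta> * x ^ 2 + \<gamma> * x)"
      by (simp add: power2_eq_square algebra_simps)
    finally show ?thesis by (rule padic_char_cong)
  qed
  then show ?thesis unfolding loc_const_def by blast
qed

text \<open>Substituting x = a + p z multiplies the quadratic coefficient by p^2 but the linear one
  only by p. This disparity drives the inductions of \<open>qint_eq_0\<close> and
  \<open>qint_square\<close>.\<close>

lemma qint_split:
  "qint \<beta> \<gamma> = (\<Sum>a<CARD('p). padic_char (\<beta> * of_nat a ^ 2 + \<gamma> * of_nat a)
     * qint (\<beta> * uniformizer ^ 2) ((2 * \<beta> * of_nat a + \<gamma>) * uniformizer)) / of_nat CARD('p)"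
proof -
  have "padic_char (\<beta> * (of_nat a + uniformizer * z) ^ 2 + \<gamma> * (of_nat a + uniformizer * z))
    = padic_char (\<beta> * of_nat a ^ 2 + \<gamma> * of_nat a)
      * padic_char (\<beta> * uniformizer ^ 2 * z ^ 2 + (2 * \<beta> * of_nat a + \<gamma>) * uniformizer * z)" for a z
    unfolding padic_char_add[symmetric] by (simp add: power2_eq_square algebra_simps)
  moreover have "qint \<beta> \<gamma> = (\<Sum>a<CARD('p). zint (\<lambda>z. padic_char (\<beta> * (of_nat a + uniformizer * z) ^ 2
      + \<gamma> * (of_nat a + uniformizer * z)))) / of_nat CARD('p)"
    unfolding qint_def by (rule zint_split[OF loc_const_quadratic])
  ultimately show ?thesis by (simp add: zint_mult_left qint_def)
qed

lemma qint_eq_1: "\<beta> \<in> zball 0 \<Longrightarrow> \<gamma> \<in> zball 0 \<Longrightarrow> qint \<beta> \<gamma> = 1"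
proof -
  assume bg: "\<beta> \<in> zball 0" "\<gamma> \<in> zball 0"
  have "zint (\<lambda>x. padic_char (\<beta> * x ^ 2 + \<gamma> * x)) = zint (\<lambda>_. 1)"
    using bg by (intro zint_cong padic_char_zball zball_add zball_mult_ints)
      (auto simp: power2_eq_square intro: zball_mult_ints)
  then show ?thesis by (simp add: qint_def)
qed

text \<open>The hypotheses say that \<open>\<gamma>\<close> has absolute value p^(k+1) and
  \<open>\<beta>\<close> at most p^k. Splitting reproduces this shape one level lower, since 2
  \<open>\<beta>\<close> a is too small to change the absolute value of the linear coefficient. At k
  = 0 there remains a full sum of a nontrivial additive character.\<close>

lemma qint_eq_0:
  assumes "\<gamma> \<in> zball (int (Suc k))" "\<gamma> \<notin> zball (int k)" "\<beta> \<in> zball (int k)"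
  shows "qint \<beta> \<gamma> = 0"
  using assms
proof (induction k arbitrary: \<beta> \<gamma>)
  case 0
  then obtain r where r: "uniformizer * \<gamma> - of_int r \<in> zball (- 1)"
    "\<And>a. padic_char (\<gamma> * of_int a) = gauss_char (- of_int r * of_int a :: 'p mod_ring)"
    using zball_1_residue[of \<gamma>] by auto
  have r0: "(of_int r :: 'p mod_ring) \<noteq> 0"
  proof
    assume "(of_int r :: 'p mod_ring) = 0"
    then have "uniformizer * \<gamma> - of_int r + of_int r \<in> zball (- 1)"
      using r(1) by (intro zball_add) (simp_all add: of_int_in_zball_minus_1_iff)
    then have "\<gamma> \<in> zball 0" using mult_uniformizer_in_zball_iff[of \<gamma> "- 1"] by (simp add: mult.commute)
    with 0 show False by simp
  qed
  have "padic_char (\<beta> * of_nat a ^ 2 + \<gamma> * of_nat a)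
      * qint (\<beta> * uniformizer ^ 2) ((2 * \<beta> * of_nat a + \<gamma>) * uniformizer)
    = gauss_char (- of_int r * of_nat a :: 'p mod_ring)" for a
  proof -
    have b: "\<beta> \<in> zball 0" using 0 by simp
    have "2 * \<beta> * of_nat a + \<gamma> \<in> zball 1"
      using 0 zball_mult_ints[OF b of_nat_in_zball[of "2 * a"]]
      by (intro zball_add) (auto simp: mult_ac intro: zball_mono)
    moreover have "\<beta> \<in> zball 2" using b by (rule zball_mono) simp
    ultimately have "qint (\<beta> * uniformizer ^ 2) ((2 * \<beta> * of_nat a + \<gamma>) * uniformizer) = 1"
      by (intro qint_eq_1) (simp_all add: mult_uniformizer_in_zball_iff mult_uniformizer_sq_in_zball_iff)
    moreover have "padic_char (\<beta> * of_nat a ^ 2) = 1"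
      using zball_mult_ints[OF b of_nat_in_zball[of "a ^ 2"]] by simp
    ultimately show ?thesis using r(2)[of "int a"] by (simp add: padic_char_add)
  qed
  then have "qint \<beta> \<gamma> = (\<Sum>x\<in>UNIV. gauss_char (- of_int r * x :: 'p mod_ring)) / of_nat CARD('p)"
    by (simp add: qint_split[of \<beta> \<gamma>] sum_mod_ring)
  then show ?case using sum_gauss_char[of "- of_int r :: 'p mod_ring"] r0 by simp
next
  case (Suc k)
  have "qint (\<beta> * uniformizer ^ 2) ((2 * \<beta> * of_nat a + \<gamma>) * uniformizer) = 0" for a
  proof (rule Suc.IH)
    have b: "2 * \<beta> * of_nat a \<in> zball (int (Suc k))"
      using zball_mult_ints[OF Suc.prems(3) of_nat_in_zball[of "2 * a"]] by (simp add: mult_ac)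
    then show "(2 * \<beta> * of_nat a + \<gamma>) * uniformizer \<in> zball (int (Suc k))"
      using Suc.prems(1) unfolding mult_uniformizer_in_zball_iff
      by (intro zball_add) (auto elim: zball_mono)
    show "(2 * \<beta> * of_nat a + \<gamma>) * uniformizer \<notin> zball (int k)"
      using Suc.prems(2) zball_add_cancel[OF b, of \<gamma>]
      by (simp add: mult_uniformizer_in_zball_iff add.commute)
    show "\<beta> * uniformizer ^ 2 \<in> zball (int k)"
      using Suc.prems(3) unfolding mult_uniformizer_sq_in_zball_iff by (rule zball_mono) simp
  qed
  then show ?case by (simp add: qint_split[of \<beta> \<gamma>])
qed

lemma qint_dominant_linear:
  assumes "\<gamma> \<noteq> 0" "\<beta> = 0 \<or> padic_val \<gamma> < padic_val \<beta>"
  shows "qint \<beta> \<gamma> = (if padic_val \<gamma> \<ge> 0 then 1 else 0)"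
proof (cases "padic_val \<gamma> \<ge> 0")
  case True
  then show ?thesis using assms by (auto intro!: qint_eq_1 simp: zball_iff_val)
next
  case False
  \<comment> \<open>Chosen so that \<open>\<gamma>\<close> has absolute value p^(k+1); the strict
    inequality of valuations then bounds that of \<open>\<beta>\<close> by p^k.\<close>
  define k where "k = nat (- padic_val \<gamma> - 1)"
  have "qint \<beta> \<gamma> = 0"
    using False assms by (intro qint_eq_0[of _ k]) (auto simp: zball_iff_val k_def)
  with False show ?thesis by simp
qed

lemma zint_char: "zint (\<lambda>z. padic_char (\<gamma> * z)) = (if \<gamma> \<in> zball 0 then 1 else 0)"
proof (cases "\<gamma> = 0")
  case False
  then show ?thesis using qint_dominant_linear[of \<gamma> 0] by (simp add: qint_def zball_iff_val)
qed simp

text \<open>As p is odd, c / (2b) lies in Z_p, so \<open>zint_shift\<close> applies to it.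
  Integrality of c / b is what membership in \<open>N_set\<close> supplies.\<close>

lemma qint_complete_square:
  assumes "CARD('p) \<ge> 3" "b \<noteq> 0" "c / b \<in> zball 0"
  shows "qint (\<sigma> * b) (\<sigma> * c) = padic_char (- \<sigma> * (c ^ 2 / (4 * b))) * qint (\<sigma> * b) 0"
proof -
  define h where "h = c / (2 * b)"
  have "\<not> CARD('p) dvd 2" using assms(1) by (auto dest!: dvd_imp_le)
  then have "padic_val (of_nat 2 :: 'p padic) = 0" by (rule padic_val_of_nat)
  then have "padic_norm (2 :: 'p padic) = 1" by (simp add: padic_norm_eq_val)
  then have h: "h \<in> zball 0"
    using assms(3) by (simp add: h_def zball_def padic_norm_divide padic_norm_mult)
  have "padic_char (\<sigma> * b * x ^ 2 + \<sigma> * c * x)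
      = padic_char (- \<sigma> * (c ^ 2 / (4 * b))) * padic_char (\<sigma> * b * (x + h) ^ 2 + 0 * (x + h))" for x
  proof -
    have "\<sigma> * b * x ^ 2 + \<sigma> * c * x = - \<sigma> * (c ^ 2 / (4 * b)) + (\<sigma> * b * (x + h) ^ 2 + 0 * (x + h))"
      using assms(2) by (simp add: h_def field_simps power2_eq_square)
    then show ?thesis by (simp only: padic_char_add)
  qed
  then show ?thesis
    unfolding qint_def using zint_shift[OF loc_const_quadratic h, of "\<sigma> * b" 0]
    by (simp add: zint_mult_left)
qed

lemma cnj_eps: "cnj (eps k) = eps k ^ 3"
  by (simp add: eps_def power3_eq_cube)

text \<open>Each splitting lowers k by two and costs a factor 1/p, so the parity of k decides
  whether the recursion ends at the trivial integral k = 0 or at the Gauss sum k = 1.\<close>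

lemma qint_square:
  assumes p: "CARD('p) \<ge> 3" and "\<beta> \<noteq> 0" "padic_val \<beta> = - int k"
  shows "qint \<beta> 0 = of_real (real CARD('p) powr (- real k / 2))
     * (if odd k then eps CARD('p) ^ 3 * of_int (padic_Legendre (padic_unit_part \<beta>)) else 1)"
  using assms(2,3)
proof (induction k arbitrary: \<beta> rule: less_induct)
  case (less k)
  have two: "padic_val (2 :: 'p padic) = 0"
  proof -
    have "\<not> CARD('p) dvd 2" using p by (auto dest!: dvd_imp_le)
    then show ?thesis using padic_val_of_nat[of 2, where 'p='p] by simp
  qed
  consider "k = 0" | "k = 1" | l where "k = Suc (Suc l)"
    by (metis One_nat_def not0_implies_Suc)
  then show ?case
  proof cases
    case 1
    then show ?thesis using less.prems by (simp add: qint_eq_1 zball_iff_val)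
  next
    case 2
    then have b: "\<beta> \<in> zball 1" using less.prems by (simp add: zball_iff_val)
    then obtain r where r: "uniformizer * \<beta> - of_int r \<in> zball (- 1)"
      "\<And>a. padic_char (\<beta> * of_int a) = gauss_char (- of_int r * of_int a :: 'p mod_ring)"
      using zball_1_residue by blast
    have L: "padic_Legendre (padic_unit_part \<beta>) = qchar (of_int r :: 'p mod_ring)"
      using padic_Legendre_eq[OF r(1)] less.prems 2 by (simp add: padic_unit_part_def mult.commute)
    have "qchar (of_int r :: 'p mod_ring) \<noteq> 0"
    proof
      assume "qchar (of_int r :: 'p mod_ring) = 0"
      then have "uniformizer * \<beta> - of_int r + of_int r \<in> zball (- 1)"
        using r(1) by (intro zball_add) (simp_all add: of_int_in_zball_minus_1_iff qchar_eq split: if_splits)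
      then have "\<beta> \<in> zball 0" using mult_uniformizer_in_zball_iff[of \<beta> "- 1"] by (simp add: mult.commute)
      with less.prems 2 show False by (simp add: zball_iff_val)
    qed
    then have r0: "(of_int r :: 'p mod_ring) \<noteq> 0" by auto
    \<comment> \<open>The inner integrals are 1, so a single sum over the residues remains; the sign
      of \<open>padic_char\<close> makes it a conjugate Gauss sum.\<close>
    have "padic_char (\<beta> * of_nat a ^ 2 + 0 * of_nat a)
        * qint (\<beta> * uniformizer ^ 2) ((2 * \<beta> * of_nat a + 0) * uniformizer)
      = cnj (gauss_char (of_int r * of_nat a ^ 2 :: 'p mod_ring))" for a
    proof -
      have "2 * \<beta> * of_nat a \<in> zball 1"
        using zball_mult_ints[OF b of_nat_in_zball[of "2 * a"]] by (simp add: mult_ac)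
      moreover have "\<beta> \<in> zball 2" using b by (rule zball_mono) simp
      ultimately have "qint (\<beta> * uniformizer ^ 2) ((2 * \<beta> * of_nat a + 0) * uniformizer) = 1"
        by (intro qint_eq_1) (simp_all add: mult_uniformizer_in_zball_iff mult_uniformizer_sq_in_zball_iff)
      then show ?thesis using r(2)[of "int a ^ 2"] by (simp add: cnj_gauss_char)
    qed
    then have "qint \<beta> 0 = cnj (\<Sum>x\<in>UNIV. gauss_char (of_int r * x ^ 2 :: 'p mod_ring)) / of_nat CARD('p)"
      by (simp add: qint_split[of \<beta> 0] sum_mod_ring)
    also have "\<dots> = eps CARD('p) ^ 3 * of_int (qchar (of_int r :: 'p mod_ring)) * of_real (sqrt (real CARD('p)) / real CARD('p))"
      by (simp add: sum_gauss_char_squares[OF p r0] gauss_sum_value[OF p] cnj_eps)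
    also have "sqrt (real CARD('p)) / real CARD('p) = real CARD('p) powr (- real k / 2)"
      by (simp add: 2 powr_minus powr_half_sqrt real_div_sqrt field_simps)
    finally show ?thesis using 2 by (simp add: L)
  next
    case 3
    txt \<open>The residue classes of units contribute nothing, since there the linear term dominates.\<close>
    have v2: "padic_val (uniformizer ^ 2 :: 'p padic) = 2"
      using padic_val_uniformizer_powi[of 2, where 'p='p] by simp
    have v: "padic_val (\<beta> * uniformizer ^ 2) = - int l"
      using less.prems 3 v2 by (simp add: padic_val_mult)
    have "padic_char (\<beta> * of_nat a ^ 2 + 0 * of_nat a)
        * qint (\<beta> * uniformizer ^ 2) ((2 * \<beta> * of_nat a + 0) * uniformizer)
      = (if a = 0 then qint (\<beta> * uniformizer ^ 2) 0 else 0)" if "a < CARD('p)" for a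
    proof (cases "a = 0")
      case False
      then have "\<not> CARD('p) dvd a" using that by (auto dest: dvd_imp_le)
      then have va: "padic_val (of_nat a :: 'p padic) = 0" by (rule padic_val_of_nat)
      have "padic_val (2 * \<beta> * of_nat a * uniformizer) = padic_val \<beta> + 1"
        using False less.prems padic_val_uniformizer_powi[of 1, where 'p='p]
        by (simp add: padic_val_mult two va)
      then have "qint (\<beta> * uniformizer ^ 2) ((2 * \<beta> * of_nat a + 0) * uniformizer) = 0"
        using less.prems False 3
        by (intro qint_eq_0[of _ l]) (simp_all add: zball_iff_val v)
      with False show ?thesis by simp
    qed simp
    then have "qint \<beta> 0 = (\<Sum>a<CARD('p). if a = 0 then qint (\<beta> * uniformizer ^ 2) 0 else 0) / of_nat CARD('p)"
      by (subst qint_split) simp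
    then have q: "qint \<beta> 0 = qint (\<beta> * uniformizer ^ 2) 0 / of_nat CARD('p)"
      by simp
    have u: "padic_unit_part (\<beta> * uniformizer ^ 2) = padic_unit_part \<beta>"
      using less.prems v2 by (simp add: padic_unit_part_mult) (simp add: padic_unit_part_def v2 power_int_minus)
    have "real CARD('p) powr (- real k / 2) = real CARD('p) powr (- real l / 2) / real CARD('p)"
    proof -
      have e: "- real k / 2 = - real l / 2 - 1" using 3 by simp
      show ?thesis unfolding e by (simp add: powr_diff)
    qed
    then show ?thesis
      using less.IH[of l "\<beta> * uniformizer ^ 2"] less.prems v 3 unfolding q u by simp
  qed
qed

end

section \<open>The integrand on the shells\<close>

lemma D_set_D:
  assumes "i \<in> D_set r b c"
  shows "c i \<noteq> 0" "b i = 0 \<or> padic_val (c i) < padic_val (b i)" "t_coef b c i = ereal (of_int (padic_val (c i)))"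
  using assms by (auto simp: D_set_def t_coef_def padic_ord_def split: if_splits)

lemma N_set_D:
  assumes "i \<in> N_set r b c"
  shows "b i = 0 \<Longrightarrow> c i = 0" "b i = 0 \<Longrightarrow> t_coef b c i = \<infinity>"
    "b i \<noteq> 0 \<Longrightarrow> c i / b i \<in> zball 0" "b i \<noteq> 0 \<Longrightarrow> t_coef b c i = ereal (of_int (padic_val (b i)))"
proof -
  show "b i = 0 \<Longrightarrow> c i = 0" "b i = 0 \<Longrightarrow> t_coef b c i = \<infinity>"
    using assms by (auto simp: N_set_def t_coef_def padic_ord_def split: if_splits)
  show "b i \<noteq> 0 \<Longrightarrow> t_coef b c i = ereal (of_int (padic_val (b i)))"
    using assms by (auto simp: N_set_def t_coef_def padic_ord_def min_def split: if_splits)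
  assume b: "b i \<noteq> 0"
  show "c i / b i \<in> zball 0"
  proof (cases "c i = 0")
    case False
    then have le: "padic_val (b i) \<le> padic_val (c i)"
      using assms b by (auto simp: N_set_def padic_ord_def)
    have "padic_val (c i / b i * b i) = padic_val (c i / b i) + padic_val (b i)"
      using b False by (intro padic_val_mult) simp_all
    with le b show ?thesis by (simp add: zball_iff_val)
  qed simp
qed

lemma D_set_Un_N_set: "{1..r} = D_set r b c \<union> N_set r b c" "D_set r b c \<inter> N_set r b c = {}"
  "finite (D_set r b c)" "finite (N_set r b c)"
  by (auto simp: D_set_def N_set_def)

lemma L_set_iff:
  assumes "i \<in> N_set r b c"
  shows "i \<in> L_set r b c t \<longleftrightarrow> b i \<noteq> 0 \<and> padic_val (b i) < t \<and> odd (padic_val (b i) - t)"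
proof (cases "b i = 0")
  case True
  then show ?thesis using N_set_D(2)[OF assms] by (simp add: L_set_def)
next
  case False
  have "(\<exists>k::int. odd k \<and> real_of_int (padic_val (b i)) - real_of_int t = real_of_int k) \<longleftrightarrow> odd (padic_val (b i) - t)"
    by (metis of_int_diff of_int_eq_iff)
  then show ?thesis using assms False N_set_D(4)[OF assms] by (simp add: L_set_def)
qed

context padic_haar
begin

text \<open>The character turns the sum over the coordinates into a product, and the indicator of
  the cube factors as well, so Fubini applies.\<close>

lemma Ip_integrand_eq_prod:
  "Ip_integrand \<mu> r n (quad_poly r b c) \<sigma>
    = padic_char (- \<sigma> * n) * (\<Prod>i=1..r. qint (\<sigma> * b i) (\<sigma> * c i))"
proof -
  interpret product_sigma_finite "\<lambda>_. \<mu>"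
    by standard (rule sigma_finite_measure.sigma_finite_countable[OF sigma_finite_haar])
  let ?q = "\<lambda>i x. padic_char (\<sigma> * b i * x ^ 2 + \<sigma> * c i * x)"
  let ?f = "\<lambda>i x. indicator padic_ints x *\<^sub>R ?q i x"
  have char_sum: "padic_char (\<Sum>i\<in>A. g i) = (\<Prod>i\<in>A. padic_char (g i))" for A and g :: "nat \<Rightarrow> 'p padic"
    by (induction A rule: infinite_finite_induct) (simp_all add: padic_char_add)
  have "indicator (\<Pi>\<^sub>E i\<in>{1..r}. padic_ints) x *\<^sub>R padic_char (\<sigma> * (quad_poly r b c x - n))
      = padic_char (- \<sigma> * n) * (\<Prod>i=1..r. ?f i (x i))" if "x \<in> space (\<Pi>\<^sub>M i\<in>{1..r}. \<mu>)" for x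
  proof -
    have ext: "x \<in> extensional {1..r}"
      using that by (simp add: space_PiM PiE_def)
    have "\<sigma> * (quad_poly r b c x - n) = - \<sigma> * n + (\<Sum>i=1..r. \<sigma> * b i * x i ^ 2 + \<sigma> * c i * x i)"
      by (simp add: quad_poly_def sum_distrib_left algebra_simps)
    then have e: "padic_char (\<sigma> * (quad_poly r b c x - n)) = padic_char (- \<sigma> * n) * (\<Prod>i=1..r. ?q i (x i))"
      by (simp only: padic_char_add[of "- \<sigma> * n"] char_sum)
    show ?thesis
    proof (cases "x \<in> (\<Pi>\<^sub>E i\<in>{1..r}. padic_ints)")
      case True
      then have "(\<Prod>i=1..r. ?f i (x i)) = (\<Prod>i=1..r. ?q i (x i))"
        by (intro prod.cong refl) (auto simp: PiE_def Pi_def)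
      with True e show ?thesis by simp
    next
      case False
      \<comment> \<open>Points of the product space are extensional, so a point outside the cube has
        a coordinate outside Z_p.\<close>
      then obtain i where "i \<in> {1..r}" "x i \<notin> padic_ints"
        using ext unfolding PiE_iff by blast
      then have "(\<Prod>i=1..r. ?f i (x i)) = 0" by (intro prod_zero bexI[of _ i]) auto
      with False show ?thesis by simp
    qed
  qed
  then have "Ip_integrand \<mu> r n (quad_poly r b c) \<sigma>
      = (LINT x|(\<Pi>\<^sub>M i\<in>{1..r}. \<mu>). padic_char (- \<sigma> * n) * (\<Prod>i=1..r. ?f i (x i)))"
    unfolding Ip_integrand_def set_lebesgue_integral_def
    by (intro Bochner_Integration.integral_cong refl) auto
  also have "\<dots> = padic_char (- \<sigma> * n) * (LINT x|(\<Pi>\<^sub>M i\<in>{1..r}. \<mu>). (\<Prod>i=1..r. ?f i (x i)))"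
    by simp
  also have "(LINT x|(\<Pi>\<^sub>M i\<in>{1..r}. \<mu>). (\<Prod>i=1..r. ?f i (x i))) = (\<Prod>i=1..r. LINT x|\<mu>. ?f i x)"
    by (intro product_integral_prod zint_integrable loc_const_quadratic) simp
  finally show ?thesis
    by (simp add: qint_def zint_def set_lebesgue_integral_def)
qed

lemma qint_cong: "\<beta> - \<beta>' \<in> zball 0 \<Longrightarrow> \<gamma> - \<gamma>' \<in> zball 0 \<Longrightarrow> qint \<beta> \<gamma> = qint \<beta>' \<gamma>'"
proof -
  assume a: "\<beta> - \<beta>' \<in> zball 0" "\<gamma> - \<gamma>' \<in> zball 0"
  show ?thesis
    unfolding qint_def
  proof (intro zint_cong padic_char_cong)
    fix x :: "'p padic" assume x: "x \<in> zball 0"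
    have "((\<beta> - \<beta>') * x) * x + (\<gamma> - \<gamma>') * x \<in> zball 0"
      by (intro zball_add zball_mult_ints a x)
    then show "\<beta> * x ^ 2 + \<gamma> * x - (\<beta>' * x ^ 2 + \<gamma>' * x) \<in> zball 0"
      by (simp add: algebra_simps power2_eq_square)
  qed
qed

text \<open>All coefficients are integral, so an integral change of \<open>\<sigma>\<close> alters
  every phase by an element of Z_p. This uniform period makes the integral over each ball a finite
  sum.\<close>

lemma Ip_integrand_periodic:
  assumes "n \<in> zball 0" "\<And>i. i \<in> {1..r} \<Longrightarrow> b i \<in> zball 0 \<and> c i \<in> zball 0" "h \<in> zball 0"
  shows "Ip_integrand \<mu> r n (quad_poly r b c) (\<sigma> + h) = Ip_integrand \<mu> r n (quad_poly r b c) \<sigma>"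
proof -
  have "padic_char (- (\<sigma> + h) * n) = padic_char (- \<sigma> * n)"
    using zball_mult_ints[OF assms(3,1)] by (intro padic_char_cong) (simp add: algebra_simps)
  moreover have "qint ((\<sigma> + h) * b i) ((\<sigma> + h) * c i) = qint (\<sigma> * b i) (\<sigma> * c i)" if "i \<in> {1..r}" for i
    using zball_mult_ints[OF assms(3), of "b i"] zball_mult_ints[OF assms(3), of "c i"] assms(2)[OF that]
    by (intro qint_cong) (simp_all add: algebra_simps)
  ultimately show ?thesis by (simp add: Ip_integrand_eq_prod)
qed

lemma Ip_integrand_zball:
  assumes "n \<in> zball 0" "\<And>i. i \<in> {1..r} \<Longrightarrow> b i \<in> zball 0 \<and> c i \<in> zball 0" "\<sigma> \<in> zball 0"
  shows "Ip_integrand \<mu> r n (quad_poly r b c) \<sigma> = 1"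
proof -
  have "Ip_integrand \<mu> r n (quad_poly r b c) (0 + \<sigma>) = 1"
    by (subst Ip_integrand_periodic[OF assms]) (simp_all add: Ip_integrand_eq_prod qint_eq_1)
  then show ?thesis by simp
qed

text \<open>The part of the integrand that depends on \<open>\<sigma>\<close> only through its
  absolute value p^t. The exponent is tau - t, because the summand t of \<open>tau\<close> comes
  from the volume of the shell.\<close>

definition shell_coef :: "nat \<Rightarrow> (nat \<Rightarrow> 'p padic) \<Rightarrow> (nat \<Rightarrow> 'p padic) \<Rightarrow> int \<Rightarrow> complex" where
  "shell_coef r b c t = (if ereal (of_int t) \<le> t_d r b c
     then delta r b c t * of_real (real CARD('p) powr (tau r b c t - of_int t)) else 0)"

text \<open>The indices in \<open>D_set\<close> give indicators whose product is the condition t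
  \<le> t_d. Each index in \<open>N_set\<close> gives a phase from completing the square and a value
  of \<open>qint_square\<close>; the symbol of w enters once per index with odd exponent, hence the
  power \<open>ell\<close>.\<close>

lemma Ip_integrand_shell:
  fixes t :: int
  assumes p: "CARD('p) \<ge> 3" and w: "padic_norm w = 1"
    and \<sigma>_def: "\<sigma> = uniformizer powi (- t) * w"
  shows "Ip_integrand \<mu> r n (quad_poly r b c) \<sigma>
    = shell_coef r b c t * of_int (padic_Legendre w) ^ ell r b c t * padic_char (- \<sigma> * shifted_n r b c n)"
proof -
  let ?D = "D_set r b c" and ?N = "N_set r b c" and ?L = "L_set r b c t"
  have w0: "w \<noteq> 0" using w by auto
  have vw: "padic_val w = 0" using w by (intro padic_val_eqI) simp
  have \<sigma>0: "\<sigma> \<noteq> 0" using w0 by (simp add: \<sigma>_def)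
  have v\<sigma>: "padic_val \<sigma> = - t" using w0 vw by (simp add: \<sigma>_def padic_val_mult)
  have u\<sigma>: "padic_unit_part \<sigma> = w"
    unfolding padic_unit_part_def v\<sigma> by (simp add: \<sigma>_def power_int_minus)
  have D: "(\<Prod>i\<in>?D. qint (\<sigma> * b i) (\<sigma> * c i)) = (if ereal (of_int t) \<le> t_d r b c then 1 else 0)"
  proof -
    have q: "qint (\<sigma> * b i) (\<sigma> * c i) = (if ereal (of_int t) \<le> t_coef b c i then 1 else 0)" if "i \<in> ?D" for i
      using D_set_D[OF that] \<sigma>0 v\<sigma> by (cases "b i = 0"; subst qint_dominant_linear) (auto simp: padic_val_mult)
    show ?thesis
    proof (cases "ereal (of_int t) \<le> t_d r b c")
      case True
      then have "ereal (of_int t) \<le> t_coef b c i" if "i \<in> ?D" for i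
        using that unfolding t_d_def le_INF_iff by blast
      with True q show ?thesis by simp
    next
      case False
      then obtain i where "i \<in> ?D" "\<not> ereal (of_int t) \<le> t_coef b c i"
        unfolding t_d_def le_INF_iff by blast
      then have "(\<Prod>i\<in>?D. qint (\<sigma> * b i) (\<sigma> * c i)) = 0"
        by (intro prod_zero bexI[of _ i]) (simp_all add: q D_set_Un_N_set)
      with False show ?thesis by simp
    qed
  qed
  have N: "qint (\<sigma> * b i) (\<sigma> * c i) = padic_char (- \<sigma> * (c i ^ 2 / (4 * b i)))
      * of_real (if t_coef b c i < ereal (of_int t) then real CARD('p) powr ((real_of_ereal (t_coef b c i) - of_int t) / 2) else 1)
      * (if i \<in> ?L then eps CARD('p) ^ 3 * of_int (padic_Legendre (padic_unit_part (b i))) * of_int (padic_Legendre w) else 1)"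
    if i: "i \<in> ?N" for i
  proof (cases "b i = 0")
    case True
    \<comment> \<open>Now \<open>c i = 0\<close> too, the integral is 1, and the infinite
      \<open>t_coef\<close> selects the value 1 in both conditionals.\<close>
    then show ?thesis using N_set_D[OF i] L_set_iff[OF i] by (simp add: qint_eq_1)
  next
    case False
    note tc = N_set_D(4)[OF i False]
    have vb: "padic_val (\<sigma> * b i) = padic_val (b i) - t"
      using \<sigma>0 False v\<sigma> by (simp add: padic_val_mult)
    have cs: "qint (\<sigma> * b i) (\<sigma> * c i) = padic_char (- \<sigma> * (c i ^ 2 / (4 * b i))) * qint (\<sigma> * b i) 0"
      by (rule qint_complete_square[OF p False N_set_D(3)[OF i False]])
    show ?thesis
    proof (cases "padic_val (b i) < t")
      case True
      define k where "k = nat (t - padic_val (b i))"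
      have k: "int k = t - padic_val (b i)" using True by (simp add: k_def)
      then have rk: "real k = of_int t - of_int (padic_val (b i))" by (metis of_int_diff of_int_of_nat_eq)
      have "odd k \<longleftrightarrow> odd (int k)" by simp
      also have "\<dots> \<longleftrightarrow> i \<in> ?L" unfolding L_set_iff[OF i] k using True False by auto
      finally have odd: "odd k \<longleftrightarrow> i \<in> ?L" .
      have "padic_Legendre (padic_unit_part (\<sigma> * b i)) = padic_Legendre w * padic_Legendre (padic_unit_part (b i))"
        unfolding padic_unit_part_mult[OF \<sigma>0 False] u\<sigma>
        using p w padic_unit_part_norm[OF False] by (intro padic_Legendre_mult) (simp_all add: zball_def)
      moreover have "qint (\<sigma> * b i) 0 = of_real (real CARD('p) powr (- real k / 2))
          * (if odd k then eps CARD('p) ^ 3 * of_int (padic_Legendre (padic_unit_part (\<sigma> * b i))) else 1)"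
        using \<sigma>0 False vb k by (intro qint_square[OF p]) simp_all
      ultimately show ?thesis
        unfolding cs odd by (simp add: tc True rk)
    next
      case ge: False
      then have "qint (\<sigma> * b i) 0 = 1" using vb by (intro qint_eq_1) (simp_all add: zball_iff_val)
      then show ?thesis unfolding cs using ge by (simp add: tc L_set_iff[OF i])
    qed
  qed
  have L: "?L \<subseteq> ?N" by (auto simp: L_set_def)
  have char_sum: "(\<Prod>i\<in>A. padic_char (g i)) = padic_char (\<Sum>i\<in>A. g i)" for A and g :: "nat \<Rightarrow> 'p padic"
    by (induction A rule: infinite_finite_induct) (simp_all add: padic_char_add)
  have N1: "(\<Prod>i\<in>?N. padic_char (- \<sigma> * (c i ^ 2 / (4 * b i)))) = padic_char (- \<sigma> * (\<Sum>i\<in>?N. c i ^ 2 / (4 * b i)))"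
    unfolding char_sum sum_distrib_left ..
  have N2: "(\<Prod>i\<in>?N. if t_coef b c i < ereal (of_int t) then real CARD('p) powr ((real_of_ereal (t_coef b c i) - of_int t) / 2) else 1)
      = real CARD('p) powr (tau r b c t - of_int t)"
    by (subst prod.inter_filter[symmetric]) (simp_all add: tau_def powr_sum D_set_Un_N_set)
  have N3: "(\<Prod>i\<in>?N. if i \<in> ?L then eps CARD('p) ^ 3 * of_int (padic_Legendre (padic_unit_part (b i))) * of_int (padic_Legendre w) else 1)
      = delta r b c t * of_int (padic_Legendre w) ^ ell r b c t"
  proof -
    have "?L = {i \<in> ?N. i \<in> ?L}" using L by auto
    then have "(\<Prod>i\<in>?N. if i \<in> ?L then eps CARD('p) ^ 3 * of_int (padic_Legendre (padic_unit_part (b i))) * of_int (padic_Legendre w) else 1)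
        = (\<Prod>i\<in>?L. eps CARD('p) ^ 3 * of_int (padic_Legendre (padic_unit_part (b i))) * of_int (padic_Legendre w) :: complex)"
      by (subst prod.inter_filter[symmetric]) (simp_all add: D_set_Un_N_set)
    then show ?thesis by (simp add: prod.distrib delta_def ell_def power_mult)
  qed
  have "(\<Prod>i\<in>?N. qint (\<sigma> * b i) (\<sigma> * c i)) = (\<Prod>i\<in>?N. padic_char (- \<sigma> * (c i ^ 2 / (4 * b i)))
      * of_real (if t_coef b c i < ereal (of_int t) then real CARD('p) powr ((real_of_ereal (t_coef b c i) - of_int t) / 2) else 1)
      * (if i \<in> ?L then eps CARD('p) ^ 3 * of_int (padic_Legendre (padic_unit_part (b i))) * of_int (padic_Legendre w) else 1))"
    by (intro prod.cong refl N)
  also have "\<dots> = padic_char (- \<sigma> * (\<Sum>i\<in>?N. c i ^ 2 / (4 * b i))) * of_real (real CARD('p) powr (tau r b c t - of_int t))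
      * (delta r b c t * of_int (padic_Legendre w) ^ ell r b c t)"
    unfolding prod.distrib N1 N3 N2[symmetric] of_real_prod ..
  finally have Nprod: "(\<Prod>i\<in>?N. qint (\<sigma> * b i) (\<sigma> * c i)) = \<dots>" .
  have "(\<Prod>i=1..r. qint (\<sigma> * b i) (\<sigma> * c i))
      = (\<Prod>i\<in>?D. qint (\<sigma> * b i) (\<sigma> * c i)) * (\<Prod>i\<in>?N. qint (\<sigma> * b i) (\<sigma> * c i))"
    unfolding D_set_Un_N_set(1)[of r b c] by (intro prod.union_disjoint D_set_Un_N_set)
  moreover have "padic_char (- \<sigma> * shifted_n r b c n)
      = padic_char (- \<sigma> * n) * padic_char (- \<sigma> * (\<Sum>i\<in>?N. c i ^ 2 / (4 * b i)))"
    unfolding padic_char_add[symmetric] shifted_n_def distrib_left ..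
  ultimately show ?thesis
    by (simp add: Ip_integrand_eq_prod D Nprod shell_coef_def)
qed

end

section \<open>Twisted character sums over the nonzero residues\<close>

lemma sum_mod_ring_nonzero:
  "(\<Sum>a\<in>{1..<CARD('p)}. h (of_nat a :: 'p::prime_card mod_ring)) = (\<Sum>x\<in>UNIV. h x) - (h 0 :: complex)"
proof -
  have "(\<Sum>x\<in>UNIV. h (x :: 'p mod_ring)) = (\<Sum>a\<in>{0..<CARD('p)}. h (of_nat a))"
    by (simp add: sum_mod_ring lessThan_atLeast0)
  also have "\<dots> = h 0 + (\<Sum>a\<in>{1..<CARD('p)}. h (of_nat a))"
    by (subst sum.atLeast_Suc_lessThan) simp_all
  finally show ?thesis by simp
qed

lemma of_nat_mod_ring_neq_0: "a \<in> {1..<CARD('p)} \<Longrightarrow> (of_nat a :: 'p::prime_card mod_ring) \<noteq> 0"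
  using of_nat_0_mod_ring_dvd[of a, where 'a='p] by (auto dest!: dvd_imp_le)

lemma qchar_power:
  "x \<noteq> 0 \<Longrightarrow> qchar x ^ l = (if even l then 1 else qchar x)"
  by (auto simp: qchar_eq)

lemma char_sum_trivial:
  assumes p: "CARD('p::prime_card) \<ge> 3" and "(\<gamma> :: 'p padic) \<in> zball 0"
  shows "(\<Sum>a\<in>{1..<CARD('p)}. of_int (qchar (of_nat a :: 'p mod_ring)) ^ l * padic_char (\<gamma> * of_nat a))
    = (if even l then of_nat CARD('p) - 1 else 0)"
proof -
  have "of_int (qchar (of_nat a :: 'p mod_ring)) ^ l * padic_char (\<gamma> * of_nat a)
      = (if even l then 1 else of_int (qchar (of_nat a :: 'p mod_ring)))" if "a \<in> {1..<CARD('p)}" for a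
    using qchar_power[OF of_nat_mod_ring_neq_0[OF that], of l] zball_mult_ints[OF assms(2) of_nat_in_zball, of a]
    by (simp flip: of_int_power)
  then have "(\<Sum>a\<in>{1..<CARD('p)}. of_int (qchar (of_nat a :: 'p mod_ring)) ^ l * padic_char (\<gamma> * of_nat a))
      = (\<Sum>a\<in>{1..<CARD('p)}. if even l then 1 else of_int (qchar (of_nat a :: 'p mod_ring)))"
    by (rule sum.cong[OF refl])
  also have "\<dots> = (if even l then of_nat CARD('p) - 1 else 0)"
    using sum_mod_ring_nonzero[of "\<lambda>x. of_int (qchar (x :: 'p mod_ring))"] sum_qchar[OF p]
    by (simp add: of_nat_diff)
  finally show ?thesis .
qed

text \<open>The minus sign of the argument cancels that of \<open>padic_char\<close>, so the Gauss
  sum appears unconjugated. For even l the sum over all residues vanishes, and removing a = 0 leaves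
  -1.\<close>

lemma char_sum_primitive:
  assumes p: "CARD('p::prime_card) \<ge> 3" and "(\<gamma> :: 'p padic) \<in> zball 1" "\<gamma> \<notin> zball 0"
  shows "(\<Sum>a\<in>{1..<CARD('p)}. of_int (qchar (of_nat a :: 'p mod_ring)) ^ l * padic_char (- \<gamma> * of_nat a))
    = (if even l then - 1 else eps CARD('p) * of_int (padic_Legendre (uniformizer * \<gamma>)) * of_real (sqrt (real CARD('p))))"
proof -
  have "- \<gamma> \<in> zball 1" using assms by simp
  then obtain r where r: "uniformizer * (- \<gamma>) - of_int r \<in> zball (- 1)"
    "\<And>a. padic_char (- \<gamma> * of_int a) = gauss_char (- of_int r * of_int a :: 'p mod_ring)"
    using zball_1_residue by blast
  define s where "s = (of_int (- r) :: 'p mod_ring)"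
  have "uniformizer * (- \<gamma>) - of_int r = - (uniformizer * \<gamma> - of_int (- r))" by simp
  with r(1) have s: "uniformizer * \<gamma> - of_int (- r) \<in> zball (- 1)" by (simp only: zball_minus_iff)
  have s0: "s \<noteq> 0"
  proof
    assume "s = 0"
    then have "uniformizer * \<gamma> - of_int (- r) + of_int (- r) \<in> zball (- 1)"
      using s by (intro zball_add) (simp_all only: of_int_in_zball_minus_1_iff s_def)
    then show False using assms(3) zball_powi_mult_iff[of 1 \<gamma> "- 1"] by simp
  qed
  have "of_int (qchar (of_nat a :: 'p mod_ring)) ^ l * padic_char (- \<gamma> * of_nat a)
      = (if even l then gauss_char (s * of_nat a) else of_int (qchar (of_nat a :: 'p mod_ring)) * gauss_char (s * of_nat a))"
    if "a \<in> {1..<CARD('p)}" for a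
    using qchar_power[OF of_nat_mod_ring_neq_0[OF that], of l] r(2)[of "int a"]
    by (simp add: s_def flip: of_int_power)
  then have "(\<Sum>a\<in>{1..<CARD('p)}. of_int (qchar (of_nat a :: 'p mod_ring)) ^ l * padic_char (- \<gamma> * of_nat a))
      = (\<Sum>a\<in>{1..<CARD('p)}. if even l then gauss_char (s * of_nat a) else of_int (qchar (of_nat a :: 'p mod_ring)) * gauss_char (s * of_nat a))"
    by (rule sum.cong[OF refl])
  also have "\<dots> = (if even l then - 1 else of_int (qchar s) * gauss_sum TYPE('p))"
    using sum_mod_ring_nonzero[of "\<lambda>x. gauss_char (s * x)"]
      sum_mod_ring_nonzero[of "\<lambda>x. of_int (qchar x) * gauss_char (s * x)"]
      sum_gauss_char[OF s0] sum_qchar_gauss_char[OF p s0] by simp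
  finally show ?thesis
    by (simp add: gauss_sum_value[OF p] padic_Legendre_eq[OF s] s_def)
qed

section \<open>Summation over the shells\<close>

context padic_haar
begin

text \<open>The larger ball is scaled to Z_p and split by the lowest digit a: a = 0 gives back the
  smaller ball, the nonzero digits make up the shell. The factor p^T is the scaling factor p^(T+1)
  times the 1/p of the splitting.\<close>

lemma integral_padic_ball_Suc:
  assumes "\<And>x h. h \<in> zball 0 \<Longrightarrow> F (x + h) = F x"
  shows "(LINT \<sigma>:padic_ball (Suc T)|\<mu>. F \<sigma>) = (LINT \<sigma>:padic_ball T|\<mu>. F \<sigma>)
    + of_nat CARD('p) ^ T * (\<Sum>a\<in>{1..<CARD('p)}. zint (\<lambda>z. F (uniformizer powi (- int (Suc T)) * (of_nat a + uniformizer * z))))"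
proof -
  let ?G = "\<lambda>s. F (uniformizer powi (- int (Suc T)) * s)"
  have A: "(LINT \<sigma>:padic_ball T|\<mu>. F \<sigma>) = of_nat CARD('p) ^ T * zint (\<lambda>s. F (uniformizer powi (- int T) * s))" for T
    unfolding padic_ball_eq_zball
    by (subst integral_zball_scale[of "int T" T]) (use assms in simp_all)
  have "?G (x + y) = ?G x" if "y \<in> zball (- int (Suc T))" for x y
  proof -
    have "uniformizer powi (- int (Suc T)) * y \<in> zball 0" using that by (simp only: zball_powi_mult_iff) simp
    then show ?thesis unfolding distrib_left by (rule assms)
  qed
  then have "loc_const ?G" unfolding loc_const_def by blast
  then have "zint ?G = (\<Sum>a<CARD('p). zint (\<lambda>z. ?G (of_nat a + uniformizer * z))) / of_nat CARD('p)"
    by (rule zint_split)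
  also have "(\<Sum>a<CARD('p). zint (\<lambda>z. ?G (of_nat a + uniformizer * z)))
      = zint (\<lambda>z. ?G (uniformizer * z)) + (\<Sum>a\<in>{1..<CARD('p)}. zint (\<lambda>z. ?G (of_nat a + uniformizer * z)))"
    unfolding lessThan_atLeast0 by (subst sum.atLeast_Suc_lessThan) simp_all
  finally have "of_nat CARD('p) * zint ?G = zint (\<lambda>z. ?G (uniformizer * z))
      + (\<Sum>a\<in>{1..<CARD('p)}. zint (\<lambda>z. ?G (of_nat a + uniformizer * z)))"
    by simp
  moreover have "uniformizer powi (- int (Suc T)) * (uniformizer * z) = uniformizer powi (- int T) * z" for z :: "'p padic"
    by (simp add: power_int_minus power_int_diff field_simps)
  ultimately show ?thesis unfolding A power_Suc2 mult.assoc by (simp only: distrib_left)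
qed

text \<open>The Legendre symbol of a + p z sees only a, and the dependence on z is a linear
  character with coefficient -p^(1-t) \<open>\<nn>\<close>. Its integral is an indicator, which
  eliminates all shells beyond t_n + 1.\<close>

lemma zint_Ip_integrand_shell:
  fixes t :: int
  assumes p: "CARD('p) \<ge> 3" and a: "a \<in> {1..<CARD('p)}"
    and \<nn>_def: "\<nn> = shifted_n r b c n"
  shows "zint (\<lambda>z. Ip_integrand \<mu> r n (quad_poly r b c) (uniformizer powi (- t) * (of_nat a + uniformizer * z)))
    = shell_coef r b c t * (if \<nn> \<in> zball (1 - t) then 1 else 0)
      * (of_int (qchar (of_nat a :: 'p mod_ring)) ^ ell r b c t * padic_char (- (uniformizer powi (- t) * \<nn>) * of_nat a))"
proof -
  let ?P = "uniformizer powi (- t) :: 'p padic"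
  have na: "\<not> CARD('p) dvd a" using a by (auto dest!: dvd_imp_le)
  have "Ip_integrand \<mu> r n (quad_poly r b c) (?P * (of_nat a + uniformizer * z))
      = (shell_coef r b c t * (of_int (qchar (of_nat a :: 'p mod_ring)) ^ ell r b c t * padic_char (- (?P * \<nn>) * of_nat a)))
        * padic_char ((- (?P * uniformizer * \<nn>)) * z)" if z: "z \<in> zball 0" for z
  proof -
    let ?w = "of_nat a + uniformizer * z"
    have Uz: "uniformizer * z \<in> zball (- 1)" using z zball_powi_mult_iff[of 1 z "- 1"] by simp
    have "of_nat a \<notin> (zball (- 1) :: 'p padic set)"
      using of_int_in_zball_iff[of "int a" 1, where 'p='p] na by simp
    then have "?w \<notin> zball (- 1)" using zball_add_cancel[OF Uz] by blast
    moreover have "?w \<in> zball 0" using Uz by (intro zball_add) (auto elim: zball_mono)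
    ultimately have w: "padic_norm ?w = 1"
      using padic_norm_less_1_iff[of ?w] by (simp add: zball_def[of 0])
    have "padic_Legendre ?w = qchar (of_int (int a) :: 'p mod_ring)"
      using Uz by (intro padic_Legendre_eq) simp
    moreover have "- (?P * ?w) * \<nn> = - (?P * \<nn>) * of_nat a + (- (?P * uniformizer * \<nn>)) * z"
      by (simp add: algebra_simps)
    ultimately show ?thesis
      by (simp only: Ip_integrand_shell[OF p w refl] \<nn>_def[symmetric] padic_char_add of_int_of_nat_eq) (simp only: mult_ac)
  qed
  then have z1: "zint (\<lambda>z. Ip_integrand \<mu> r n (quad_poly r b c) (?P * (of_nat a + uniformizer * z)))
      = (shell_coef r b c t * (of_int (qchar (of_nat a :: 'p mod_ring)) ^ ell r b c t * padic_char (- (?P * \<nn>) * of_nat a)))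
        * zint (\<lambda>z. padic_char ((- (?P * uniformizer * \<nn>)) * z))"
    unfolding zint_mult_left[symmetric] by (rule zint_cong)
  have z2: "- (?P * uniformizer * \<nn>) \<in> zball 0 \<longleftrightarrow> \<nn> \<in> zball (1 - t)"
    using zball_powi_mult_iff[of "1 - t" \<nn> 0] by (simp add: power_int_diff power_int_minus field_simps)
  show ?thesis unfolding z1 zint_char z2 by (simp only: mult_ac)
qed

end

text \<open>\<open>t_d\<close> is an integer or infinite. This reconciles the strict condition t_n <
  t_d in \<open>omega\<close> with the condition t \<le> t_d on the shell t = t_n + 1.\<close>

lemma less_t_d_iff: "ereal (of_int v) < t_d r b c \<longleftrightarrow> ereal (of_int (v + 1)) \<le> t_d r b c"
proof
  assume lt: "ereal (of_int v) < t_d r b c"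
  show "ereal (of_int (v + 1)) \<le> t_d r b c"
    unfolding t_d_def
  proof (rule INF_greatest)
    fix i assume i: "i \<in> D_set r b c"
    then have "t_d r b c \<le> t_coef b c i" unfolding t_d_def by (rule INF_lower)
    with lt have "ereal (of_int v) < t_coef b c i" by (rule less_le_trans)
    then show "ereal (of_int (v + 1)) \<le> t_coef b c i" by (simp add: D_set_D(3)[OF i])
  qed
next
  have "ereal (of_int v) < ereal (of_int (v + 1))" by simp
  also assume "\<dots> \<le> t_d r b c"
  finally show "ereal (of_int v) < t_d r b c" .
qed

context padic_haar
begin

lemma shell_contribution:
  assumes p: "CARD('p) \<ge> 3" and t_def: "t = int (Suc T)" and \<nn>_def: "\<nn> = shifted_n r b c n"
  shows "of_nat CARD('p) ^ T * (\<Sum>a\<in>{1..<CARD('p)}. zint (\<lambda>z. Ip_integrand \<mu> r n (quad_poly r b c)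
      (uniformizer powi (- t) * (of_nat a + uniformizer * z))))
    = (1 - 1 / of_nat CARD('p)) * sum_term r b c n (Suc T)
      + (if \<nn> \<noteq> 0 \<and> padic_val \<nn> + 1 = t
         then delta r b c (padic_val \<nn> + 1) * omega r b c n * of_real (real CARD('p) powr tau r b c (padic_val \<nn> + 1)) else 0)"
proof -
  let ?P = "uniformizer powi (- t) :: 'p padic"
  let ?p = "real CARD('p)"
  have p0: "?p > 0" by simp
  define C where "C = shell_coef r b c t"
  define X where "X = (\<Sum>a\<in>{1..<CARD('p)}. of_int (qchar (of_nat a :: 'p mod_ring)) ^ ell r b c t
    * padic_char (- (?P * \<nn>) * of_nat a))"
  have lhs: "(\<Sum>a\<in>{1..<CARD('p)}. zint (\<lambda>z. Ip_integrand \<mu> r n (quad_poly r b c)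
      (?P * (of_nat a + uniformizer * z)))) = C * (if \<nn> \<in> zball (1 - t) then 1 else 0) * X"
    unfolding C_def X_def sum_distrib_left by (intro sum.cong refl zint_Ip_integrand_shell p \<nn>_def)
  have tn: "t_n r b c n = (if \<nn> = 0 then \<infinity> else ereal (of_int (padic_val \<nn>)))"
    by (simp add: t_n_def padic_ord_def \<nn>_def)
  \<comment> \<open>Since t = T + 1, a factor 1/p is left over. It turns the values p - 1, -1 and
    sqrt p of the character sums into 1 - 1/p, -1/p and 1/sqrt p.\<close>
  have pC: "of_nat CARD('p) ^ T * C = (if ereal (of_int t) \<le> t_d r b c
      then delta r b c t * of_real (?p powr tau r b c t) / of_nat CARD('p) else 0)"
  proof -
    have "of_nat CARD('p) ^ T * of_real (?p powr (tau r b c t - of_int t)) = (of_real (?p ^ T * ?p powr (tau r b c t - of_int t)) :: complex)"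
      by simp
    also have "?p ^ T * ?p powr (tau r b c t - of_int t) = ?p powr tau r b c t / ?p"
      using p0 by (simp add: t_def powr_diff powr_realpow[symmetric] powr_add)
    finally show ?thesis by (simp add: C_def shell_coef_def mult_ac)
  qed
  have gam: "?P * \<nn> \<in> zball m \<longleftrightarrow> \<nn> \<in> zball (m - t)" for m
    using zball_powi_mult_iff[of "- t" \<nn> m] by simp
  consider "\<nn> \<in> zball (- t)" | "\<nn> \<notin> zball (- t)" "\<nn> \<in> zball (1 - t)" | "\<nn> \<notin> zball (1 - t)"
    by blast
  then show ?thesis
  proof cases
    case 1
    then have v: "\<nn> = 0 \<or> t \<le> padic_val \<nn>" by (simp add: zball_iff_val)
    have "\<nn> \<in> zball (1 - t)" using 1 by (rule zball_mono) simp
    moreover have "X = (if even (ell r b c t) then of_nat CARD('p) - 1 else 0)"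
      unfolding X_def using 1 by (intro char_sum_trivial p) (simp add: gam)
    moreover have "sum_term r b c n (Suc T) = (if ereal (of_int t) \<le> t_d r b c \<and> even (ell r b c t)
        then delta r b c t * of_real (?p powr tau r b c t) else 0)"
      using v by (auto simp: sum_term_def tn t_def)
    ultimately show ?thesis
      using v unfolding lhs mult.assoc[symmetric] pC by (auto simp: field_simps)
  next
    case 2
    then have v: "\<nn> \<noteq> 0" "padic_val \<nn> + 1 = t" by (auto simp: zball_iff_val)
    have X: "X = (if even (ell r b c t) then - 1
        else eps CARD('p) * of_int (padic_Legendre (uniformizer * (?P * \<nn>))) * of_real (sqrt ?p))"
      unfolding X_def using 2 by (intro char_sum_primitive p) (simp_all add: gam)
    have u: "uniformizer * (?P * \<nn>) = padic_unit_part \<nn>"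
    proof -
      have e: "- padic_val \<nn> = - t + 1" using v by simp
      have "uniformizer powi (- t + 1) = ?P * uniformizer" by (subst power_int_add) simp_all
      then show ?thesis unfolding padic_unit_part_def e by (simp only: mult_ac)
    qed
    have st: "sum_term r b c n (Suc T) = 0"
      using v by (auto simp: sum_term_def tn t_def)
    have om: "omega r b c n = (if ereal (of_int t) \<le> t_d r b c then
        if even (ell r b c t) then - 1 / of_nat CARD('p)
        else eps CARD('p) * of_int (padic_Legendre (padic_unit_part \<nn>)) * (1 / of_real (sqrt ?p)) else 0)"
      using less_t_d_iff[of "padic_val \<nn>" r b c] v by (auto simp: omega_def tn \<nn>_def[symmetric] not_le)
    have sq: "of_real (sqrt ?p) / of_nat CARD('p) = (1 / of_real (sqrt ?p) :: complex)"
    proof -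
      have "sqrt ?p / ?p = 1 / sqrt ?p" using p0 by (simp add: real_div_sqrt field_simps)
      then show ?thesis by (metis of_real_1 of_real_divide of_real_of_nat_eq)
    qed
    show ?thesis
      using v 2 unfolding lhs mult.assoc[symmetric] pC st om X[unfolded u] sq[symmetric] by (simp add: field_simps)
  next
    case 3
    then have v: "\<nn> \<noteq> 0" "padic_val \<nn> + 1 < t" by (auto simp: zball_iff_val)
    then have "sum_term r b c n (Suc T) = 0"
      by (auto simp: sum_term_def tn t_def)
    with v 3 show ?thesis unfolding lhs by simp
  qed
qed

text \<open>The formula is exact for every ball; its last term switches on once the ball contains
  the shell t_n + 1.\<close>

lemma integral_padic_ball:
  assumes p: "CARD('p) \<ge> 3" and n: "n \<in> zball 0" and bc: "\<And>i. i \<in> {1..r} \<Longrightarrow> b i \<in> zball 0 \<and> c i \<in> zball 0"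
    and \<nn>_def: "\<nn> = shifted_n r b c n"
  shows "(LINT \<sigma>:padic_ball T|\<mu>. Ip_integrand \<mu> r n (quad_poly r b c) \<sigma>)
    = 1 + (1 - 1 / of_nat CARD('p)) * (\<Sum>t<Suc T. sum_term r b c n t)
      + (if \<nn> \<noteq> 0 \<and> padic_val \<nn> + 1 \<le> int T
         then delta r b c (padic_val \<nn> + 1) * omega r b c n * of_real (real CARD('p) powr tau r b c (padic_val \<nn> + 1)) else 0)"
proof (induction T)
  case 0
  \<comment> \<open>Integrality of \<open>\<nn>\<close>, which uses that p is odd, gives t_n + 1
    \<ge> 1, so the term with \<open>omega\<close> is absent at T = 0.\<close>
  have "\<nn> \<in> zball 0"
    unfolding \<nn>_def shifted_n_def
  proof (intro zball_add n zball_sum)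
    fix i assume i: "i \<in> N_set r b c"
    show "c i ^ 2 / (4 * b i) \<in> zball 0"
    proof (cases "b i = 0")
      case False
      have "\<not> CARD('p) dvd 2 * 2"
        using p prime_dvd_mult_nat[OF prime_card[where 'a='p], of 2 2] by (auto dest!: dvd_imp_le)
      then have "padic_val (of_nat (2 * 2) :: 'p padic) = 0" by (rule padic_val_of_nat)
      then have "padic_norm (4 :: 'p padic) = 1" by (simp add: padic_norm_eq_val)
      moreover have "c i / b i * c i \<in> zball 0"
        using N_set_D(3)[OF i False] bc[of i] i by (intro zball_mult_ints) (auto simp: N_set_def)
      ultimately show ?thesis
        by (simp add: zball_def padic_norm_divide padic_norm_mult padic_norm_power power2_eq_square)
    qed simp
  qed
  then have "\<nn> = 0 \<or> 0 \<le> padic_val \<nn>" by (simp add: zball_iff_val)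
  moreover have "(LINT \<sigma>:padic_ball 0|\<mu>. Ip_integrand \<mu> r n (quad_poly r b c) \<sigma>) = zint (\<lambda>_. 1)"
  proof -
    have "(LINT \<sigma>:padic_ball 0|\<mu>. Ip_integrand \<mu> r n (quad_poly r b c) \<sigma>) = zint (Ip_integrand \<mu> r n (quad_poly r b c))"
      by (simp add: zint_def padic_ball_eq_zball padic_ints_eq_zball)
    also have "\<dots> = zint (\<lambda>_. 1)"
      by (intro zint_cong Ip_integrand_zball n bc)
    finally show ?thesis .
  qed
  ultimately show ?case by (auto simp: sum_term_def)
next
  case (Suc T)
  have "(LINT \<sigma>:padic_ball (Suc T)|\<mu>. Ip_integrand \<mu> r n (quad_poly r b c) \<sigma>)
      = (LINT \<sigma>:padic_ball T|\<mu>. Ip_integrand \<mu> r n (quad_poly r b c) \<sigma>)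
      + of_nat CARD('p) ^ T * (\<Sum>a\<in>{1..<CARD('p)}. zint (\<lambda>z. Ip_integrand \<mu> r n (quad_poly r b c)
          (uniformizer powi (- int (Suc T)) * (of_nat a + uniformizer * z))))"
    by (rule integral_padic_ball_Suc) (rule Ip_integrand_periodic[OF n bc])
  then show ?case
    unfolding shell_contribution[OF p refl \<nn>_def] Suc.IH by (auto simp: distrib_left)
qed

end

text \<open>If t_d and t_n are both infinite, the sum has no upper limit and may diverge: for r = 0
  and n = 0 its terms are p^t. Hence the equivalence of convergence over the balls with summability;
  \<open>sum_term\<close> extends the sum by zeros.\<close>

theorem theorem4p2:
  fixes \<mu> :: "'p::prime_card padic measure"
    and r :: nat and n :: "'p padic" and b c :: "nat \<Rightarrow> 'p padic"
  assumes "CARD('p) \<ge> 3"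
    and "is_padic_haar \<mu>"
    and "n \<in> padic_ints"
    and "\<forall>i\<in>{1..r}. b i \<in> padic_ints \<and> c i \<in> padic_ints"
  shows "(padic_integrable \<mu> (Ip_integrand \<mu> r n (quad_poly r b c)) \<longleftrightarrow>
            summable (sum_term r b c n))
       \<and> (summable (sum_term r b c n) \<longrightarrow>
            Ip \<mu> r n (quad_poly r b c) =
              1 + (1 - 1 / of_nat CARD('p)) * (\<Sum>t. sum_term r b c n t)
                + delta r b c (padic_val (shifted_n r b c n) + 1) * omega r b c n
                  * of_real (real CARD('p) powr tau r b c (padic_val (shifted_n r b c n) + 1)))"
proof -
  interpret padic_haar \<mu> by standard (rule assms(2))
  define \<nn> where "\<nn> = shifted_n r b c n"
  define E where "E = delta r b c (padic_val \<nn> + 1) * omega r b c n * of_real (real CARD('p) powr tau r b c (padic_val \<nn> + 1))"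
  define k :: complex where "k = 1 - 1 / of_nat CARD('p)"
  define S where "S T = (\<Sum>t<T. sum_term r b c n t)" for T
  define A where "A T = (LINT \<sigma>:padic_ball T|\<mu>. Ip_integrand \<mu> r n (quad_poly r b c) \<sigma>)" for T
  \<comment> \<open>A nonzero factor k allows the partial sums to be recovered from the integrals
    over the balls, which gives the converse direction.\<close>
  have k: "k \<noteq> 0" using assms(1) by (auto simp: k_def)
  have A: "A T = 1 + k * S (Suc T) + (if \<nn> \<noteq> 0 \<and> padic_val \<nn> + 1 \<le> int T then E else 0)" for T
    unfolding A_def S_def E_def k_def
    by (rule integral_padic_ball) (use assms in \<open>simp_all add: padic_ints_eq_zball \<nn>_def\<close>)
  \<comment> \<open>For \<open>\<nn> = 0\<close> the argument of \<open>delta\<close> and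
    \<open>tau\<close> is built from the default value \<open>padic_val 0\<close>; t_n = \<infinity>
    forces \<open>omega\<close> to vanish, so E agrees with the absent term.\<close>
  have E0: "E = 0" if "\<nn> = 0"
    using that by (simp add: E_def omega_def t_n_def padic_ord_def flip: \<nn>_def)
  have ev: "\<forall>\<^sub>F T in sequentially. 1 + k * S (Suc T) + E = A T"
    unfolding eventually_sequentially
    by (rule exI[of _ "nat (padic_val \<nn> + 1)"]) (auto simp: A E0)
  have lim: "A \<longlonglongrightarrow> 1 + k * s + E" if "S \<longlonglongrightarrow> s" for s
  proof -
    have "(\<lambda>T. 1 + k * S (Suc T) + E) \<longlonglongrightarrow> 1 + k * s + E"
      using that by (intro tendsto_intros LIMSEQ_Suc)
    then show ?thesis using ev by (rule Lim_transform_eventually)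
  qed
  have conv: "convergent A \<longleftrightarrow> summable (sum_term r b c n)"
  proof
    assume "convergent A"
    then obtain a where a: "A \<longlonglongrightarrow> a" by (auto simp: convergent_def)
    have "(\<lambda>T. (A T - 1 - E) / k) \<longlonglongrightarrow> (a - 1 - E) / k"
      using k by (intro tendsto_intros a)
    moreover have "\<forall>\<^sub>F T in sequentially. (A T - 1 - E) / k = S (Suc T)"
      using ev by eventually_elim (use k in \<open>auto simp: field_simps\<close>)
    ultimately have "(\<lambda>T. S (Suc T)) \<longlonglongrightarrow> (a - 1 - E) / k" by (rule Lim_transform_eventually)
    then have "S \<longlonglongrightarrow> (a - 1 - E) / k" by (rule LIMSEQ_imp_Suc)
    then show "summable (sum_term r b c n)"
      unfolding summable_def sums_def S_def by blast
  next
    assume "summable (sum_term r b c n)"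
    then have "S \<longlonglongrightarrow> (\<Sum>t. sum_term r b c n t)" unfolding S_def by (rule summable_LIMSEQ)
    then show "convergent A" using lim by (auto simp: convergent_def)
  qed
  have val: "lim A = 1 + k * (\<Sum>t. sum_term r b c n t) + E" if "summable (sum_term r b c n)"
    using lim[of "\<Sum>t. sum_term r b c n t"] summable_LIMSEQ[OF that] unfolding S_def by (intro limI)
  show ?thesis
    using conv val unfolding padic_integrable_def Ip_def padic_integral_def A_def E_def k_def \<nn>_def
    by auto
qed

end
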